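(* Let $\Sigma^m$, $m\le 2n-1$, be a submanifold of a complex space form $N^n(c)$. If $V$ is a normal vector field that is parallel in the normal bundle, with $\operatorname{trace} A_V$ constant, then $$\begin{aligned} \frac{1}{2}\Delta|A_V|^2=&\;|\nabla A_V|^2+\frac{c}{4}\Big\{m|A_V|^2+6|tA_V|^2+6\operatorname{trace}(A_V(tA_{nV}))+3\operatorname{trace}(A_VA_{n(tV)})\\ &-(\operatorname{trace} A_V)^2+6\operatorname{trace}(A_V(t(A_Vt)))+3\operatorname{trace}(\langle t(\sigma(A_V\cdot,tV)),\cdot\rangle)\\ &-3\operatorname{trace}(\langle t(\sigma(A_V(tV),\cdot)),\cdot\rangle)+3m\langle A_V(tH),tV\rangle\Big\}\\ &+\sum_{\alpha=m+1}^{2n}\Big\{\operatorname{trace}(A_VA_{\alpha}A_VA_{\alpha}-A_V^2A_{\alpha}^2)+\operatorname{trace}(A_{\alpha})\operatorname{trace}(A_V^2A_{\alpha})-(\operatorname{trace}(A_VA_{\alpha}))^2\Big\}, \end{aligned}$$ where $\{E_{\alpha}\}_{\alpha=m+1}^{2n}$ is a local orthonormal frame field in the normal bundle and $A_\alpha=A_{E_\alpha}$.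
   Context: $N^n(c)$ is a complex space form of complex dimension $n$, complex structure $J$ and constant holomorphic sectional curvature $c$, with curvature tensor $$\bar R(X,Y)Z=\tfrac{c}{4}\{\langle Y,Z\rangle X-\langle X,Z\rangle Y+\langle JY,Z\rangle JX-\langle JX,Z\rangle JY+2\langle X,JY\rangle JZ\},$$ where $\bar R(X,Y)Z=[\bar\nabla_X,\bar\nabla_Y]Z-\bar\nabla_{[X,Y]}Z$. For a submanifold $\Sigma^m$: $\nabla$ is its Levi-Civita connection, $\sigma$ its second fundamental form ($\bar\nabla_XY=\nabla_XY+\sigma(X,Y)$), $H=\frac1m\operatorname{trace}\sigma$ its mean curvature vector field, and $A_V$ the shape operator in the normal direction $V$, $\bar\nabla_XV=-A_VX+\nabla^\perp_XV$; $V$ is parallel in the normal bundle if $\nabla^\perp V=0$. $\Delta=\operatorname{trace}\nabla^2$ is the Laplacian. For any vector $W$ of $N^n(c)$ at a point of $\Sigma$ (tangent or normal to $\Sigma$), $JW=tW+nW$ with $tW$ tangent and $nW$ normal to $\Sigma$. Thus $tA_V$ is the endomorphism $X\mapsto t(A_VX)$, $A_Vt$ is $X\mapsto A_V(tX)$, and so on. Norms of endomorphisms are $|B|^2=\sum_i|BE_i|^2$, and traces of bilinear expressions are taken over a local orthonormal tangent frame $\{E_i\}_{i=1}^m$, e.g. $\operatorname{trace}(\langle t(\sigma(A_V\cdot,tV)),\cdot\rangle)=\sum_{i=1}^m\langle t(\sigma(A_VE_i,tV)),E_i\rangle$. *)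

theory Defs
  imports "HOL-Analysis.Analysis"
begin

text \<open>
  Manifolds are topological spaces with a smooth atlas modelled on a Euclidean space.  A tensor
  field is given in the classical way, as a family of local coordinate expressions, one for each
  chart, that transform into one another under the changes of charts.  The differential operators
  (connections, curvature, Laplacian) are applied to these coordinate expressions; here a tangent
  vector at a point of a chart domain is its coordinate vector in the model space.
\<close>

section \<open>Smooth maps between Euclidean spaces\<close>

abbreviation fderiv :: "('a::real_normed_vector \<Rightarrow> 'b::real_normed_vector) \<Rightarrow> 'a \<Rightarrow> 'a \<Rightarrow> 'b"
  where "fderiv f x \<equiv> frechet_derivative f (at x)"

fun Ck_on :: "nat \<Rightarrow> 'a::euclidean_space set \<Rightarrow> ('a \<Rightarrow> 'b::real_normed_vector) \<Rightarrow> bool" where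
  "Ck_on 0 S f \<longleftrightarrow> continuous_on S f"
| "Ck_on (Suc k) S f \<longleftrightarrow>
     (\<forall>x\<in>S. f differentiable (at x)) \<and> (\<forall>v. Ck_on k S (\<lambda>x. fderiv f x v))"

text \<open>Only used for open sets \<open>S\<close>.\<close>

definition smooth_on :: "'a::euclidean_space set \<Rightarrow> ('a \<Rightarrow> 'b::real_normed_vector) \<Rightarrow> bool"
  where "smooth_on S f \<longleftrightarrow> (\<forall>k. Ck_on k S f)"


section \<open>Manifolds\<close>

text \<open>A chart is a pair of its domain and its coordinate map.\<close>

type_synonym ('p, 'e) chart = "'p set \<times> ('p \<Rightarrow> 'e)"

definition chart_inv :: "('p, 'e) chart \<Rightarrow> 'e \<Rightarrow> 'p"
  where "chart_inv \<phi> = inv_into (fst \<phi>) (snd \<phi>)"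

definition chart_image :: "('p, 'e) chart \<Rightarrow> 'e set"
  where "chart_image \<phi> = snd \<phi> ` fst \<phi>"

definition overlap :: "('p, 'e) chart \<Rightarrow> ('p, 'e) chart \<Rightarrow> 'e set"
  where "overlap \<phi> \<psi> = snd \<phi> ` (fst \<phi> \<inter> fst \<psi>)"

definition transition :: "('p, 'e) chart \<Rightarrow> ('p, 'e) chart \<Rightarrow> 'e \<Rightarrow> 'e"
  where "transition \<phi> \<psi> = snd \<psi> \<circ> chart_inv \<phi>"

definition smooth_manifold :: "'p topology \<Rightarrow> ('p, 'e::euclidean_space) chart set \<Rightarrow> bool"
  where "smooth_manifold X \<A> \<longleftrightarrow>
    Hausdorff_space X \<and> second_countable X \<and>
    topspace X = (\<Union>\<phi>\<in>\<A>. fst \<phi>) \<and>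
    (\<forall>\<phi>\<in>\<A>. openin X (fst \<phi>) \<and> open (chart_image \<phi>) \<and>
        homeomorphic_map (subtopology X (fst \<phi>)) (top_of_set (chart_image \<phi>)) (snd \<phi>)) \<and>
    (\<forall>\<phi>\<in>\<A>. \<forall>\<psi>\<in>\<A>. smooth_on (overlap \<phi> \<psi>) (transition \<phi> \<psi>))"

definition riemannian_metric ::
    "('p, 'e::euclidean_space) chart set \<Rightarrow> (('p, 'e) chart \<Rightarrow> 'e \<Rightarrow> 'e \<Rightarrow> 'e \<Rightarrow> real) \<Rightarrow> bool"
  where "riemannian_metric \<A> g \<longleftrightarrow>
    (\<forall>\<phi>\<in>\<A>. (\<forall>u v. smooth_on (chart_image \<phi>) (\<lambda>x. g \<phi> x u v)) \<and>
       (\<forall>x\<in>chart_image \<phi>. bilinear (g \<phi> x) \<and> (\<forall>u v. g \<phi> x u v = g \<phi> x v u) \<and>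
          (\<forall>u. u \<noteq> 0 \<longrightarrow> g \<phi> x u u > 0))) \<and>
    (\<forall>\<phi>\<in>\<A>. \<forall>\<psi>\<in>\<A>. \<forall>x\<in>overlap \<phi> \<psi>. \<forall>u v.
       g \<phi> x u v = g \<psi> (transition \<phi> \<psi> x)
          (fderiv (transition \<phi> \<psi>) x u) (fderiv (transition \<phi> \<psi>) x v))"

definition almost_complex_structure ::
    "('p, 'e::euclidean_space) chart set \<Rightarrow> (('p, 'e) chart \<Rightarrow> 'e \<Rightarrow> 'e \<Rightarrow> 'e) \<Rightarrow> bool"
  where "almost_complex_structure \<A> J \<longleftrightarrow>
    (\<forall>\<phi>\<in>\<A>. (\<forall>u. smooth_on (chart_image \<phi>) (\<lambda>x. J \<phi> x u)) \<and>
       (\<forall>x\<in>chart_image \<phi>. linear (J \<phi> x) \<and> (\<forall>u. J \<phi> x (J \<phi> x u) = - u))) \<and>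
    (\<forall>\<phi>\<in>\<A>. \<forall>\<psi>\<in>\<A>. \<forall>x\<in>overlap \<phi> \<psi>. \<forall>u.
       J \<psi> (transition \<phi> \<psi> x) (fderiv (transition \<phi> \<psi>) x u) =
         fderiv (transition \<phi> \<psi>) x (J \<phi> x u))"


section \<open>Levi-Civita connection and curvature in a coordinate domain\<close>

text \<open>
  \<open>christoffel g x u v\<close> is \<open>\<nabla>\<^sub>U V\<close> at \<open>x\<close> for the fields \<open>U\<close>, \<open>V\<close> with constant coordinate
  vectors \<open>u\<close>, \<open>v\<close>; since such fields commute, it is determined by the Koszul formula below.
\<close>

definition christoffel ::
    "('e::euclidean_space \<Rightarrow> 'e \<Rightarrow> 'e \<Rightarrow> real) \<Rightarrow> 'e \<Rightarrow> 'e \<Rightarrow> 'e \<Rightarrow> 'e"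
  where "christoffel g x u v = (THE w. \<forall>z. 2 * g x w z =
      fderiv (\<lambda>y. g y v z) x u + fderiv (\<lambda>y. g y u z) x v - fderiv (\<lambda>y. g y u v) x z)"

definition nabla ::
    "('e::euclidean_space \<Rightarrow> 'e \<Rightarrow> 'e \<Rightarrow> real) \<Rightarrow> ('e \<Rightarrow> 'e) \<Rightarrow> ('e \<Rightarrow> 'e) \<Rightarrow> 'e \<Rightarrow> 'e"
  where "nabla g X Y x = fderiv Y x (X x) + christoffel g x (X x) (Y x)"

definition lie_bracket :: "('e::euclidean_space \<Rightarrow> 'e) \<Rightarrow> ('e \<Rightarrow> 'e) \<Rightarrow> 'e \<Rightarrow> 'e"
  where "lie_bracket X Y x = fderiv Y x (X x) - fderiv X x (Y x)"

definition curvature ::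
    "('e::euclidean_space \<Rightarrow> 'e \<Rightarrow> 'e \<Rightarrow> real) \<Rightarrow> ('e \<Rightarrow> 'e) \<Rightarrow> ('e \<Rightarrow> 'e) \<Rightarrow> ('e \<Rightarrow> 'e) \<Rightarrow> 'e \<Rightarrow> 'e"
  where "curvature g X Y Z x =
    nabla g X (nabla g Y Z) x - nabla g Y (nabla g X Z) x - nabla g (lie_bracket X Y) Z x"


section \<open>Complex space forms\<close>

definition kaehler_manifold ::
    "'p topology \<Rightarrow> ('p, 'e::euclidean_space) chart set \<Rightarrow>
     (('p, 'e) chart \<Rightarrow> 'e \<Rightarrow> 'e \<Rightarrow> 'e \<Rightarrow> real) \<Rightarrow> (('p, 'e) chart \<Rightarrow> 'e \<Rightarrow> 'e \<Rightarrow> 'e) \<Rightarrow> bool"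
  where "kaehler_manifold M \<A> g J \<longleftrightarrow>
    smooth_manifold M \<A> \<and> riemannian_metric \<A> g \<and> almost_complex_structure \<A> J \<and>
    (\<forall>\<phi>\<in>\<A>. \<forall>x\<in>chart_image \<phi>. \<forall>u v. g \<phi> x (J \<phi> x u) (J \<phi> x v) = g \<phi> x u v) \<and>
    (\<forall>\<phi>\<in>\<A>. \<forall>X Y. smooth_on (chart_image \<phi>) X \<longrightarrow> smooth_on (chart_image \<phi>) Y \<longrightarrow>
       (\<forall>x\<in>chart_image \<phi>.
          nabla (g \<phi>) X (\<lambda>y. J \<phi> y (Y y)) x = J \<phi> x (nabla (g \<phi>) X Y x)))"

text \<open>
  Constant holomorphic sectional curvature \<open>c\<close> is expressed through the curvature tensor; see
  \<open>holomorphic_sectional_curvature\<close> below.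
\<close>

definition complex_space_form ::
    "nat \<Rightarrow> real \<Rightarrow> 'p topology \<Rightarrow> ('p, 'e::euclidean_space) chart set \<Rightarrow>
     (('p, 'e) chart \<Rightarrow> 'e \<Rightarrow> 'e \<Rightarrow> 'e \<Rightarrow> real) \<Rightarrow> (('p, 'e) chart \<Rightarrow> 'e \<Rightarrow> 'e \<Rightarrow> 'e) \<Rightarrow> bool"
  where "complex_space_form n c M \<A> g J \<longleftrightarrow>
    DIM('e) = 2 * n \<and> kaehler_manifold M \<A> g J \<and>
    (\<forall>\<phi>\<in>\<A>. \<forall>X Y Z. smooth_on (chart_image \<phi>) X \<longrightarrow> smooth_on (chart_image \<phi>) Y \<longrightarrow>
       smooth_on (chart_image \<phi>) Z \<longrightarrow>
       (\<forall>x\<in>chart_image \<phi>. curvature (g \<phi>) X Y Z x = (c / 4) *\<^sub>R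
          (g \<phi> x (Y x) (Z x) *\<^sub>R X x - g \<phi> x (X x) (Z x) *\<^sub>R Y x
           + g \<phi> x (J \<phi> x (Y x)) (Z x) *\<^sub>R J \<phi> x (X x)
           - g \<phi> x (J \<phi> x (X x)) (Z x) *\<^sub>R J \<phi> x (Y x)
           + (2 * g \<phi> x (X x) (J \<phi> x (Y x))) *\<^sub>R J \<phi> x (Z x))))"


section \<open>Submanifolds\<close>

text \<open>
  A submanifold is a manifold \<open>(X, \<A>)\<close> with an immersion \<open>f\<close> into the ambient manifold
  \<open>(Y, \<B>)\<close>, endowed with the induced metric.  Embedded submanifolds are the case in which \<open>f\<close>
  is an embedding.
\<close>

definition rep_dom :: "('p \<Rightarrow> 'q) \<Rightarrow> ('p, 'e) chart \<Rightarrow> ('q, 'f) chart \<Rightarrow> 'e set"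
  where "rep_dom f \<phi> \<psi> = snd \<phi> ` (fst \<phi> \<inter> f -` fst \<psi>)"

definition rep :: "('p \<Rightarrow> 'q) \<Rightarrow> ('p, 'e) chart \<Rightarrow> ('q, 'f) chart \<Rightarrow> 'e \<Rightarrow> 'f"
  where "rep f \<phi> \<psi> = snd \<psi> \<circ> f \<circ> chart_inv \<phi>"

definition immersed_submanifold ::
    "'p topology \<Rightarrow> ('p, 'e::euclidean_space) chart set \<Rightarrow>
     'q topology \<Rightarrow> ('q, 'f::euclidean_space) chart set \<Rightarrow> ('p \<Rightarrow> 'q) \<Rightarrow> bool"
  where "immersed_submanifold X \<A> Y \<B> f \<longleftrightarrow>
    smooth_manifold X \<A> \<and> smooth_manifold Y \<B> \<and> continuous_map X Y f \<and>
    (\<forall>\<phi>\<in>\<A>. \<forall>\<psi>\<in>\<B>. smooth_on (rep_dom f \<phi> \<psi>) (rep f \<phi> \<psi>) \<and>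
       (\<forall>x\<in>rep_dom f \<phi> \<psi>. inj (fderiv (rep f \<phi> \<psi>) x)))"

text \<open>
  A vector field along \<open>f\<close>: \<open>V \<psi> p\<close> is the coordinate vector, in the chart \<open>\<psi>\<close> of the ambient
  manifold, of the tangent vector at \<open>f p\<close>.
\<close>

definition vector_field_along ::
    "'p topology \<Rightarrow> ('p, 'e::euclidean_space) chart set \<Rightarrow> ('q, 'f::euclidean_space) chart set \<Rightarrow>
     ('p \<Rightarrow> 'q) \<Rightarrow> (('q, 'f) chart \<Rightarrow> 'p \<Rightarrow> 'f) \<Rightarrow> bool"
  where "vector_field_along X \<A> \<B> f V \<longleftrightarrow>
    (\<forall>\<phi>\<in>\<A>. \<forall>\<psi>\<in>\<B>. smooth_on (rep_dom f \<phi> \<psi>) (V \<psi> \<circ> chart_inv \<phi>)) \<and>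
    (\<forall>\<psi>\<in>\<B>. \<forall>\<psi>'\<in>\<B>. \<forall>p\<in>topspace X. f p \<in> fst \<psi> \<inter> fst \<psi>' \<longrightarrow>
       V \<psi>' p = fderiv (transition \<psi> \<psi>') (snd \<psi> (f p)) (V \<psi> p))"

text \<open>
  In the remainder of this section \<open>g\<close> is the coordinate expression of the ambient metric and \<open>F\<close>
  that of the immersion.  Vectors tangent to the submanifold are coordinate vectors in \<open>'e\<close>,
  identified with ambient vectors in \<open>'f\<close> by \<open>fderiv F x\<close>.
\<close>

definition induced_metric ::
    "('f::euclidean_space \<Rightarrow> 'f \<Rightarrow> 'f \<Rightarrow> real) \<Rightarrow> ('e::euclidean_space \<Rightarrow> 'f) \<Rightarrow>
     'e \<Rightarrow> 'e \<Rightarrow> 'e \<Rightarrow> real"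
  where "induced_metric g F x u v = g (F x) (fderiv F x u) (fderiv F x v)"

definition tangential ::
    "('f::euclidean_space \<Rightarrow> 'f \<Rightarrow> 'f \<Rightarrow> real) \<Rightarrow> ('e::euclidean_space \<Rightarrow> 'f) \<Rightarrow> 'e \<Rightarrow> 'f \<Rightarrow> 'e"
  where "tangential g F x w =
    (THE u. \<forall>v. g (F x) (w - fderiv F x u) (fderiv F x v) = 0)"

definition normal_part ::
    "('f::euclidean_space \<Rightarrow> 'f \<Rightarrow> 'f \<Rightarrow> real) \<Rightarrow> ('e::euclidean_space \<Rightarrow> 'f) \<Rightarrow> 'e \<Rightarrow> 'f \<Rightarrow> 'f"
  where "normal_part g F x w = w - fderiv F x (tangential g F x w)"

definition normal_field_on ::
    "('f::euclidean_space \<Rightarrow> 'f \<Rightarrow> 'f \<Rightarrow> real) \<Rightarrow> ('e::euclidean_space \<Rightarrow> 'f) \<Rightarrow> 'e set \<Rightarrow>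
     ('e \<Rightarrow> 'f) \<Rightarrow> bool"
  where "normal_field_on g F S W \<longleftrightarrow> (\<forall>x\<in>S. \<forall>v. g (F x) (W x) (fderiv F x v) = 0)"

definition nabla_along ::
    "('f::euclidean_space \<Rightarrow> 'f \<Rightarrow> 'f \<Rightarrow> real) \<Rightarrow> ('e::euclidean_space \<Rightarrow> 'f) \<Rightarrow>
     ('e \<Rightarrow> 'f) \<Rightarrow> 'e \<Rightarrow> 'e \<Rightarrow> 'f"
  where "nabla_along g F W x u = fderiv W x u + christoffel g (F x) (fderiv F x u) (W x)"

text \<open>The Gauss formula, for the tangent fields with constant coordinate vectors \<open>u\<close> and \<open>v\<close>.\<close>

definition second_fundamental_form ::
    "('f::euclidean_space \<Rightarrow> 'f \<Rightarrow> 'f \<Rightarrow> real) \<Rightarrow> ('e::euclidean_space \<Rightarrow> 'f) \<Rightarrow>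
     'e \<Rightarrow> 'e \<Rightarrow> 'e \<Rightarrow> 'f"
  where "second_fundamental_form g F x u v =
    nabla_along g F (\<lambda>y. fderiv F y v) x u
      - fderiv F x (nabla (induced_metric g F) (\<lambda>_. u) (\<lambda>_. v) x)"

text \<open>The Weingarten formula; here \<open>W\<close> is a normal field.\<close>

definition shape_operator ::
    "('f::euclidean_space \<Rightarrow> 'f \<Rightarrow> 'f \<Rightarrow> real) \<Rightarrow> ('e::euclidean_space \<Rightarrow> 'f) \<Rightarrow>
     ('e \<Rightarrow> 'f) \<Rightarrow> 'e \<Rightarrow> 'e \<Rightarrow> 'e"
  where "shape_operator g F W x u = - tangential g F x (nabla_along g F W x u)"

definition normal_connection ::
    "('f::euclidean_space \<Rightarrow> 'f \<Rightarrow> 'f \<Rightarrow> real) \<Rightarrow> ('e::euclidean_space \<Rightarrow> 'f) \<Rightarrow>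
     ('e \<Rightarrow> 'f) \<Rightarrow> 'e \<Rightarrow> 'e \<Rightarrow> 'f"
  where "normal_connection g F W x u = normal_part g F x (nabla_along g F W x u)"


section \<open>Metric traces, norms and the Laplacian\<close>

definition orthonormal_frame ::
    "('e::euclidean_space \<Rightarrow> 'e \<Rightarrow> real) \<Rightarrow> (nat \<Rightarrow> 'e) \<Rightarrow> bool"
  where "orthonormal_frame h E \<longleftrightarrow>
    (\<forall>i<DIM('e). \<forall>j<DIM('e). h (E i) (E j) = (if i = j then 1 else 0))"

text \<open>For bilinear \<open>\<beta>\<close> the value does not depend on the frame.\<close>

definition form_trace ::
    "('e::euclidean_space \<Rightarrow> 'e \<Rightarrow> real) \<Rightarrow> ('e \<Rightarrow> 'e \<Rightarrow> 'b::real_vector) \<Rightarrow> 'b"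
  where "form_trace h \<beta> =
    (let E = (SOME E. orthonormal_frame h E) in \<Sum>i<DIM('e). \<beta> (E i) (E i))"

definition end_trace :: "('e::euclidean_space \<Rightarrow> 'e \<Rightarrow> real) \<Rightarrow> ('e \<Rightarrow> 'e) \<Rightarrow> real"
  where "end_trace h B = form_trace h (\<lambda>u v. h (B u) v)"

definition end_norm_sq :: "('e::euclidean_space \<Rightarrow> 'e \<Rightarrow> real) \<Rightarrow> ('e \<Rightarrow> 'e) \<Rightarrow> real"
  where "end_norm_sq h B = form_trace h (\<lambda>u v. h (B u) (B v))"

text \<open>\<open>(\<nabla>\<^sub>u A) v = \<nabla>\<^sub>u (A v) - A (\<nabla>\<^sub>u v)\<close> for a field \<open>A\<close> of endomorphisms.\<close>

definition nabla_end ::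
    "('e::euclidean_space \<Rightarrow> 'e \<Rightarrow> 'e \<Rightarrow> real) \<Rightarrow> ('e \<Rightarrow> 'e \<Rightarrow> 'e) \<Rightarrow> 'e \<Rightarrow> 'e \<Rightarrow> 'e \<Rightarrow> 'e"
  where "nabla_end h A x u v =
    nabla h (\<lambda>_. u) (\<lambda>y. A y v) x - A x (nabla h (\<lambda>_. u) (\<lambda>_. v) x)"

definition nabla_end_norm_sq ::
    "('e::euclidean_space \<Rightarrow> 'e \<Rightarrow> 'e \<Rightarrow> real) \<Rightarrow> ('e \<Rightarrow> 'e \<Rightarrow> 'e) \<Rightarrow> 'e \<Rightarrow> real"
  where "nabla_end_norm_sq h A x =
    form_trace (h x) (\<lambda>u u'. form_trace (h x) (\<lambda>v v'.
      h x (nabla_end h A x u v) (nabla_end h A x u' v')))"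

definition laplacian ::
    "('e::euclidean_space \<Rightarrow> 'e \<Rightarrow> 'e \<Rightarrow> real) \<Rightarrow> ('e \<Rightarrow> real) \<Rightarrow> 'e \<Rightarrow> real"
  where "laplacian h r x = form_trace (h x) (\<lambda>u v.
    fderiv (\<lambda>y. fderiv r y v) x u - fderiv r x (nabla h (\<lambda>_. u) (\<lambda>_. v) x))"

definition mean_curvature ::
    "('f::euclidean_space \<Rightarrow> 'f \<Rightarrow> 'f \<Rightarrow> real) \<Rightarrow> ('e::euclidean_space \<Rightarrow> 'f) \<Rightarrow> 'e \<Rightarrow> 'f"
  where "mean_curvature g F x =
    (1 / real DIM('e)) *\<^sub>R form_trace (induced_metric g F x) (second_fundamental_form g F x)"

text \<open>
  A local orthonormal frame field of the normal bundle over \<open>S\<close>, indexed by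
  \<open>m + 1, \<dots>, 2n\<close> where \<open>m\<close> and \<open>2n\<close> are the dimensions of submanifold and ambient manifold.
\<close>

definition normal_frame_on ::
    "('f::euclidean_space \<Rightarrow> 'f \<Rightarrow> 'f \<Rightarrow> real) \<Rightarrow> ('e::euclidean_space \<Rightarrow> 'f) \<Rightarrow> 'e set \<Rightarrow>
     (nat \<Rightarrow> 'e \<Rightarrow> 'f) \<Rightarrow> bool"
  where "normal_frame_on g F S \<nu> \<longleftrightarrow>
    (\<forall>\<alpha>\<in>{DIM('e)+1..DIM('f)}. smooth_on S (\<nu> \<alpha>) \<and> normal_field_on g F S (\<nu> \<alpha>)) \<and>
    (\<forall>x\<in>S. \<forall>\<alpha>\<in>{DIM('e)+1..DIM('f)}. \<forall>\<beta>\<in>{DIM('e)+1..DIM('f)}.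
       g (F x) (\<nu> \<alpha> x) (\<nu> \<beta> x) = (if \<alpha> = \<beta> then 1 else 0))"


section \<open>The connection and the holomorphic sectional curvature\<close>

lemma holomorphic_sectional_curvature:
  fixes \<phi> :: "('p, 'e::euclidean_space) chart"
  assumes N: "complex_space_form n c M \<A> g J" and \<phi>: "\<phi> \<in> \<A>" and x: "x \<in> chart_image \<phi>"
  shows "g \<phi> x (curvature (g \<phi>) (\<lambda>_. u) (\<lambda>y. J \<phi> y u) (\<lambda>y. J \<phi> y u) x) u = c * (g \<phi> x u u)\<^sup>2"
proof -
  let ?g = "g \<phi> x" and ?J = "J \<phi> x"
  have K: "kaehler_manifold M \<A> g J" using N by (simp add: complex_space_form_def)
  have bil: "bilinear ?g" and sym: "\<And>a b. ?g a b = ?g b a"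
    using K \<phi> x by (auto simp: kaehler_manifold_def riemannian_metric_def)
  have JJ: "?J (?J a) = - a" and smJ: "smooth_on (chart_image \<phi>) (\<lambda>y. J \<phi> y a)"
    and lin: "linear ?J" for a
    using K \<phi> x by (auto simp: kaehler_manifold_def almost_complex_structure_def)
  have herm: "?g (?J a) (?J b) = ?g a b" for a b
    using K \<phi> x by (auto simp: kaehler_manifold_def)
  have "Ck_on k (chart_image \<phi>) (\<lambda>_. a)" for k and a :: 'e
    by (induction k arbitrary: a) (auto simp: frechet_derivative_const)
  then have smc: "smooth_on (chart_image \<phi>) (\<lambda>_. u)" by (simp add: smooth_on_def)
  have "?g u (?J u) = ?g (?J u) (?J (?J u))" by (simp only: herm)
  also have "\<dots> = - ?g u (?J u)" using sym[of u] by (simp add: JJ bilinear_rneg[OF bil])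
  finally have orth: "?g u (?J u) = 0" "?g (?J u) u = 0" using sym[of u] by simp_all
  have "curvature (g \<phi>) (\<lambda>_. u) (\<lambda>y. J \<phi> y u) (\<lambda>y. J \<phi> y u) x = (c / 4) *\<^sub>R
     (?g (?J u) (?J u) *\<^sub>R u - ?g u (?J u) *\<^sub>R ?J u
      + ?g (?J (?J u)) (?J u) *\<^sub>R ?J u - ?g (?J u) (?J u) *\<^sub>R ?J (?J u)
      + (2 * ?g u (?J (?J u))) *\<^sub>R ?J (?J u))"
    using N \<phi> x smc smJ unfolding complex_space_form_def by blast
  also have "\<dots> = (c * ?g u u) *\<^sub>R u"
    by (simp add: JJ herm orth bilinear_lneg[OF bil] bilinear_rneg[OF bil] flip: scaleR_add_left)
  finally show ?thesis by (simp add: bilinear_lmul[OF bil] power2_eq_square)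
qed
lemma christoffel_koszul:
  fixes g :: "'e::euclidean_space \<Rightarrow> 'e \<Rightarrow> 'e \<Rightarrow> real"
  assumes S: "x \<in> S" "open S"
    and bil: "\<And>y. y \<in> S \<Longrightarrow> bilinear (g y)"
    and pos: "\<And>u. u \<noteq> 0 \<Longrightarrow> g x u u > 0"
    and diff: "\<And>u v. (\<lambda>y. g y u v) differentiable (at x)"
  shows "2 * g x (christoffel g x u v) z =
    fderiv (\<lambda>y. g y v z) x u + fderiv (\<lambda>y. g y u z) x v - fderiv (\<lambda>y. g y u v) x z"
proof -
  let ?l = "\<lambda>z. fderiv (\<lambda>y. g y v z) x u + fderiv (\<lambda>y. g y u z) x v - fderiv (\<lambda>y. g y u v) x z"
  have bx: "bilinear (g x)" using bil S by blast
  have lin1: "linear (\<lambda>z. fderiv (\<lambda>y. g y a z) x b)" for a b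
  proof (rule linearI)
    fix z1 z2
    have "((\<lambda>y. g y a z1 + g y a z2) has_derivative
        (\<lambda>b. fderiv (\<lambda>y. g y a z1) x b + fderiv (\<lambda>y. g y a z2) x b)) (at x)"
      by (intro has_derivative_add) (metis diff frechet_derivative_works)+
    moreover have "\<And>y. y \<in> S \<Longrightarrow> g y a z1 + g y a z2 = g y a (z1 + z2)"
      using bil by (simp add: bilinear_radd)
    ultimately have "((\<lambda>y. g y a (z1 + z2)) has_derivative
        (\<lambda>b. fderiv (\<lambda>y. g y a z1) x b + fderiv (\<lambda>y. g y a z2) x b)) (at x)"
      by (rule has_derivative_transform_within_open[OF _ S(2,1)])
    from frechet_derivative_at[OF this]
    show "fderiv (\<lambda>y. g y a (z1 + z2)) x b = fderiv (\<lambda>y. g y a z1) x b + fderiv (\<lambda>y. g y a z2) x b"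
      by metis
  next
    fix r z1
    have "((\<lambda>y. r *\<^sub>R g y a z1) has_derivative (\<lambda>b. r *\<^sub>R fderiv (\<lambda>y. g y a z1) x b)) (at x)"
      by (intro has_derivative_scaleR_right) (metis diff frechet_derivative_works)
    moreover have "\<And>y. y \<in> S \<Longrightarrow> r *\<^sub>R g y a z1 = g y a (r *\<^sub>R z1)"
      using bil by (simp add: bilinear_rmul)
    ultimately have "((\<lambda>y. g y a (r *\<^sub>R z1)) has_derivative
        (\<lambda>b. r *\<^sub>R fderiv (\<lambda>y. g y a z1) x b)) (at x)"
      by (rule has_derivative_transform_within_open[OF _ S(2,1)])
    from frechet_derivative_at[OF this]
    show "fderiv (\<lambda>y. g y a (r *\<^sub>R z1)) x b = r *\<^sub>R fderiv (\<lambda>y. g y a z1) x b"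
      by metis
  qed
  have lin2: "linear (fderiv (\<lambda>y. g y u v) x)"
    using diff linear_frechet_derivative by blast
  have linl: "linear ?l"
    by (intro linear_compose_add linear_compose_sub lin1 lin2)
  define T where "T = (\<lambda>w. \<Sum>b\<in>Basis. (2 * g x w b) *\<^sub>R b)"
  have linr: "linear (\<lambda>z. 2 * g x w z)" for w
    using bx by (auto intro!: linearI simp: bilinear_radd bilinear_rmul algebra_simps)
  have Tin: "T w \<bullet> z = 2 * g x w z" for w z
  proof -
    have "2 * g x w z = (\<Sum>b\<in>Basis. (z \<bullet> b) *\<^sub>R (2 * g x w b))"
    proof -
      have "2 * g x w z = 2 * g x w (\<Sum>b\<in>Basis. (z \<bullet> b) *\<^sub>R b)"
        by (simp only: euclidean_representation)
      also have "\<dots> = (\<Sum>b\<in>Basis. (z \<bullet> b) *\<^sub>R (2 * g x w b))"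
        by (simp only: linear_sum[OF linr] linear_scale[OF linr])
      finally show ?thesis .
    qed
    then show ?thesis
      by (simp add: T_def inner_sum_left inner_sum_right inner_commute mult.commute)
  qed
  have "linear T"
    unfolding T_def using bx
    by (auto intro!: linearI simp: bilinear_ladd bilinear_lmul algebra_simps
        sum.distrib scaleR_sum_right)
  moreover have "inj T"
  proof (subst linear_injective_0[OF \<open>linear T\<close>], intro allI impI)
    fix w assume "T w = 0"
    then have "g x w w = 0" using Tin[of w w] by simp
    then show "w = 0" using pos[of w] by force
  qed
  ultimately have "surj T" by (simp add: linear_injective_imp_surjective)
  define l where "l = ?l"
  have linl': "linear l" unfolding l_def by (rule linl)
  obtain w where w: "(\<Sum>b\<in>Basis. l b *\<^sub>R b) = T w"
    using surjD[OF \<open>surj T\<close>, of "\<Sum>b\<in>Basis. l b *\<^sub>R b"] by blast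
  have "2 * g x w z = l z" for z
  proof -
    have "l z = l (\<Sum>b\<in>Basis. (z \<bullet> b) *\<^sub>R b)" by (simp only: euclidean_representation)
    also have "\<dots> = (\<Sum>b\<in>Basis. (z \<bullet> b) *\<^sub>R l b)"
      by (simp only: linear_sum[OF linl'] linear_scale[OF linl'])
    also have "\<dots> = T w \<bullet> z"
      unfolding w[symmetric] by (simp add: inner_sum_left inner_sum_right inner_commute mult.commute)
    finally show ?thesis using Tin by simp
  qed
  then have wz: "2 * g x w z = ?l z" for z by (simp add: l_def)
  have "\<forall>z. 2 * g x (christoffel g x u v) z = ?l z"
    unfolding christoffel_def
  proof (rule theI[where a = w])
    show "\<forall>z. 2 * g x w z = ?l z" using wz by blast
  next
    fix w' assume "\<forall>z. 2 * g x w' z = ?l z"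
    then have "T w' \<bullet> z = T w \<bullet> z" for z using wz Tin by simp
    then have "T w' = T w" by (metis inner_commute vector_eq_ldot)
    then show "w' = w" using \<open>inj T\<close> by (simp add: inj_eq)
  qed
  then show ?thesis by blast
qed

lemma christoffel_levi_civita:
  fixes g :: "'e::euclidean_space \<Rightarrow> 'e \<Rightarrow> 'e \<Rightarrow> real"
  assumes S: "x \<in> S" "open S"
    and bil: "\<And>y. y \<in> S \<Longrightarrow> bilinear (g y)"
    and sym: "\<And>y u v. y \<in> S \<Longrightarrow> g y u v = g y v u"
    and pos: "\<And>u. u \<noteq> 0 \<Longrightarrow> g x u u > 0"
    and diff: "\<And>u v. (\<lambda>y. g y u v) differentiable (at x)"
  shows torsion_free: "christoffel g x u v = christoffel g x v u"
    and metric: "fderiv (\<lambda>y. g y u v) x z =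
      g x (christoffel g x z u) v + g x u (christoffel g x z v)"
proof -
  have fs: "fderiv (\<lambda>y. g y a b) x = fderiv (\<lambda>y. g y b a) x" for a b
  proof -
    have "((\<lambda>y. g y a b) has_derivative fderiv (\<lambda>y. g y a b) x) (at x)"
      using diff frechet_derivative_works by blast
    then have "((\<lambda>y. g y b a) has_derivative fderiv (\<lambda>y. g y a b) x) (at x)"
      by (rule has_derivative_transform_within_open[OF _ S(2,1)]) (rule sym)
    then show ?thesis by (rule frechet_derivative_at)
  qed
  note K = christoffel_koszul[OF S bil pos diff]
  show "christoffel g x u v = christoffel g x v u"
    unfolding christoffel_def by (simp only: fs[of u v] add.commute)
  show "fderiv (\<lambda>y. g y u v) x z = g x (christoffel g x z u) v + g x u (christoffel g x z v)"
    using K[of z u v] K[of z v u] fs[of u v] sym[OF S(1), of u "christoffel g x z v"] by simp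
qed

end

theory Submission
  imports Defs
begin

text \<open>
  Write \<open>A\<close> for the shape operator of the parallel field \<open>V\<close> and \<open>T = tV\<close>. Since \<open>A\<close> is self-adjoint,
  \<open>|A|\<^sup>2 = trace (A A)\<close>, and in a chart the trace is a fixed linear functional, so differentiating
  twice gives \<open>\<Delta>|A|\<^sup>2 / 2 = |\<nabla>A|\<^sup>2 + \<Sum>\<^sub>i\<^sub>j \<langle>(\<nabla>\<^sup>2\<^sub>i\<^sub>i A) E\<^sub>j, A E\<^sub>j\<rangle>\<close>. The Codazzi equation
  \<open>(\<nabla>\<^sub>X A) Y - (\<nabla>\<^sub>Y A) X = P(X, Y)\<close>, where \<open>P\<close> is built from \<open>t\<close> and \<open>T\<close>, turns
  \<open>(\<nabla>\<^sup>2\<^sub>i\<^sub>i A) E\<^sub>j\<close> into \<open>(\<nabla>\<^sup>2\<^sub>i\<^sub>j A) E\<^sub>i\<close>, the Ricci identity into \<open>(\<nabla>\<^sup>2\<^sub>j\<^sub>i A) E\<^sub>i\<close>, and self-adjointness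
  together with a second use of Codazzi into the trace of a second derivative of \<open>A\<close>, which
  vanishes since \<open>trace A\<close> is constant. What remains are curvature terms, given by the Gauss equation,
  and \<open>\<nabla>P\<close>, given by \<open>\<nabla>\<^sub>X T = A\<^sub>n\<^sub>V X - t A X\<close> and \<open>(\<nabla>\<^sub>X t) Y = A\<^sub>n\<^sub>Y X + t \<sigma>(X, Y)\<close>.
\<close>

section \<open>Smooth functions\<close>

text \<open>The frame hidden in \<open>form_trace\<close> is chosen by \<open>SOME\<close> at each
  point separately, so nothing may be differentiated through it. Derivatives are therefore taken
  only of coordinate traces and of fields given in coordinates, and orthonormal frames are summed
  over only at one fixed point, after all identities have become tensorial. Constant vectors
  commute, which removes Lie brackets, but they are not parallel: iterated derivatives carry
  Christoffel terms, and these must be subtracted before the Codazzi and Ricci exchanges close up.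
  Christoffel symbols and tangential parts are given by definite descriptions; they become tractable
  as the vectors that represent smooth families of linear forms in the metric. The final contraction
  is linear algebra at a point and is kept apart from the analysis. There every coefficient 3 is 1 +
  2, where the 2 goes back to the summand 2<X,JY>JZ of the ambient curvature tensor or to its trace
  in the Codazzi equation, and every 6 is the sum of two such contributions.\<close>

lemma fderiv_works:
  "f differentiable (at x) \<Longrightarrow> (f has_derivative fderiv f x) (at x)"
  using frechet_derivative_works by blast

lemma fderiv_eqI: "(f has_derivative f') (at x) \<Longrightarrow> fderiv f x = f'"
  by (metis frechet_derivative_at)

lemma fderiv_cong_open:
  assumes "open S" "x \<in> S" "\<And>y. y \<in> S \<Longrightarrow> f y = g y" "f differentiable (at x)"
  shows "g differentiable (at x)" "fderiv g x = fderiv f x"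
proof -
  have "(g has_derivative fderiv f x) (at x)"
    by (rule has_derivative_transform_within_open[OF fderiv_works[OF assms(4)] assms(1,2)])
      (use assms(3) in auto)
  then show "g differentiable (at x)" "fderiv g x = fderiv f x"
    by (auto simp: differentiable_def dest: fderiv_eqI)
qed

section \<open>Closure properties of C^k maps on open sets\<close>

text \<open>On an open set a derivative depends only on the values in that set. Each closure proof
  below uses this to replace \<open>fderiv\<close> of a compound map by its explicit
  formula.\<close>

lemma Ck_on_cong:
  assumes "open S" "\<And>y. y \<in> S \<Longrightarrow> f y = g y" "Ck_on k S f"
  shows "Ck_on k S g"
  using assms(2,3)
proof (induction k arbitrary: f g)
  case 0
  then show ?case by (auto cong: continuous_on_cong)
next
  case (Suc k)
  have d: "g differentiable (at x)" "fderiv g x = fderiv f x" if "x \<in> S" for x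
    using fderiv_cong_open[OF assms(1) that, of f g] Suc.prems that by auto
  have "Ck_on k S (\<lambda>x. fderiv g x v)" for v
    using Suc.IH[of "\<lambda>x. fderiv f x v" "\<lambda>x. fderiv g x v"] Suc.prems d by simp
  then show ?case using d by simp
qed

text \<open>Product and chain rules mix differentiated and undifferentiated factors; the latter have
  to be lowered from order \<open>Suc k\<close> to \<open>k\<close> before an induction hypothesis
  applies.\<close>

lemma Ck_on_SucD: "Ck_on (Suc k) S f \<Longrightarrow> Ck_on k S f"
proof (induction k arbitrary: f)
  case 0
  then show ?case
    by (auto intro!: continuous_at_imp_continuous_on differentiable_imp_continuous_within)
next
  case (Suc k)
  show ?case unfolding Ck_on.simps(2)[of k S f]
    using Suc.prems Suc.IH unfolding Ck_on.simps(2)[of "Suc k"] by simp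
qed

lemma Ck_on_subset: "Ck_on k S f \<Longrightarrow> T \<subseteq> S \<Longrightarrow> Ck_on k T f"
  by (induction k arbitrary: f) (auto intro: continuous_on_subset)

lemma Ck_on_const: "Ck_on k S (\<lambda>_. a)"
  by (induction k arbitrary: a) (auto simp: frechet_derivative_const)

lemma Ck_on_linear:
  assumes "bounded_linear l" "open S" "Ck_on k S f"
  shows "Ck_on k S (\<lambda>x. l (f x))"
  using assms(3)
proof (induction k arbitrary: f)
  case 0
  then show ?case using bounded_linear.continuous_on[OF assms(1)] by simp
next
  case (Suc k)
  have d: "((\<lambda>x. l (f x)) has_derivative (\<lambda>v. l (fderiv f x v))) (at x)" if "x \<in> S" for x
    using Suc.prems that by (intro bounded_linear.has_derivative[OF assms(1)] fderiv_works) auto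
  have "Ck_on k S (\<lambda>x. fderiv (\<lambda>x. l (f x)) x v)" for v
    by (rule Ck_on_cong[OF assms(2) _ Suc.IH[of "\<lambda>x. fderiv f x v"]])
      (use Suc.prems in \<open>simp_all add: fderiv_eqI[OF d]\<close>)
  then show ?case using d by (auto simp: differentiable_def)
qed

lemma Ck_on_add:
  assumes "open S" "Ck_on k S f" "Ck_on k S g"
  shows "Ck_on k S (\<lambda>x. f x + g x)"
  using assms(2,3)
proof (induction k arbitrary: f g)
  case 0
  then show ?case by (simp add: continuous_on_add)
next
  case (Suc k)
  have d: "((\<lambda>x. f x + g x) has_derivative (\<lambda>v. fderiv f x v + fderiv g x v)) (at x)" if "x \<in> S" for x
    using Suc.prems that by (intro has_derivative_add fderiv_works) auto
  have "Ck_on k S (\<lambda>x. fderiv (\<lambda>x. f x + g x) x v)" for v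
    by (rule Ck_on_cong[OF assms(1) _ Suc.IH[of "\<lambda>x. fderiv f x v" "\<lambda>x. fderiv g x v"]])
      (use Suc.prems in \<open>simp_all add: fderiv_eqI[OF d]\<close>)
  then show ?case using d by (auto simp: differentiable_def)
qed

lemma Ck_on_scaleR:
  assumes "open S" "Ck_on k S f" "Ck_on k S g"
  shows "Ck_on k S (\<lambda>x. f x *\<^sub>R g x)"
  using assms(2,3)
proof (induction k arbitrary: f g)
  case 0
  then show ?case by (simp add: continuous_on_scaleR)
next
  case (Suc k)
  have d: "((\<lambda>x. f x *\<^sub>R g x) has_derivative (\<lambda>v. f x *\<^sub>R fderiv g x v + fderiv f x v *\<^sub>R g x)) (at x)"
    if "x \<in> S" for x
    using Suc.prems that by (intro has_derivative_scaleR fderiv_works) auto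
  have "Ck_on k S (\<lambda>x. fderiv (\<lambda>x. f x *\<^sub>R g x) x v)" for v
    by (rule Ck_on_cong[OF assms(1), of "\<lambda>x. f x *\<^sub>R fderiv g x v + fderiv f x v *\<^sub>R g x"])
      (use Suc.prems Ck_on_SucD[OF Suc.prems(1)] Ck_on_SucD[OF Suc.prems(2)] in
        \<open>simp_all add: fderiv_eqI[OF d] Ck_on_add assms(1) Suc.IH\<close>)
  then show ?case using d by (auto simp: differentiable_def)
qed

lemma Ck_on_sum:
  assumes "open S" "\<And>i. i \<in> I \<Longrightarrow> Ck_on k S (f i)"
  shows "Ck_on k S (\<lambda>x. \<Sum>i\<in>I. f i x)"
  using assms(2) by (induction I rule: infinite_finite_induct)
    (auto intro!: Ck_on_const Ck_on_add assms(1))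

lemma linear_euclidean: "linear l \<Longrightarrow> l v = (\<Sum>b\<in>Basis. (v \<bullet> b) *\<^sub>R l b)"
proof -
  assume l: "linear l"
  have "l v = l (\<Sum>b\<in>Basis. (v \<bullet> b) *\<^sub>R b)" by (simp only: euclidean_representation)
  also have "\<dots> = (\<Sum>b\<in>Basis. (v \<bullet> b) *\<^sub>R l b)"
    by (simp only: linear_sum[OF l] linear_scale[OF l])
  finally show ?thesis .
qed

text \<open>A field of linear maps is controlled only on fixed vectors. Expanding \<open>W y\<close>
  in the standard basis turns the value into a finite sum of scalar coefficients times such
  fields.\<close>

lemma Ck_on_apply:
  assumes S: "open S" and l: "\<And>y. y \<in> S \<Longrightarrow> linear (L y)" and L: "\<And>v. Ck_on k S (\<lambda>y. L y v)"
    and W: "Ck_on k S W"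
  shows "Ck_on k S (\<lambda>y. L y (W y :: 'a::euclidean_space))"
proof (rule Ck_on_cong[OF S])
  show "(\<Sum>b\<in>Basis. (W y \<bullet> b) *\<^sub>R L y b) = L y (W y)" if "y \<in> S" for y
    using linear_euclidean[OF l[OF that]] by metis
  show "Ck_on k S (\<lambda>y. \<Sum>b\<in>Basis. (W y \<bullet> b) *\<^sub>R L y b)"
    using L by (intro Ck_on_sum Ck_on_scaleR S Ck_on_linear[OF _ S W] bounded_linear_inner_left)
qed

text \<open>By the chain rule the derivative is the family \<open>fderiv g (F y)\<close> applied to
  the field \<open>fderiv F y v\<close>. The induction hypothesis treats the family on fixed
  vectors, and \<open>Ck_on_apply\<close> combines the two.\<close>

lemma Ck_on_compose:
  fixes F :: "'a::euclidean_space \<Rightarrow> 'b::euclidean_space"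
  assumes S: "open S" and T: "F ` S \<subseteq> T" and F: "Ck_on k S F" and g: "Ck_on k T g"
  shows "Ck_on k S (\<lambda>x. g (F x))"
  using F g
proof (induction k arbitrary: g)
  case 0
  then show ?case using T by (auto intro: continuous_on_compose2)
next
  case (Suc k)
  have d: "((\<lambda>x. g (F x)) has_derivative (\<lambda>v. fderiv g (F x) (fderiv F x v))) (at x)"
    if "x \<in> S" for x
    by (rule has_derivative_compose; rule fderiv_works) (use Suc.prems that T in auto)
  have "Ck_on k S (\<lambda>x. fderiv g (F x) (fderiv F x v))" for v
  proof (rule Ck_on_apply[OF S])
    show "linear (fderiv g (F y))" if "y \<in> S" for y
      using Suc.prems T that by (auto intro!: linear_frechet_derivative)
    show "Ck_on k S (\<lambda>y. fderiv g (F y) v)" for v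
      using Suc.prems by (intro Suc.IH[of "\<lambda>y. fderiv g y v"] Ck_on_SucD[OF Suc.prems(1)]) simp
  qed (use Suc.prems in simp)
  then have "Ck_on k S (\<lambda>x. fderiv (\<lambda>x. g (F x)) x v)" for v
    by (rule Ck_on_cong[OF S, rotated]) (simp add: fderiv_eqI[OF d])
  then show ?case using d by (auto simp: differentiable_def)
qed

text \<open>The derivative of the reciprocal is a product of the reciprocal itself and the
  derivative of \<open>f\<close>, so regularity of order \<open>k\<close> yields order
  \<open>Suc k\<close>.\<close>

lemma Ck_on_inverse:
  fixes f :: "'a::euclidean_space \<Rightarrow> real"
  assumes S: "open S" and f: "Ck_on k S f" and nz: "\<And>x. x \<in> S \<Longrightarrow> f x \<noteq> 0"
  shows "Ck_on k S (\<lambda>x. inverse (f x))"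
  using f
proof (induction k)
  case 0
  then show ?case using nz by (auto intro!: continuous_on_inverse)
next
  case (Suc k)
  have d: "((\<lambda>x. inverse (f x)) has_derivative
      (\<lambda>v. - (inverse (f x) * fderiv f x v * inverse (f x)))) (at x)" if "x \<in> S" for x
    using Suc.prems that by (intro Deriv.has_derivative_inverse fderiv_works nz) auto
  note IH = Suc.IH[OF Ck_on_SucD[OF Suc.prems]]
  have "Ck_on k S (\<lambda>x. fderiv (\<lambda>x. inverse (f x)) x v)" for v
  proof (rule Ck_on_cong[OF S, of "\<lambda>x. - ((inverse (f x) *\<^sub>R fderiv f x v) *\<^sub>R inverse (f x))"])
    show "Ck_on k S (\<lambda>x. - ((inverse (f x) *\<^sub>R fderiv f x v) *\<^sub>R inverse (f x)))"
      by (rule Ck_on_linear[OF bounded_linear_minus[OF bounded_linear_ident] S],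
          intro Ck_on_scaleR S IH) (use Suc.prems in simp)
  qed (simp add: fderiv_eqI[OF d])
  then show ?case using d by (auto simp: differentiable_def)
qed

lemma smooth_on_fderiv: "smooth_on S f \<Longrightarrow> smooth_on S (\<lambda>x. fderiv f x v)"
  unfolding smooth_on_def
proof
  fix k assume "\<forall>k. Ck_on k S f"
  then have "Ck_on (Suc k) S f" by blast
  then show "Ck_on k S (\<lambda>x. fderiv f x v)" by simp
qed

lemma smooth_on_differentiable:
  assumes "smooth_on S f" "x \<in> S" shows "f differentiable (at x)"
proof -
  have "Ck_on (Suc 0) S f" using assms(1) unfolding smooth_on_def by blast
  then show ?thesis using assms(2) by simp
qed

lemma smooth_on_works: "smooth_on S f \<Longrightarrow> x \<in> S \<Longrightarrow> (f has_derivative fderiv f x) (at x)"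
  using smooth_on_differentiable fderiv_works by blast

lemma smooth_on_continuous: "smooth_on S f \<Longrightarrow> continuous_on S f"
  unfolding smooth_on_def by (metis Ck_on.simps(1))

lemma smooth_on_subset: "smooth_on S f \<Longrightarrow> T \<subseteq> S \<Longrightarrow> smooth_on T f"
  unfolding smooth_on_def by (intro allI, rule Ck_on_subset[of _ S f T]) auto

lemma smooth_on_cong:
  "open S \<Longrightarrow> (\<And>y. y \<in> S \<Longrightarrow> f y = g y) \<Longrightarrow> smooth_on S f \<Longrightarrow> smooth_on S g"
  unfolding smooth_on_def by (intro allI, rule Ck_on_cong[of S f g]) auto

lemma smooth_on_const: "smooth_on S (\<lambda>_. a)"
  by (simp add: smooth_on_def Ck_on_const)

lemma smooth_on_linear:
  "bounded_linear l \<Longrightarrow> open S \<Longrightarrow> smooth_on S f \<Longrightarrow> smooth_on S (\<lambda>x. l (f x))"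
  by (simp add: smooth_on_def Ck_on_linear)

lemma smooth_on_add:
  "open S \<Longrightarrow> smooth_on S f \<Longrightarrow> smooth_on S g \<Longrightarrow> smooth_on S (\<lambda>x. f x + g x)"
  by (simp add: smooth_on_def Ck_on_add)

lemma smooth_on_minus: "open S \<Longrightarrow> smooth_on S f \<Longrightarrow> smooth_on S (\<lambda>x. - f x)"
  by (rule smooth_on_linear[OF bounded_linear_minus[OF bounded_linear_ident]])

lemma smooth_on_diff:
  "open S \<Longrightarrow> smooth_on S f \<Longrightarrow> smooth_on S g \<Longrightarrow> smooth_on S (\<lambda>x. f x - g x)"
  using smooth_on_add[of S f "\<lambda>x. - g x"] smooth_on_minus[of S g] by simp

lemma smooth_on_scaleR:
  "open S \<Longrightarrow> smooth_on S f \<Longrightarrow> smooth_on S g \<Longrightarrow> smooth_on S (\<lambda>x. f x *\<^sub>R g x)"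
  by (simp add: smooth_on_def Ck_on_scaleR)

lemma smooth_on_mult:
  "open S \<Longrightarrow> smooth_on S f \<Longrightarrow> smooth_on S g \<Longrightarrow> smooth_on S (\<lambda>x. f x * (g x :: real))"
  using smooth_on_scaleR[of S f g] by simp

lemma smooth_on_sum:
  "open S \<Longrightarrow> (\<And>i. i \<in> I \<Longrightarrow> smooth_on S (f i)) \<Longrightarrow> smooth_on S (\<lambda>x. \<Sum>i\<in>I. f i x)"
  by (simp add: smooth_on_def Ck_on_sum)

lemma smooth_on_apply:
  fixes W :: "'a::euclidean_space \<Rightarrow> 'b::euclidean_space"
  assumes "open S" "\<And>y. y \<in> S \<Longrightarrow> linear (L y)" "\<And>v. smooth_on S (\<lambda>y. L y v)" "smooth_on S W"
  shows "smooth_on S (\<lambda>y. L y (W y))"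
  unfolding smooth_on_def
  by (intro allI, rule Ck_on_apply[of S L]) (use assms in \<open>auto simp: smooth_on_def\<close>)

lemma smooth_on_bilinear_apply:
  fixes X :: "'a::euclidean_space \<Rightarrow> 'b::euclidean_space" and Y :: "'a \<Rightarrow> 'c::euclidean_space"
  assumes S: "open S" and b: "\<And>y. y \<in> S \<Longrightarrow> bilinear (L y)"
    and "\<And>u v. smooth_on S (\<lambda>y. L y u v)" "smooth_on S X" "smooth_on S Y"
  shows "smooth_on S (\<lambda>y. L y (X y) (Y y))"
proof (rule smooth_on_apply[OF S, of "\<lambda>y. L y (X y)"])
  show "linear (L y (X y))" if "y \<in> S" for y using b[OF that] by (simp add: bilinear_def)
  show "smooth_on S (\<lambda>y. L y (X y) v)" for v
    by (rule smooth_on_apply[OF S, of "\<lambda>y u. L y u v"]) (use assms in \<open>auto simp: bilinear_def\<close>)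
qed fact

lemma smooth_on_compose:
  assumes "open S" "F ` S \<subseteq> T" "smooth_on S F" "smooth_on T g"
  shows "smooth_on S (\<lambda>x. g (F x))"
  using assms by (simp add: smooth_on_def Ck_on_compose)

lemma smooth_on_inverse:
  "open S \<Longrightarrow> smooth_on S f \<Longrightarrow> (\<And>x. x \<in> S \<Longrightarrow> f x \<noteq> 0) \<Longrightarrow> smooth_on S (\<lambda>x. inverse (f x :: real))"
  by (simp add: smooth_on_def Ck_on_inverse)

section \<open>Product rules for fields of linear and bilinear maps\<close>

text \<open>The first summand differentiates the family with \<open>W x\<close> frozen. In this form
  it is again a derivative on a constant vector, which is how covariant derivatives of tensors enter
  later.\<close>

lemma fderiv_apply:
  fixes W :: "'a::euclidean_space \<Rightarrow> 'b::euclidean_space"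
  assumes S: "open S" "x \<in> S" and l: "\<And>y. y \<in> S \<Longrightarrow> linear (L y)"
    and L: "\<And>v. (\<lambda>y. L y v) differentiable (at x)" and W: "W differentiable (at x)"
  shows "((\<lambda>y. L y (W y)) has_derivative
    (\<lambda>u. fderiv (\<lambda>y. L y (W x)) x u + L x (fderiv W x u))) (at x)"
proof -
  have sumL: "(\<Sum>b\<in>Basis. (w \<bullet> b) *\<^sub>R L y b) = L y w" if "y \<in> S" for y w
    using linear_euclidean[OF l[OF that]] by metis
  have d1: "((\<lambda>y. \<Sum>b\<in>Basis. (W y \<bullet> b) *\<^sub>R L y b) has_derivative
    (\<lambda>u. \<Sum>b\<in>Basis. ((W x \<bullet> b) *\<^sub>R fderiv (\<lambda>y. L y b) x u + (fderiv W x u \<bullet> b) *\<^sub>R L x b))) (at x)"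
    by (intro has_derivative_sum has_derivative_scaleR has_derivative_inner_left fderiv_works L W)
  have d2: "((\<lambda>y. \<Sum>b\<in>Basis. (W x \<bullet> b) *\<^sub>R L y b) has_derivative
    (\<lambda>u. \<Sum>b\<in>Basis. (W x \<bullet> b) *\<^sub>R fderiv (\<lambda>y. L y b) x u)) (at x)"
    by (intro has_derivative_sum has_derivative_scaleR_right fderiv_works L)
  have "((\<lambda>y. L y (W x)) has_derivative
    (\<lambda>u. \<Sum>b\<in>Basis. (W x \<bullet> b) *\<^sub>R fderiv (\<lambda>y. L y b) x u)) (at x)"
    by (rule has_derivative_transform_within_open[OF d2 S]) (simp add: sumL)
  then have e: "fderiv (\<lambda>y. L y (W x)) x = (\<lambda>u. \<Sum>b\<in>Basis. (W x \<bullet> b) *\<^sub>R fderiv (\<lambda>y. L y b) x u)"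
    by (rule fderiv_eqI)
  have "((\<lambda>y. L y (W y)) has_derivative
    (\<lambda>u. \<Sum>b\<in>Basis. ((W x \<bullet> b) *\<^sub>R fderiv (\<lambda>y. L y b) x u + (fderiv W x u \<bullet> b) *\<^sub>R L x b))) (at x)"
    by (rule has_derivative_transform_within_open[OF d1 S]) (simp add: sumL)
  then show ?thesis by (simp add: e sum.distrib sumL[OF S(2)])
qed

lemma fderiv_bilinear_apply:
  fixes X :: "'a::euclidean_space \<Rightarrow> 'b::euclidean_space" and Y :: "'a \<Rightarrow> 'c::euclidean_space"
  assumes S: "open S" "x \<in> S" and b: "\<And>y. y \<in> S \<Longrightarrow> bilinear (L y)"
    and L: "\<And>v w. smooth_on S (\<lambda>y. L y v w)" and X: "X differentiable (at x)" and Y: "Y differentiable (at x)"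
  shows "((\<lambda>y. L y (X y) (Y y)) has_derivative
    (\<lambda>u. fderiv (\<lambda>y. L y (X x) (Y x)) x u + L x (fderiv X x u) (Y x) + L x (X x) (fderiv Y x u))) (at x)"
proof -
  have l1: "linear (\<lambda>v. L y v w)" "linear (L y w')" if "y \<in> S" for y w w'
    using b[OF that] by (simp_all add: bilinear_def)
  have 1: "((\<lambda>y. L y (X y) w) has_derivative
     (\<lambda>u. fderiv (\<lambda>y. L y (X x) w) x u + L x (fderiv X x u) w)) (at x)" for w
    by (rule fderiv_apply[OF S l1(1) smooth_on_differentiable[OF L S(2)] X])
  have "((\<lambda>y. L y (X y) (Y y)) has_derivative
    (\<lambda>u. fderiv (\<lambda>y. L y (X y) (Y x)) x u + L x (X x) (fderiv Y x u))) (at x)"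
    by (rule fderiv_apply[OF S l1(2) _ Y]) (use 1 in \<open>auto simp: differentiable_def\<close>)
  then show ?thesis by (simp add: fderiv_eqI[OF 1])
qed

section \<open>Symmetry of second derivatives\<close>

lemma DERIV_along_line:
  assumes "f differentiable (at (p + r *\<^sub>R u))"
  shows "DERIV (\<lambda>r. f (p + r *\<^sub>R u) :: real) r :> fderiv f (p + r *\<^sub>R u) u"
proof -
  have "((\<lambda>r. f (p + r *\<^sub>R u)) has_derivative (\<lambda>t. fderiv f (p + r *\<^sub>R u) (t *\<^sub>R u))) (at r)"
    by (rule has_derivative_compose[of "\<lambda>r. p + r *\<^sub>R u" _ _ _ f, OF _ fderiv_works[OF assms]]) (auto intro!: derivative_eq_intros)
  moreover have "fderiv f (p + r *\<^sub>R u) (t *\<^sub>R u) = fderiv f (p + r *\<^sub>R u) u * t" for t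
    using linear_scale[OF linear_frechet_derivative[OF assms]] by simp
  ultimately show ?thesis by (simp add: has_field_derivative_def)
qed

text \<open>The mean value theorem is used twice: in direction \<open>u\<close> for the difference
  of \<open>f\<close> along two parallel segments, then in direction \<open>v\<close> for the
  derivative so obtained.\<close>

lemma second_difference:
  fixes f :: "'a::euclidean_space \<Rightarrow> real"
  assumes B: "ball x d \<subseteq> S" and s: "0 < s" "s * (norm u + norm v) < d"
    and f: "\<And>y. y \<in> S \<Longrightarrow> f differentiable (at y)"
    and f': "\<And>y. y \<in> S \<Longrightarrow> (\<lambda>y. fderiv f y u) differentiable (at y)"
  shows "\<exists>p q. 0 < p \<and> p < s \<and> 0 < q \<and> q < s \<and>
    f (x + s *\<^sub>R u + s *\<^sub>R v) - f (x + s *\<^sub>R u) - f (x + s *\<^sub>R v) + f x =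
    s\<^sup>2 * fderiv (\<lambda>y. fderiv f y u) (x + p *\<^sub>R u + q *\<^sub>R v) v"
proof -
  have inS: "x + p *\<^sub>R u + q *\<^sub>R v \<in> S" if "0 \<le> p" "p \<le> s" "0 \<le> q" "q \<le> s" for p q
  proof -
    have "norm (p *\<^sub>R u + q *\<^sub>R v) \<le> p * norm u + q * norm v"
      using that norm_triangle_ineq[of "p *\<^sub>R u" "q *\<^sub>R v"] by simp
    also have "\<dots> \<le> s * norm u + s * norm v"
      using that by (intro add_mono mult_right_mono) auto
    finally have "x + p *\<^sub>R u + q *\<^sub>R v \<in> ball x d"
      using s(2) by (simp add: dist_norm algebra_simps norm_minus_commute)
    then show ?thesis using B by blast
  qed
  have inS0: "x + p *\<^sub>R u \<in> S" if "0 \<le> p" "p \<le> s" for p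
    using inS[of p 0] that s by simp
  have D: "DERIV (\<lambda>r. f (x + s *\<^sub>R v + r *\<^sub>R u) - f (x + r *\<^sub>R u)) r :>
      fderiv f (x + s *\<^sub>R v + r *\<^sub>R u) u - fderiv f (x + r *\<^sub>R u) u" if "0 \<le> r" "r \<le> s" for r
    using inS[of r s] inS0[of r] that s
    by (intro DERIV_diff DERIV_along_line f) (simp_all add: add.commute add.left_commute)
  obtain p where p: "0 < p" "p < s" and 1: "f (x + s *\<^sub>R v + s *\<^sub>R u) - f (x + s *\<^sub>R u)
      - (f (x + s *\<^sub>R v) - f x) = s * (fderiv f (x + s *\<^sub>R v + p *\<^sub>R u) u - fderiv f (x + p *\<^sub>R u) u)"
    using MVT2[OF s(1) D] by auto
  have "DERIV (\<lambda>r. fderiv f (x + p *\<^sub>R u + r *\<^sub>R v) u) r :>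
      fderiv (\<lambda>y. fderiv f y u) (x + p *\<^sub>R u + r *\<^sub>R v) v" if "0 \<le> r" "r \<le> s" for r
    using inS[of p r] that p by (intro DERIV_along_line f') simp
  from MVT2[OF s(1) this] obtain q where "0 < q" "q < s" and 2: "fderiv f (x + p *\<^sub>R u + s *\<^sub>R v) u
      - fderiv f (x + p *\<^sub>R u) u = s * fderiv (\<lambda>y. fderiv f y u) (x + p *\<^sub>R u + q *\<^sub>R v) v"
    by auto
  moreover have "f (x + s *\<^sub>R u + s *\<^sub>R v) - f (x + s *\<^sub>R u) - f (x + s *\<^sub>R v) + f x =
    s * (s * fderiv (\<lambda>y. fderiv f y u) (x + p *\<^sub>R u + q *\<^sub>R v) v)"
    using 1 unfolding 2[symmetric] by (simp add: add.commute add.left_commute)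
  ultimately show ?thesis using p by (auto simp: power2_eq_square)
qed

text \<open>The second difference is symmetric in \<open>u\<close> and \<open>v\<close>. Hence the
  two mixed derivatives agree at suitable points arbitrarily close to \<open>x\<close>, and by
  continuity at \<open>x\<close> itself.\<close>

lemma second_fderiv_sym_real:
  fixes f :: "'a::euclidean_space \<Rightarrow> real"
  assumes S: "open S" "x \<in> S" and f: "smooth_on S f"
  shows "fderiv (\<lambda>y. fderiv f y v) x u = fderiv (\<lambda>y. fderiv f y u) x v"
proof -
  define a where "a = (\<lambda>y. fderiv (\<lambda>y. fderiv f y u) y v)"
  define b where "b = (\<lambda>y. fderiv (\<lambda>y. fderiv f y v) y u)"
  have "isCont a x" "isCont b x"
    using S f by (auto simp: a_def b_def continuous_on_eq_continuous_at
      dest!: smooth_on_continuous[OF smooth_on_fderiv[OF smooth_on_fderiv]])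
  have "\<bar>a x - b x\<bar> < e" if "e > 0" for e
  proof -
    obtain d1 where d1: "d1 > 0" "\<And>y. dist y x < d1 \<Longrightarrow> dist (a y) (a x) < e / 2"
      using \<open>isCont a x\<close> \<open>e > 0\<close> unfolding continuous_at_eps_delta by (metis half_gt_zero)
    obtain d2 where d2: "d2 > 0" "\<And>y. dist y x < d2 \<Longrightarrow> dist (b y) (b x) < e / 2"
      using \<open>isCont b x\<close> \<open>e > 0\<close> unfolding continuous_at_eps_delta by (metis half_gt_zero)
    obtain d3 where d3: "d3 > 0" "ball x d3 \<subseteq> S" using S openE by blast
    define d where "d = Min {d1, d2, d3}"
    have d: "d > 0" "d \<le> d1" "d \<le> d2" "d \<le> d3" using d1 d2 d3 by (auto simp: d_def)
    \<comment> \<open>The summand 1 keeps the denominator of \<open>s\<close> positive when both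
      directions vanish, and makes the bound by \<open>k\<close> strict.\<close>
    define k where "k = norm u + norm v + 1"
    define s where "s = d / (2 * k)"
    have k: "k > 0" "norm u + norm v < k" by (simp_all add: k_def add_nonneg_pos)
    have s: "0 < s" using d k by (simp add: s_def)
    have "s * (norm u + norm v) < s * k" using k s by simp
    also have "\<dots> < d" using d k by (simp add: s_def)
    finally have sd: "s * (norm u + norm v) < d" .
    have near: "dist (x + p *\<^sub>R u + q *\<^sub>R v) x < d" if "0 < p" "p < s" "0 < q" "q < s" for p q
    proof -
      have "norm (p *\<^sub>R u + q *\<^sub>R v) \<le> p * norm u + q * norm v"
        using that norm_triangle_ineq[of "p *\<^sub>R u" "q *\<^sub>R v"] by simp
      also have "\<dots> \<le> s * norm u + s * norm v"
        using that by (intro add_mono mult_right_mono) auto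
      finally show ?thesis using sd by (simp add: dist_norm algebra_simps)
    qed
    have B: "ball x d \<subseteq> S" using d3 d by auto
    note sm = smooth_on_differentiable[OF f] smooth_on_differentiable[OF smooth_on_fderiv[OF f]]
    obtain p q where pq: "0 < p" "p < s" "0 < q" "q < s" and
      1: "f (x + s *\<^sub>R u + s *\<^sub>R v) - f (x + s *\<^sub>R u) - f (x + s *\<^sub>R v) + f x =
        s\<^sup>2 * a (x + p *\<^sub>R u + q *\<^sub>R v)"
      using second_difference[OF B s sd sm(1) sm(2)] unfolding a_def by blast
    have sd': "s * (norm v + norm u) < d" using sd by (simp add: add.commute)
    obtain p' q' where pq': "0 < p'" "p' < s" "0 < q'" "q' < s" and
      2: "f (x + s *\<^sub>R v + s *\<^sub>R u) - f (x + s *\<^sub>R v) - f (x + s *\<^sub>R u) + f x =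
        s\<^sup>2 * b (x + p' *\<^sub>R v + q' *\<^sub>R u)"
      using second_difference[OF B s sd' sm(1) sm(2)] unfolding b_def by blast
    have sw: "x + s *\<^sub>R v + s *\<^sub>R u = x + s *\<^sub>R u + s *\<^sub>R v"
      "x + p' *\<^sub>R v + q' *\<^sub>R u = x + q' *\<^sub>R u + p' *\<^sub>R v" by simp_all
    have "s\<^sup>2 * a (x + p *\<^sub>R u + q *\<^sub>R v) = s\<^sup>2 * b (x + q' *\<^sub>R u + p' *\<^sub>R v)"
      using 1 2 unfolding sw by linarith
    then have "a (x + p *\<^sub>R u + q *\<^sub>R v) = b (x + q' *\<^sub>R u + p' *\<^sub>R v)" using s by simp
    moreover have "dist (a (x + p *\<^sub>R u + q *\<^sub>R v)) (a x) < e / 2"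
      "dist (b (x + q' *\<^sub>R u + p' *\<^sub>R v)) (b x) < e / 2"
      using d1(2)[of "x + p *\<^sub>R u + q *\<^sub>R v"] d2(2)[of "x + q' *\<^sub>R u + p' *\<^sub>R v"]
        near[OF pq] near[OF pq'(3,4,1,2)] d by auto
    ultimately show ?thesis unfolding dist_real_def by linarith
  qed
  then have "a x = b x" by (metis less_irrefl right_minus_eq zero_less_abs_iff)
  then show ?thesis by (simp add: a_def b_def)
qed

lemma second_fderiv_sym:
  fixes f :: "'a::euclidean_space \<Rightarrow> 'b::euclidean_space"
  assumes S: "open S" "x \<in> S" and f: "smooth_on S f"
  shows "fderiv (\<lambda>y. fderiv f y v) x u = fderiv (\<lambda>y. fderiv f y u) x v"
proof (rule euclidean_eqI)
  fix b :: 'b assume "b \<in> Basis"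
  have fb: "smooth_on S (\<lambda>y. f y \<bullet> b)"
    by (rule smooth_on_linear[OF bounded_linear_inner_left S(1) f])
  have 1: "fderiv (\<lambda>y. f y \<bullet> b) y = (\<lambda>v. fderiv f y v \<bullet> b)" if "y \<in> S" for y
    by (intro fderiv_eqI has_derivative_inner_left smooth_on_works[OF f that])
  have "fderiv (\<lambda>y. fderiv (\<lambda>y. f y \<bullet> b) y v) x u = fderiv (\<lambda>y. fderiv f y v) x u \<bullet> b" for u v
  proof -
    have "((\<lambda>y. fderiv f y v \<bullet> b) has_derivative (\<lambda>u. fderiv (\<lambda>y. fderiv f y v) x u \<bullet> b)) (at x)"
      by (intro has_derivative_inner_left smooth_on_works[OF smooth_on_fderiv[OF f] S(2)])
    then have "((\<lambda>y. fderiv (\<lambda>y. f y \<bullet> b) y v) has_derivative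
        (\<lambda>u. fderiv (\<lambda>y. fderiv f y v) x u \<bullet> b)) (at x)"
      by (rule has_derivative_transform_within_open[OF _ S]) (simp add: 1)
    then show ?thesis by (simp add: fderiv_eqI)
  qed
  then show "fderiv (\<lambda>y. fderiv f y v) x u \<bullet> b = fderiv (\<lambda>y. fderiv f y u) x v \<bullet> b"
    using second_fderiv_sym_real[OF S fb] by metis
qed

section \<open>Orthonormal frames and traces\<close>

text \<open>
  The coordinate trace does not involve the metric, so that it commutes with differentiation; it
  agrees with the metric trace by \<open>trace_frame\<close> below.
\<close>

definition lin_trace :: "('a::euclidean_space \<Rightarrow> 'a) \<Rightarrow> real"
  where "lin_trace B = (\<Sum>b\<in>Basis. B b \<bullet> b)"

locale inner_form =
  fixes h :: "'a::euclidean_space \<Rightarrow> 'a \<Rightarrow> real"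
  assumes bil: "bilinear h" and sym: "h u v = h v u" and pos: "u \<noteq> 0 \<Longrightarrow> h u u > 0"
begin

lemmas form_simps = bilinear_ladd[OF bil] bilinear_radd[OF bil] bilinear_lsub[OF bil]
  bilinear_rsub[OF bil] bilinear_lmul[OF bil] bilinear_rmul[OF bil] bilinear_lneg[OF bil]
  bilinear_rneg[OF bil] bilinear_lzero[OF bil] bilinear_rzero[OF bil]

lemma linear_left: "linear (\<lambda>u. h u v)" and linear_right: "linear (h u)"
  using bil by (simp_all add: bilinear_def)

lemmas sum_left = linear_sum[OF linear_left] and sum_right = linear_sum[OF linear_right]

lemma eqI: "(\<And>z. h u z = h v z) \<Longrightarrow> u = v"
proof (rule ccontr)
  assume a: "\<And>z. h u z = h v z" and "u \<noteq> v"
  then have "h (u - v) (u - v) > 0" using pos by simp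
  then show False by (simp add: form_simps a)
qed

end

locale inner_frame = inner_form h for h :: "'a::euclidean_space \<Rightarrow> 'a \<Rightarrow> real" +
  fixes I :: "'i set" and E :: "'i \<Rightarrow> 'a"
  assumes fin: "finite I" and card: "card I = DIM('a)"
    and orth: "i \<in> I \<Longrightarrow> j \<in> I \<Longrightarrow> h (E i) (E j) = (if i = j then 1 else 0)"
begin

text \<open>Orthonormality makes the family independent, and its cardinality is the dimension, so it
  spans; pairing with \<open>E j\<close> identifies the coefficients.\<close>

lemma expand: "v = (\<Sum>i\<in>I. h v (E i) *\<^sub>R E i)"
proof -
  have coef: "h (\<Sum>i\<in>I. c i *\<^sub>R E i) (E j) = c j" if "j \<in> I" for c j
  proof -
    have "h (\<Sum>i\<in>I. c i *\<^sub>R E i) (E j) = (\<Sum>i\<in>I. c i * (if i = j then 1 else 0))"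
      unfolding sum_left by (rule sum.cong) (simp_all add: form_simps orth that)
    then show ?thesis using fin that by (simp add: if_distrib[of "(*) _"] cong: if_cong)
  qed
  have inj: "inj_on E I"
    by (rule inj_onI) (metis orth zero_neq_one)
  have "independent (E ` I)"
  proof (rule independent_if_scalars_zero)
    fix c x assume 0: "(\<Sum>x\<in>E ` I. c x *\<^sub>R x) = 0" and "x \<in> E ` I"
    then obtain j where j: "j \<in> I" "x = E j" by blast
    have "(\<Sum>i\<in>I. c (E i) *\<^sub>R E i) = 0" using 0 by (simp add: sum.reindex[OF inj])
    then show "c x = 0" using coef[OF j(1), of "\<lambda>i. c (E i)"] j by (simp add: form_simps)
  qed (use fin in simp)
  then have "span (E ` I) = UNIV"
    using card_eq_dim[of "E ` I" UNIV] card_image[OF inj] card fin by (simp add: dim_UNIV) blast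
  then have "v \<in> span (E ` I)" by simp
  then obtain a where "v = (\<Sum>x\<in>E ` I. a x *\<^sub>R x)"
    using span_finite[of "E ` I"] fin by auto
  then have v: "v = (\<Sum>i\<in>I. a (E i) *\<^sub>R E i)" by (simp add: sum.reindex[OF inj])
  have "a (E i) = h v (E i)" if "i \<in> I" for i
    by (subst v) (simp add: coef[OF that])
  then show ?thesis by (subst v) simp
qed

text \<open>Index contraction: a summation index that occurs once in a metric coefficient and once
  in a linear slot disappears. Nearly all sums of the algebraic part are evaluated this way.\<close>

lemma contract: "linear l \<Longrightarrow> (\<Sum>i\<in>I. h v (E i) *\<^sub>R l (E i)) = l v"
  by (subst (2) expand) (simp add: linear_sum linear_scale)

lemma contract_real: "linear l \<Longrightarrow> (\<Sum>i\<in>I. h v (E i) * l (E i)) = l v"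
  using contract[of l v] by simp

lemma parseval: "(\<Sum>i\<in>I. h u (E i) * h v (E i)) = h u v"
  using contract_real[OF linear_right, of u v] by (simp add: sym mult.commute)

text \<open>Each standard basis vector is expanded in the orthonormal frame; after exchanging the
  sums, \<open>B (E i)\<close> is reassembled from its standard coordinates.\<close>

lemma trace_frame:
  assumes "linear B" shows "(\<Sum>i\<in>I. h (B (E i)) (E i)) = lin_trace B"
proof -
  have "lin_trace B = (\<Sum>b\<in>Basis. B (\<Sum>i\<in>I. h b (E i) *\<^sub>R E i) \<bullet> b)"
    unfolding lin_trace_def using expand by simp
  also have "\<dots> = (\<Sum>b\<in>Basis. \<Sum>i\<in>I. h b (E i) * (B (E i) \<bullet> b))"
    by (simp add: linear_sum[OF assms] linear_scale[OF assms] inner_sum_left)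
  also have "\<dots> = (\<Sum>i\<in>I. \<Sum>b\<in>Basis. (B (E i) \<bullet> b) *\<^sub>R h b (E i))"
    by (subst sum.swap) (simp add: mult.commute)
  also have "\<dots> = (\<Sum>i\<in>I. h (B (E i)) (E i))"
    using linear_euclidean[OF linear_left] by metis
  finally show ?thesis by simp
qed

end

text \<open>Cyclicity serves twice: it cancels the connection terms when a trace is differentiated,
  and it brings the words in the algebraic part to a common form.\<close>

lemma lin_trace_commute:
  fixes B C :: "'a::euclidean_space \<Rightarrow> 'a"
  assumes "linear B" "linear C"
  shows "lin_trace (\<lambda>u. B (C u)) = lin_trace (\<lambda>u. C (B u))"
proof -
  have "lin_trace (\<lambda>u. B (C u)) = (\<Sum>b\<in>Basis. \<Sum>d\<in>Basis. (C b \<bullet> d) * (B d \<bullet> b))"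
    if "linear B" for B C :: "'a \<Rightarrow> 'a"
    unfolding lin_trace_def
    by (rule sum.cong[OF refl], subst linear_euclidean[OF that]) (simp add: inner_sum_left)
  from this[OF assms(1)] this[OF assms(2)] show ?thesis
    by simp (subst sum.swap, simp add: mult.commute)
qed

lemma lin_trace_add: "lin_trace (\<lambda>u. B u + C u) = lin_trace B + lin_trace C"
  and lin_trace_diff: "lin_trace (\<lambda>u. B u - C u) = lin_trace B - lin_trace C"
  by (simp_all add: lin_trace_def inner_add_left inner_diff_left sum.distrib sum_subtractf)

text \<open>Gram--Schmidt without normalisation, so that only reciprocals have to be smooth.\<close>

lemma smooth_orthogonal_fields:
  fixes h :: "'a::euclidean_space \<Rightarrow> 'b::euclidean_space \<Rightarrow> 'b \<Rightarrow> real"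
  assumes S: "open S" and form: "\<And>y. y \<in> S \<Longrightarrow> inner_form (h y)"
    and sm: "\<And>u v. smooth_on S (\<lambda>y. h y u v)"
    and B: "finite B" "B \<subseteq> Basis"
  shows "\<exists>e. (\<forall>b\<in>B. smooth_on S (e b)) \<and> (\<forall>y\<in>S. \<forall>b\<in>B. e b y \<noteq> 0 \<and> e b y \<in> span B \<and>
      (\<forall>b'\<in>B. b \<noteq> b' \<longrightarrow> h y (e b y) (e b' y) = 0))"
  using B
proof (induction B)
  case empty
  then show ?case by simp
next
  case (insert a B)
  then have "B \<subseteq> Basis" by simp
  from insert.IH[OF this] obtain e where e0: "\<forall>b\<in>B. smooth_on S (e b)"
    "\<forall>y\<in>S. \<forall>b\<in>B. e b y \<noteq> 0 \<and> e b y \<in> span B \<and>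
      (\<forall>b'\<in>B. b \<noteq> b' \<longrightarrow> h y (e b y) (e b' y) = 0)"
    by (elim exE conjE)
  have e: "\<And>b. b \<in> B \<Longrightarrow> smooth_on S (e b)"
    "\<And>y b. y \<in> S \<Longrightarrow> b \<in> B \<Longrightarrow> e b y \<noteq> 0" "\<And>y b. y \<in> S \<Longrightarrow> b \<in> B \<Longrightarrow> e b y \<in> span B"
    "\<And>y b b'. y \<in> S \<Longrightarrow> b \<in> B \<Longrightarrow> b' \<in> B \<Longrightarrow> b \<noteq> b' \<Longrightarrow> h y (e b y) (e b' y) = 0"
    using e0 by simp_all
  define q where "q b y = h y a (e b y) * inverse (h y (e b y) (e b y))" for b y
  define f where "f y = a - (\<Sum>b\<in>B. q b y *\<^sub>R e b y)" for y
  have smh: "smooth_on S (\<lambda>y. h y (X y) (Y y))" if "smooth_on S X" "smooth_on S Y" for X Y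
    by (rule smooth_on_bilinear_apply[OF S inner_form.bil[OF form] sm that])
  have nz: "h y (e b y) (e b y) \<noteq> 0" if "y \<in> S" "b \<in> B" for y b
    using inner_form.pos[OF form[OF that(1)] e(2)[OF that]] by simp
  have smf: "smooth_on S f"
    unfolding f_def q_def using nz
    by (intro smooth_on_diff smooth_on_sum smooth_on_scaleR smooth_on_mult smooth_on_inverse
        smooth_on_const smh S e(1))
  have sB: "span B \<subseteq> span (insert a B)" by (rule span_mono) blast
  have inB: "(\<Sum>b\<in>B. q b y *\<^sub>R e b y) \<in> span B" if "y \<in> S" for y
    using e(3)[OF that] by (intro span_sum span_scale)
  \<comment> \<open>Since only an element of \<open>span B\<close> is subtracted from
    \<open>a\<close>, independence of the standard basis keeps the new field nonzero at every
    point.\<close>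
  have ind: "a \<notin> span B"
  proof
    assume "a \<in> span B"
    moreover have "independent (insert a B)"
      using insert.prems independent_Basis independent_mono by blast
    ultimately show False using insert.hyps by (simp add: independent_insert)
  qed
  have f0: "f y \<noteq> 0" if "y \<in> S" for y
    using inB[OF that] ind by (auto simp: f_def)
  have fs: "f y \<in> span (insert a B)" if "y \<in> S" for y
    unfolding f_def by (intro span_diff subsetD[OF sB inB[OF that]] span_base) simp
  have fo: "h y (f y) (e b y) = 0" if "y \<in> S" "b \<in> B" for y b
  proof -
    interpret inner_form "h y" by (rule form[OF that(1)])
    have "(\<Sum>d\<in>B. q d y * h y (e d y) (e b y)) = (\<Sum>d\<in>B. if d = b then h y a (e b y) else 0)"
      using that nz e(4) by (intro sum.cong) (auto simp: q_def)
    also have "\<dots> = h y a (e b y)" using insert.hyps that by simp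
    finally show ?thesis
      by (simp add: f_def form_simps sum_left)
  qed
  have fo': "h y (e b y) (f y) = 0" if "y \<in> S" "b \<in> B" for y b
    using fo[OF that] inner_form.sym[OF form[OF that(1)]] by metis
  show ?case
    using insert.hyps e smf f0 fs fo fo' sB
    by (intro exI[of _ "\<lambda>b. if b = a then f else e b"]) (auto 4 3)
qed

text \<open>Smoothness is claimed for the orthogonal fields only; square roots occur just pointwise,
  where the normalised vectors give access to the expansion in an orthonormal frame.\<close>

lemma smooth_frame_expansion:
  fixes h :: "'a::euclidean_space \<Rightarrow> 'b::euclidean_space \<Rightarrow> 'b \<Rightarrow> real"
  assumes S: "open S" and form: "\<And>y. y \<in> S \<Longrightarrow> inner_form (h y)"
    and sm: "\<And>u v. smooth_on S (\<lambda>y. h y u v)"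
  shows "\<exists>e :: 'b \<Rightarrow> 'a \<Rightarrow> 'b. (\<forall>b\<in>Basis. smooth_on S (e b)) \<and>
    (\<forall>y\<in>S. (\<forall>b\<in>Basis. h y (e b y) (e b y) > 0) \<and>
      inner_frame (h y) Basis (\<lambda>b. inverse (sqrt (h y (e b y) (e b y))) *\<^sub>R e b y))"
proof -
  obtain e :: "'b \<Rightarrow> 'a \<Rightarrow> 'b" where e: "\<And>b. b \<in> Basis \<Longrightarrow> smooth_on S (e b)"
    "\<And>y b. y \<in> S \<Longrightarrow> b \<in> Basis \<Longrightarrow> e b y \<noteq> 0"
    "\<And>y b b'. y \<in> S \<Longrightarrow> b \<in> Basis \<Longrightarrow> b' \<in> Basis \<Longrightarrow> b \<noteq> b' \<Longrightarrow> h y (e b y) (e b' y) = 0"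
    using smooth_orthogonal_fields[OF assms finite_Basis order_refl] by blast
  have p: "h y (e b y) (e b y) > 0" if "y \<in> S" "b \<in> Basis" for y b
    using inner_form.pos[OF form[OF that(1)] e(2)[OF that]] .
  have f: "inner_frame (h y) Basis (\<lambda>b. inverse (sqrt (h y (e b y) (e b y))) *\<^sub>R e b y)" if y: "y \<in> S" for y
  proof -
    interpret inner_form "h y" by (rule form[OF y])
    show ?thesis
    proof
      fix i j :: 'b assume "i \<in> Basis" "j \<in> Basis"
      then show "h y (inverse (sqrt (h y (e i y) (e i y))) *\<^sub>R e i y)
          (inverse (sqrt (h y (e j y) (e j y))) *\<^sub>R e j y) = (if i = j then 1 else 0)"
        using e(3)[OF y] p[OF y, of i]
        by (auto simp: form_simps field_simps)
    qed simp_all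
  qed
  show ?thesis by (rule exI[of _ e]) (simp add: e(1) p f)
qed

text \<open>In the orthogonal fields \<open>e b\<close> the representing vector has coefficients
  \<open>l (e b) / h (e b) (e b)\<close>, which are visibly smooth. This is the source of smoothness
  for Christoffel symbols and tangential parts.\<close>

lemma smooth_on_dual:
  fixes h :: "'a::euclidean_space \<Rightarrow> 'b::euclidean_space \<Rightarrow> 'b \<Rightarrow> real"
  assumes S: "open S" and form: "\<And>y. y \<in> S \<Longrightarrow> inner_form (h y)"
    and sm: "\<And>u v. smooth_on S (\<lambda>y. h y u v)"
    and l: "\<And>y. y \<in> S \<Longrightarrow> linear (l y)" "\<And>z. smooth_on S (\<lambda>y. l y z)"
    and w: "\<And>y z. y \<in> S \<Longrightarrow> h y (w y) z = l y z"
  shows "smooth_on S w"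
proof -
  obtain e :: "'b \<Rightarrow> 'a \<Rightarrow> 'b" where e0: "\<forall>b\<in>Basis. smooth_on S (e b)"
    "\<forall>y\<in>S. (\<forall>b\<in>Basis. h y (e b y) (e b y) > 0) \<and>
      inner_frame (h y) Basis (\<lambda>b. inverse (sqrt (h y (e b y) (e b y))) *\<^sub>R e b y)"
    using smooth_frame_expansion[OF S form sm] by blast
  have e: "\<And>b. b \<in> Basis \<Longrightarrow> smooth_on S (e b)"
    "\<And>y b. y \<in> S \<Longrightarrow> b \<in> Basis \<Longrightarrow> h y (e b y) (e b y) > 0"
    "\<And>y. y \<in> S \<Longrightarrow> inner_frame (h y) Basis (\<lambda>b. inverse (sqrt (h y (e b y) (e b y))) *\<^sub>R e b y)"
    using e0 by auto
  have "smooth_on S (\<lambda>y. \<Sum>b\<in>Basis. (l y (e b y) * inverse (h y (e b y) (e b y))) *\<^sub>R e b y)"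
  proof (rule smooth_on_sum[OF S])
    fix b :: 'b assume b: "b \<in> Basis"
    have 1: "smooth_on S (\<lambda>y. l y (e b y))"
      by (rule smooth_on_apply[OF S l(1) l(2) e(1)[OF b]])
    have 2: "smooth_on S (\<lambda>y. h y (e b y) (e b y))"
      by (rule smooth_on_bilinear_apply[OF S inner_form.bil[OF form] sm e(1)[OF b] e(1)[OF b]])
    have 3: "smooth_on S (\<lambda>y. inverse (h y (e b y) (e b y)))"
      by (rule smooth_on_inverse[OF S 2]) (use e(2)[OF _ b] in force)
    show "smooth_on S (\<lambda>y. (l y (e b y) * inverse (h y (e b y) (e b y))) *\<^sub>R e b y)"
      by (rule smooth_on_scaleR[OF S smooth_on_mult[OF S 1 3] e(1)[OF b]])
  qed
  moreover have "(\<Sum>b\<in>Basis. (l y (e b y) * inverse (h y (e b y) (e b y))) *\<^sub>R e b y) = w y"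
    if y: "y \<in> S" for y
  proof -
    interpret inner_frame "h y" Basis "\<lambda>b. inverse (sqrt (h y (e b y) (e b y))) *\<^sub>R e b y"
      by (rule e(3)[OF y])
    have "w y = (\<Sum>b\<in>Basis. l y (inverse (sqrt (h y (e b y) (e b y))) *\<^sub>R e b y) *\<^sub>R
        inverse (sqrt (h y (e b y) (e b y))) *\<^sub>R e b y)"
      using expand[of "w y"] by (simp add: w[OF y])
    also have "\<dots> = (\<Sum>b\<in>Basis. (l y (e b y) * inverse (h y (e b y) (e b y))) *\<^sub>R e b y)"
    proof (rule sum.cong)
      fix b :: 'b assume b: "b \<in> Basis"
      have "inverse (sqrt (h y (e b y) (e b y))) * inverse (sqrt (h y (e b y) (e b y))) =
          inverse (h y (e b y) (e b y))"
        using e(2)[OF y b] by (metis inverse_mult_distrib less_imp_le real_sqrt_mult_self abs_of_nonneg)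
      then show "l y (inverse (sqrt (h y (e b y) (e b y))) *\<^sub>R e b y) *\<^sub>R
          inverse (sqrt (h y (e b y) (e b y))) *\<^sub>R e b y = (l y (e b y) * inverse (h y (e b y) (e b y))) *\<^sub>R e b y"
        unfolding linear_scale[OF l(1)[OF y]] by simp
    qed simp
    finally show ?thesis by simp
  qed
  ultimately show ?thesis by (rule smooth_on_cong[OF S, rotated])
qed

section \<open>The frame behind the metric traces\<close>

context inner_form begin

lemma orthonormal_frame_exists: "\<exists>E. orthonormal_frame h E"
proof -
  \<comment> \<open>The smooth construction is applied to the family that is constantly
    \<open>h\<close>; the base point 0 is arbitrary.\<close>
  obtain e :: "'a \<Rightarrow> 'a \<Rightarrow> 'a" where e: "inner_frame h (Basis :: 'a set) (\<lambda>b. inverse (sqrt (h (e b (0::'a)) (e b 0))) *\<^sub>R e b 0)"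
    using smooth_frame_expansion[of "UNIV :: 'a set" "\<lambda>_. h", OF open_UNIV inner_form_axioms smooth_on_const]
    by auto
  obtain \<pi> where \<pi>: "bij_betw \<pi> {0..<DIM('a)} (Basis :: 'a set)"
    using ex_bij_betw_nat_finite[OF finite_Basis] by blast
  have "orthonormal_frame h (\<lambda>i. inverse (sqrt (h (e (\<pi> i) (0::'a)) (e (\<pi> i) 0))) *\<^sub>R e (\<pi> i) 0)"
    unfolding orthonormal_frame_def
  proof (intro allI impI)
    fix i j assume "i < DIM('a)" "j < DIM('a)"
    then have "\<pi> i \<in> Basis" "\<pi> j \<in> Basis" "\<pi> i = \<pi> j \<longleftrightarrow> i = j"
      using \<pi> by (auto simp: bij_betw_def inj_on_def)
    then show "h (inverse (sqrt (h (e (\<pi> i) 0) (e (\<pi> i) 0))) *\<^sub>R e (\<pi> i) 0)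
        (inverse (sqrt (h (e (\<pi> j) 0) (e (\<pi> j) 0))) *\<^sub>R e (\<pi> j) 0) = (if i = j then 1 else 0)"
      using inner_frame.orth[OF e, of "\<pi> i" "\<pi> j"] by simp
  qed
  then show ?thesis by blast
qed

text \<open>This is literally the choice made inside \<open>form_trace\<close>, so metric traces
  unfold to sums over \<open>fr\<close> without any independence of the frame.\<close>

definition fr :: "nat \<Rightarrow> 'a" where "fr = (SOME E. orthonormal_frame h E)"

lemma fr: "inner_frame h {..<DIM('a)} fr"
proof -
  have "orthonormal_frame h fr" unfolding fr_def by (rule someI_ex[OF orthonormal_frame_exists])
  then show ?thesis by unfold_locales (auto simp: orthonormal_frame_def)
qed

lemma form_trace_fr: "form_trace h \<beta> = (\<Sum>i<DIM('a). \<beta> (fr i) (fr i))"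
  by (simp add: form_trace_def fr_def Let_def)

lemma dual_exists:
  assumes "linear l" shows "\<exists>w. \<forall>z. h w z = l z"
proof -
  interpret inner_frame h "{..<DIM('a)}" fr by (rule fr)
  have "h (\<Sum>i<DIM('a). l (fr i) *\<^sub>R fr i) z = l z" for z
    using contract_real[OF assms, of z]
    by (simp add: sum_left form_simps sym[of z] mult.commute)
  then show ?thesis by blast
qed

lemma end_trace_eq: "linear B \<Longrightarrow> end_trace h B = lin_trace B"
  using inner_frame.trace_frame[OF fr] by (simp add: end_trace_def form_trace_fr)

lemma end_norm_sq_eq:
  assumes "linear B" "\<And>u v. h (B u) v = h u (B v)"
  shows "end_norm_sq h B = lin_trace (\<lambda>u. B (B u))"
  using inner_frame.trace_frame[OF fr linear_compose[OF assms(1) assms(1)]]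
  by (simp add: end_norm_sq_def form_trace_fr assms(2) sym o_def)

end

section \<open>Metric connections in a coordinate domain\<close>

lemma linear_fderiv_family:
  assumes S: "open S" "x \<in> S" and l: "\<And>y. y \<in> S \<Longrightarrow> linear (L y)"
    and L: "\<And>v. (\<lambda>y. L y v) differentiable (at x)"
  shows "linear (\<lambda>v. fderiv (\<lambda>y. L y v) x u)"
proof (rule linearI)
  fix v w
  have "((\<lambda>y. L y v + L y w) has_derivative (\<lambda>u. fderiv (\<lambda>y. L y v) x u + fderiv (\<lambda>y. L y w) x u)) (at x)"
    by (intro has_derivative_add fderiv_works L)
  then have "((\<lambda>y. L y (v + w)) has_derivative (\<lambda>u. fderiv (\<lambda>y. L y v) x u + fderiv (\<lambda>y. L y w) x u)) (at x)"
    by (rule has_derivative_transform_within_open[OF _ S]) (simp add: linear_add[OF l])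
  then show "fderiv (\<lambda>y. L y (v + w)) x u = fderiv (\<lambda>y. L y v) x u + fderiv (\<lambda>y. L y w) x u"
    by (simp add: fderiv_eqI)
next
  fix r v
  have "((\<lambda>y. r *\<^sub>R L y v) has_derivative (\<lambda>u. r *\<^sub>R fderiv (\<lambda>y. L y v) x u)) (at x)"
    by (intro has_derivative_scaleR_right fderiv_works L)
  then have "((\<lambda>y. L y (r *\<^sub>R v)) has_derivative (\<lambda>u. r *\<^sub>R fderiv (\<lambda>y. L y v) x u)) (at x)"
    by (rule has_derivative_transform_within_open[OF _ S]) (simp add: linear_scale[OF l])
  then show "fderiv (\<lambda>y. L y (r *\<^sub>R v)) x u = r *\<^sub>R fderiv (\<lambda>y. L y v) x u"
    by (simp add: fderiv_eqI)
qed

text \<open>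
  A connection, compatible with the metric \<open>k\<close>, on a trivial bundle over \<open>S\<close>. It is used both for
  the Levi-Civita connection and for the ambient connection along an immersion. Directions of
  differentiation are constant coordinate vectors; these commute, hence no bracket in \<open>curv\<close>.
\<close>

locale metric_connection =
  fixes S :: "'e::euclidean_space set" and C :: "'e \<Rightarrow> 'e \<Rightarrow> 'b::euclidean_space \<Rightarrow> 'b"
    and k :: "'e \<Rightarrow> 'b \<Rightarrow> 'b \<Rightarrow> real"
  assumes S: "open S" and C_bil: "y \<in> S \<Longrightarrow> bilinear (C y)"
    and C_smooth: "smooth_on S (\<lambda>y. C y u w)"
    and k_form: "y \<in> S \<Longrightarrow> inner_form (k y)"
    and k_smooth: "smooth_on S (\<lambda>y. k y v w)"
    and compat: "y \<in> S \<Longrightarrow> fderiv (\<lambda>y. k y v w) y u = k y (C y u v) w + k y v (C y u w)"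
begin

definition cov :: "('e \<Rightarrow> 'b) \<Rightarrow> 'e \<Rightarrow> 'e \<Rightarrow> 'b"
  where "cov W y u = fderiv W y u + C y u (W y)"

text \<open>For a constant section \<open>w\<close> the field \<open>\<lambda>y. C y v w\<close> is
  its covariant derivative in direction \<open>v\<close>, so this is the commutator of two covariant
  derivatives on constant sections.\<close>

definition curv :: "'e \<Rightarrow> 'e \<Rightarrow> 'e \<Rightarrow> 'b \<Rightarrow> 'b"
  where "curv y u v w = cov (\<lambda>y. C y v w) y u - cov (\<lambda>y. C y u w) y v"

definition covend :: "('e \<Rightarrow> 'b \<Rightarrow> 'b) \<Rightarrow> 'e \<Rightarrow> 'e \<Rightarrow> 'b \<Rightarrow> 'b"
  where "covend B y u w = cov (\<lambda>y. B y w) y u - B y (C y u w)"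

lemma C_linear: "y \<in> S \<Longrightarrow> linear (C y u)" "y \<in> S \<Longrightarrow> linear (\<lambda>u. C y u w)"
  using C_bil by (simp_all add: bilinear_def)

lemma linear_cov:
  assumes "y \<in> S" "W differentiable (at y)" shows "linear (cov W y)"
  unfolding cov_def using assms
  by (intro linear_compose_add linear_frechet_derivative C_linear)

lemma cov_cong:
  assumes y: "y \<in> S" "\<And>y. y \<in> S \<Longrightarrow> W y = W' y" "W differentiable (at y)"
  shows "cov W' y = cov W y"
proof -
  have "fderiv W' y = fderiv W y" by (rule fderiv_cong_open(2)[OF S y])
  then show ?thesis by (simp add: cov_def y fun_eq_iff)
qed

lemma cov_add:
  assumes y: "y \<in> S" and W: "W differentiable (at y)" "W' differentiable (at y)"
  shows "cov (\<lambda>y. W y + W' y) y u = cov W y u + cov W' y u"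
proof -
  have "fderiv (\<lambda>y. W y + W' y) y = (\<lambda>u. fderiv W y u + fderiv W' y u)"
    by (intro fderiv_eqI has_derivative_add fderiv_works W)
  then show ?thesis by (simp add: cov_def linear_add[OF C_linear(1)[OF y]])
qed

lemma cov_diff:
  assumes y: "y \<in> S" and W: "W differentiable (at y)" "W' differentiable (at y)"
  shows "cov (\<lambda>y. W y - W' y) y u = cov W y u - cov W' y u"
proof -
  have "fderiv (\<lambda>y. W y - W' y) y = (\<lambda>u. fderiv W y u - fderiv W' y u)"
    by (intro fderiv_eqI has_derivative_diff fderiv_works W)
  then show ?thesis by (simp add: cov_def linear_diff[OF C_linear(1)[OF y]])
qed

lemma cov_minus:
  assumes y: "y \<in> S" and W: "W differentiable (at y)"
  shows "cov (\<lambda>y. - W y) y u = - cov W y u"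
proof -
  have "fderiv (\<lambda>y. - W y) y = (\<lambda>u. - fderiv W y u)"
    by (intro fderiv_eqI has_derivative_minus fderiv_works W)
  then show ?thesis by (simp add: cov_def linear_neg[OF C_linear(1)[OF y]])
qed

lemma cov_scaleR:
  assumes y: "y \<in> S" and W: "r differentiable (at y)" "W differentiable (at y)"
  shows "cov (\<lambda>y. r y *\<^sub>R W y) y u = fderiv r y u *\<^sub>R W y + r y *\<^sub>R cov W y u"
proof -
  have "fderiv (\<lambda>y. r y *\<^sub>R W y) y = (\<lambda>u. r y *\<^sub>R fderiv W y u + fderiv r y u *\<^sub>R W y)"
    by (intro fderiv_eqI has_derivative_scaleR fderiv_works W)
  then show ?thesis by (simp add: cov_def linear_scale[OF C_linear(1)[OF y]] algebra_simps)
qed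

lemma smooth_cov:
  assumes "smooth_on S W" shows "smooth_on S (\<lambda>y. cov W y u)"
  unfolding cov_def
  by (intro smooth_on_add S smooth_on_fderiv assms smooth_on_apply[OF S C_linear(1) C_smooth])

lemma smooth_form: "smooth_on S W \<Longrightarrow> smooth_on S W' \<Longrightarrow> smooth_on S (\<lambda>y. k y (W y) (W' y))"
  by (rule smooth_on_bilinear_apply[OF S inner_form.bil[OF k_form] k_smooth])

lemma cov_metric:
  assumes y: "y \<in> S" and W: "W differentiable (at y)" "W' differentiable (at y)"
  shows "((\<lambda>y. k y (W y) (W' y)) has_derivative
    (\<lambda>u. k y (cov W y u) (W' y) + k y (W y) (cov W' y u))) (at y)"
proof -
  interpret inner_form "k y" by (rule k_form[OF y])
  show ?thesis
    using fderiv_bilinear_apply[OF S y inner_form.bil[OF k_form] k_smooth W]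
    by (simp add: compat[OF y] cov_def form_simps algebra_simps)
qed

lemma fderiv_C:
  assumes y: "y \<in> S" and W: "W differentiable (at y)"
  shows "cov (\<lambda>y. C y v (W y)) y u = cov (\<lambda>z. C z v (W y)) y u + C y v (fderiv W y u)"
  using fderiv_eqI[OF fderiv_apply[OF S y C_linear(1) smooth_on_differentiable[OF C_smooth y] W]]
  by (simp add: cov_def algebra_simps)

text \<open>Second coordinate derivatives of \<open>W\<close> commute, and the terms with one
  derivative of \<open>W\<close> are symmetric in \<open>u\<close> and \<open>v\<close>. Only the
  derivatives of the connection coefficients and their products survive, and these see
  \<open>W\<close> at the point alone.\<close>

lemma commutator:
  assumes y: "y \<in> S" and W: "smooth_on S W"
  shows "cov (\<lambda>y. cov W y v) y u - cov (\<lambda>y. cov W y u) y v = curv y u v (W y)"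
proof -
  have d: "W differentiable (at y)" "(\<lambda>y. fderiv W y v) differentiable (at y)"
    "(\<lambda>y. C y v (W y)) differentiable (at y)" for v
    using W y smooth_on_apply[OF S C_linear(1) C_smooth W]
    by (auto intro: smooth_on_differentiable smooth_on_fderiv)
  have "cov (\<lambda>y. cov W y v) y u = fderiv (\<lambda>y. fderiv W y v) y u + C y u (fderiv W y v)
      + (cov (\<lambda>z. C z v (W y)) y u + C y v (fderiv W y u))" for u v
    unfolding cov_def[of W] cov_add[OF y d(2,3)] fderiv_C[OF y d(1)]
    by (simp add: cov_def)
  then show ?thesis
    using second_fderiv_sym[OF S y W, of u v] by (simp add: curv_def)
qed

section \<open>Covariant derivatives of endomorphism fields\<close>

context
  fixes B :: "'e \<Rightarrow> 'b \<Rightarrow> 'b"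
  assumes B_linear: "y \<in> S \<Longrightarrow> linear (B y)" and B_smooth: "smooth_on S (\<lambda>y. B y w)"
begin

lemma cov_apply:
  assumes y: "y \<in> S" and W: "W differentiable (at y)"
  shows "cov (\<lambda>y. B y (W y)) y u = covend B y u (W y) + B y (cov W y u)"
  using fderiv_eqI[OF fderiv_apply[OF S y B_linear smooth_on_differentiable[OF B_smooth y] W]]
  by (simp add: cov_def covend_def linear_add[OF B_linear[OF y]])

lemma linear_covend:
  assumes y: "y \<in> S"
  shows "linear (covend B y u)" "linear (\<lambda>u. covend B y u w)"
proof -
  have "linear (\<lambda>w. fderiv (\<lambda>y. B y w) y u)"
    by (rule linear_fderiv_family[OF S y B_linear smooth_on_differentiable[OF B_smooth y]])
  then show "linear (covend B y u)"
    unfolding covend_def cov_def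
    using linear_compose[OF B_linear[OF y] C_linear(1)[OF y]]
      linear_compose[OF C_linear(1)[OF y] B_linear[OF y]]
    by (intro linear_compose_add linear_compose_sub) (auto simp: o_def)
  show "linear (\<lambda>u. covend B y u w)"
    unfolding covend_def
    using linear_compose[OF C_linear(2)[OF y] B_linear[OF y]]
    by (intro linear_compose_sub linear_cov y smooth_on_differentiable[OF B_smooth])
      (auto simp: o_def)
qed

lemma smooth_covend: "smooth_on S (\<lambda>y. covend B y u w)"
  unfolding covend_def
  by (rule smooth_on_diff[OF S smooth_cov[OF B_smooth]],
      rule smooth_on_apply[OF S, of B], erule B_linear, rule B_smooth, rule C_smooth)

text \<open>The two sides of the self-adjointness identity for constant vectors are the same
  function; metric compatibility gives two formulas for its derivative.\<close>

lemma covend_selfadjoint: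
  assumes sa: "\<And>y v w. y \<in> S \<Longrightarrow> k y (B y v) w = k y v (B y w)" and y: "y \<in> S"
  shows "k y (covend B y u v) w = k y v (covend B y u w)"
proof -
  interpret inner_form "k y" by (rule k_form[OF y])
  have c: "cov (\<lambda>_. a) y u = C y u a" for a by (simp add: cov_def frechet_derivative_const)
  have d: "(\<lambda>y. B y w) differentiable (at y)" for w by (rule smooth_on_differentiable[OF B_smooth y])
  have 0: "(\<lambda>_. a :: 'b) differentiable (at y)" for a by simp
  have 1: "((\<lambda>y. k y (B y v) w) has_derivative (\<lambda>u. k y (cov (\<lambda>y. B y v) y u) w
      + k y (B y v) (cov (\<lambda>_. w) y u))) (at y)"
    by (rule cov_metric[OF y d 0])
  have 2: "((\<lambda>y. k y (B y v) w) has_derivative (\<lambda>u. k y (cov (\<lambda>_. v) y u) (B y w)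
      + k y v (cov (\<lambda>y. B y w) y u))) (at y)"
    by (rule has_derivative_transform_within_open[OF cov_metric[OF y 0 d] S y]) (rule sa[symmetric])
  have "k y (cov (\<lambda>y. B y v) y u) w + k y (B y v) (cov (\<lambda>_. w) y u)
      = k y (cov (\<lambda>_. v) y u) (B y w) + k y v (cov (\<lambda>y. B y w) y u)"
    by (rule fun_cong[OF has_derivative_unique[OF 1 2]])
  then show ?thesis by (simp add: c covend_def form_simps sa[OF y])
qed

text \<open>The connection enters the covariant derivative of \<open>B\<close> through the
  commutator of \<open>C y u\<close> with \<open>B y\<close>, whose trace is zero. So the plain
  derivative of a coordinate trace is already the trace of the covariant derivative.\<close>

lemma covend_trace:
  assumes y: "y \<in> S"
  shows "((\<lambda>y. lin_trace (B y)) has_derivative (\<lambda>u. lin_trace (covend B y u))) (at y)"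
proof -
  have "((\<lambda>y. lin_trace (B y)) has_derivative (\<lambda>u. \<Sum>b\<in>Basis. fderiv (\<lambda>y. B y b) y u \<bullet> b)) (at y)"
    unfolding lin_trace_def
    by (intro has_derivative_sum has_derivative_inner_left smooth_on_works[OF B_smooth y])
  moreover have "lin_trace (covend B y u) = (\<Sum>b\<in>Basis. fderiv (\<lambda>y. B y b) y u \<bullet> b)" for u
  proof -
    have "lin_trace (covend B y u) = lin_trace (\<lambda>w. fderiv (\<lambda>y. B y w) y u)
        + lin_trace (\<lambda>w. C y u (B y w)) - lin_trace (\<lambda>w. B y (C y u w))"
      unfolding covend_def cov_def lin_trace_diff lin_trace_add ..
    then show ?thesis
      using lin_trace_commute[OF C_linear(1)[OF y] B_linear[OF y], of u]
      by (simp add: lin_trace_def[of "\<lambda>w. fderiv (\<lambda>y. B y w) y u"])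
  qed
  ultimately show ?thesis by simp
qed

end

lemma covend_trace_comp:
  assumes B: "\<And>y. y \<in> S \<Longrightarrow> linear (B y)" "\<And>w. smooth_on S (\<lambda>y. B y w)"
    and D: "\<And>y. y \<in> S \<Longrightarrow> linear (D y)" "\<And>w. smooth_on S (\<lambda>y. D y w)" and y: "y \<in> S"
  shows "((\<lambda>y. lin_trace (\<lambda>w. B y (D y w))) has_derivative
    (\<lambda>u. lin_trace (\<lambda>w. covend B y u (D y w)) + lin_trace (\<lambda>w. B y (covend D y u w)))) (at y)"
proof -
  have l: "linear (\<lambda>w. B y (D y w))" if "y \<in> S" for y
    using linear_compose[OF D(1) B(1), OF that that] by (simp add: o_def)
  have s: "smooth_on S (\<lambda>y. B y (D y w))" for w
    by (rule smooth_on_apply[OF S B D(2)])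
  have "covend (\<lambda>y w. B y (D y w)) y u = (\<lambda>w. covend B y u (D y w) + B y (covend D y u w))" for u
    using cov_apply[OF B y smooth_on_differentiable[OF D(2) y]]
    by (simp add: fun_eq_iff covend_def[of "\<lambda>y w. B y (D y w)"] covend_def[of D] linear_diff[OF B(1)[OF y]])
  then show ?thesis
    using covend_trace[OF l s y] by (simp add: lin_trace_add)
qed

text \<open>
  The missing correction \<open>covend B y (\<nabla>\<^sub>u v)\<close> in the second derivatives is symmetric in \<open>u\<close> and \<open>v\<close> for a
  torsion-free connection.
\<close>

lemma ricci_identity:
  assumes B: "\<And>y. y \<in> S \<Longrightarrow> linear (B y)" "\<And>w. smooth_on S (\<lambda>y. B y w)" and y: "y \<in> S"
  shows "covend (\<lambda>y. covend B y v) y u w - covend (\<lambda>y. covend B y u) y v w =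
    curv y u v (B y w) - B y (curv y u v w)"
proof -
  have dC: "(\<lambda>y. C y v w) differentiable (at y)" for v w
    by (rule smooth_on_differentiable[OF C_smooth y])
  have d1: "(\<lambda>y. cov (\<lambda>y. B y w) y v) differentiable (at y)" for v w
    by (rule smooth_on_differentiable[OF smooth_cov[OF B(2)] y])
  have d2: "(\<lambda>y. B y (C y v w)) differentiable (at y)" for v w
    by (rule smooth_on_differentiable[OF smooth_on_apply[OF S B C_smooth] y])
  have 3: "cov (\<lambda>y. B y (C y v w)) y u = covend B y u (C y v w) + B y (cov (\<lambda>y. C y v w) y u)" for u v
    by (rule cov_apply[OF B y dC])
  \<comment> \<open>The two terms with a single derivative of \<open>B\<close> form a sum symmetric
    in \<open>u\<close> and \<open>v\<close>, so they drop out on exchanging the directions.\<close>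
  have "covend (\<lambda>y. covend B y v) y u w = cov (\<lambda>y. cov (\<lambda>y. B y w) y v) y u
      - covend B y u (C y v w) - B y (cov (\<lambda>y. C y v w) y u) - covend B y v (C y u w)" for u v
    unfolding covend_def[of "\<lambda>y. covend B y v"] covend_def[of B _ v w] cov_diff[OF y d1 d2]
      3 by simp
  then show ?thesis
    using commutator[OF y B(2), of w v u] by (simp add: curv_def[of y u v w] linear_diff[OF B(1)[OF y]])
qed

end

section \<open>The Levi-Civita connection\<close>

locale riemannian_domain =
  fixes S :: "'e::euclidean_space set" and g :: "'e \<Rightarrow> 'e \<Rightarrow> 'e \<Rightarrow> real"
  assumes open_S: "open S" and form: "y \<in> S \<Longrightarrow> inner_form (g y)"
    and smooth: "smooth_on S (\<lambda>y. g y u v)"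
begin

lemma koszul:
  assumes y: "y \<in> S"
  shows "2 * g y (christoffel g y u v) z =
    fderiv (\<lambda>y. g y v z) y u + fderiv (\<lambda>y. g y u z) y v - fderiv (\<lambda>y. g y u v) y z"
  by (rule christoffel_koszul[OF y open_S inner_form.bil[OF form] inner_form.pos[OF form[OF y]]
        smooth_on_differentiable[OF smooth y]])

lemma christoffel_sym: "y \<in> S \<Longrightarrow> christoffel g y u v = christoffel g y v u"
  by (rule christoffel_levi_civita(1)[OF _ open_S inner_form.bil[OF form] inner_form.sym[OF form]
        inner_form.pos[OF form] smooth_on_differentiable[OF smooth]])

lemma christoffel_metric:
  "y \<in> S \<Longrightarrow> fderiv (\<lambda>y. g y u v) y z = g y (christoffel g y z u) v + g y u (christoffel g y z v)"
  by (rule christoffel_levi_civita(2)[OF _ open_S inner_form.bil[OF form] inner_form.sym[OF form]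
        inner_form.pos[OF form] smooth_on_differentiable[OF smooth]])

lemma linear_fderiv_metric:
  assumes y: "y \<in> S"
  shows "linear (\<lambda>v. fderiv (\<lambda>y. g y v w) y u)" "linear (\<lambda>v. fderiv (\<lambda>y. g y w v) y u)"
    "linear (fderiv (\<lambda>y. g y v w) y)"
  using linear_fderiv_family[OF open_S y inner_form.linear_left[OF form] smooth_on_differentiable[OF smooth y]]
    linear_fderiv_family[OF open_S y inner_form.linear_right[OF form] smooth_on_differentiable[OF smooth y]]
    linear_frechet_derivative[OF smooth_on_differentiable[OF smooth y]]
  by auto

text \<open>Nothing about linearity can be read off the definite description; it is inherited from
  the right-hand side of the Koszul formula by pairing with all \<open>z\<close>.\<close>

lemma christoffel_linear:
  assumes y: "y \<in> S" shows "linear (christoffel g y u)"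
proof -
  interpret inner_form "g y" by (rule form[OF y])
  note lin = linear_fderiv_metric[OF y]
  show ?thesis
  proof (rule linearI)
    fix v w
    have "2 * g y (christoffel g y u (v + w)) z = 2 * g y (christoffel g y u v + christoffel g y u w) z" for z
      by (simp add: form_simps koszul[OF y] distrib_left linear_add[OF lin(1)] linear_add[OF lin(2)] linear_add[OF lin(3)])
    then show "christoffel g y u (v + w) = christoffel g y u v + christoffel g y u w"
      by (intro eqI) simp
  next
    fix r v
    have "2 * g y (christoffel g y u (r *\<^sub>R v)) z = r * (2 * g y (christoffel g y u v) z)" for z
      unfolding koszul[OF y]
      by (simp add: linear_scale[OF lin(1)] linear_scale[OF lin(2)] linear_scale[OF lin(3)] algebra_simps)
    then show "christoffel g y u (r *\<^sub>R v) = r *\<^sub>R christoffel g y u v"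
      by (intro eqI) (simp add: form_simps)
  qed
qed

lemma christoffel_smooth: "smooth_on S (\<lambda>y. christoffel g y u v)"
proof (rule smooth_on_dual[OF open_S form smooth])
  show "g y (christoffel g y u v) z = (fderiv (\<lambda>y. g y v z) y u + fderiv (\<lambda>y. g y u z) y v
      - fderiv (\<lambda>y. g y u v) y z) / 2" if "y \<in> S" for y z
    using koszul[OF that, of u v z] by simp
  show "linear (\<lambda>z. (fderiv (\<lambda>y. g y v z) y u + fderiv (\<lambda>y. g y u z) y v
      - fderiv (\<lambda>y. g y u v) y z) / 2)" if y: "y \<in> S" for y
    using linear_compose_scale_right[OF linear_compose_sub[OF linear_compose_add[OF
      linear_fderiv_metric(2)[OF y] linear_fderiv_metric(2)[OF y]] linear_fderiv_metric(3)[OF y]], of "1/2"]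
    by simp
  show "smooth_on S (\<lambda>y. (fderiv (\<lambda>y. g y v z) y u + fderiv (\<lambda>y. g y u z) y v
      - fderiv (\<lambda>y. g y u v) y z) / 2)" for z
  proof -
    have "smooth_on S (\<lambda>y. (fderiv (\<lambda>y. g y v z) y u + fderiv (\<lambda>y. g y u z) y v
      - fderiv (\<lambda>y. g y u v) y z))"
      by (intro smooth_on_diff smooth_on_add open_S smooth_on_fderiv smooth)
    then show ?thesis
      by (rule smooth_on_linear[OF bounded_linear_divide open_S])
  qed
qed

sublocale metric_connection S "christoffel g" g
proof (rule metric_connection.intro)
  fix y assume y: "y \<in> S"
  show "bilinear (christoffel g y)"
    unfolding bilinear_def using christoffel_linear[OF y] christoffel_sym[OF y] by simp
qed (use christoffel_smooth christoffel_metric open_S form smooth in auto)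

text \<open>Inserting compatibility and symmetry into the Koszul formula leaves twice the pairing
  with \<open>C u v\<close>. The lemma is used to recognise the projected ambient derivative as the
  Levi-Civita connection of the induced metric.\<close>

lemma christoffel_unique:
  assumes y: "y \<in> S" and s: "\<And>u v. C u v = C v u"
    and m: "\<And>u v w. fderiv (\<lambda>y. g y v w) y u = g y (C u v) w + g y v (C u w)"
  shows "christoffel g y u v = C u v"
proof -
  interpret inner_form "g y" by (rule form[OF y])
  show ?thesis
  proof (rule eqI)
    fix z
    have "2 * g y (christoffel g y u v) z = 2 * g y (C u v) z"
      unfolding koszul[OF y] m s[of z u] s[of z v] s[of v u] sym[of "C u z" v] by simp
    then show "g y (christoffel g y u v) z = g y (C u v) z" by simp
  qed
qed

end

section \<open>Submanifolds of a complex space form in coordinates\<close>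

text \<open>Parallelism of \<open>J\<close> and the curvature formula are recorded for constant
  coordinate vectors only. They are tensorial, so this carries the full pointwise information;
  \<open>amb_cov_J\<close> recovers the rule for arbitrary fields along the immersion.\<close>

locale space_form_domain = ambient: riemannian_domain \<Omega> g
  for \<Omega> :: "'f::euclidean_space set" and g +
  fixes J :: "'f \<Rightarrow> 'f \<Rightarrow> 'f" and c :: real
  assumes J_linear: "y \<in> \<Omega> \<Longrightarrow> linear (J y)" and J_smooth: "smooth_on \<Omega> (\<lambda>y. J y u)"
    and J_J: "y \<in> \<Omega> \<Longrightarrow> J y (J y u) = - u"
    and J_isometry: "y \<in> \<Omega> \<Longrightarrow> g y (J y u) (J y v) = g y u v"
    and J_parallel: "y \<in> \<Omega> \<Longrightarrow> ambient.cov (\<lambda>y. J y v) y u = J y (christoffel g y u v)"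
    and space_form: "y \<in> \<Omega> \<Longrightarrow> ambient.curv y u v w = (c / 4) *\<^sub>R
      (g y v w *\<^sub>R u - g y u w *\<^sub>R v + g y (J y v) w *\<^sub>R J y u
       - g y (J y u) w *\<^sub>R J y v + (2 * g y u (J y v)) *\<^sub>R J y w)"

locale immersed_domain = space_form_domain \<Omega> g J c
  for \<Omega> :: "'f::euclidean_space set" and g J c +
  fixes S :: "'e::euclidean_space set" and F :: "'e \<Rightarrow> 'f"
  assumes open_S: "open S" and F_in: "y \<in> S \<Longrightarrow> F y \<in> \<Omega>" and F_smooth: "smooth_on S F"
    and F_inj: "y \<in> S \<Longrightarrow> inj (fderiv F y)"
begin

abbreviation d :: "'e \<Rightarrow> 'e \<Rightarrow> 'f" where "d y \<equiv> fderiv F y"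
abbreviation h :: "'e \<Rightarrow> 'e \<Rightarrow> 'e \<Rightarrow> real" where "h \<equiv> induced_metric g F"
abbreviation tanp :: "'e \<Rightarrow> 'f \<Rightarrow> 'e" where "tanp \<equiv> tangential g F"
abbreviation sff :: "'e \<Rightarrow> 'e \<Rightarrow> 'e \<Rightarrow> 'f" where "sff \<equiv> second_fundamental_form g F"

lemma F_image: "F ` S \<subseteq> \<Omega>" using F_in by blast

lemma d_linear: "y \<in> S \<Longrightarrow> linear (d y)"
  by (rule linear_frechet_derivative[OF smooth_on_differentiable[OF F_smooth]])

lemma d_smooth: "smooth_on S (\<lambda>y. d y u)"
  by (rule smooth_on_fderiv[OF F_smooth])

lemma form_F: "y \<in> S \<Longrightarrow> inner_form (g (F y))"
  using ambient.form F_in by blast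

lemma fderiv_F:
  assumes "smooth_on \<Omega> r" and y: "y \<in> S"
  shows "fderiv (\<lambda>y. r (F y)) y u = fderiv r (F y) (d y u)"
  using fderiv_eqI[OF has_derivative_compose[OF smooth_on_works[OF F_smooth y]
      smooth_on_works[OF assms(1) F_in[OF y]]]]
  by simp

text \<open>This is the ambient connection pulled back to the submanifold: directions lie in
  \<open>'e\<close>, sections take values in \<open>'f\<close>, and the differential of
  \<open>F\<close> sits inside the connection coefficients.\<close>

sublocale amb: metric_connection S "\<lambda>y u w. christoffel g (F y) (d y u) w" "\<lambda>y. g (F y)"
proof (rule metric_connection.intro)
  fix y assume y: "y \<in> S"
  note [simp] = ambient.C_linear[OF F_in[OF y]]
  show "bilinear (\<lambda>u w. christoffel g (F y) (d y u) w)"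
    unfolding bilinear_def
    using linear_compose[OF d_linear[OF y] ambient.C_linear(2)[OF F_in[OF y]]] by (simp add: o_def)
  show "inner_form (g (F y))" by (rule form_F[OF y])
  show "fderiv (\<lambda>y. g (F y) v w) y u = g (F y) (christoffel g (F y) (d y u) v) w
      + g (F y) v (christoffel g (F y) (d y u) w)" for u v w
    unfolding fderiv_F[OF ambient.smooth y] by (rule ambient.christoffel_metric[OF F_in[OF y]])
next
  show "smooth_on S (\<lambda>y. christoffel g (F y) (d y u) w)" for u w
    by (rule smooth_on_apply[OF open_S, of "\<lambda>y a. christoffel g (F y) a w"])
      (auto intro: ambient.C_linear F_in d_smooth
        smooth_on_compose[OF open_S F_image F_smooth ambient.C_smooth])
  show "smooth_on S (\<lambda>y. g (F y) v w)" for v w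
    by (rule smooth_on_compose[OF open_S F_image F_smooth ambient.smooth])
qed (rule open_S)

lemma induced_form: "y \<in> S \<Longrightarrow> inner_form (h y)"
proof
  assume y: "y \<in> S"
  interpret inner_form "g (F y)" by (rule form_F[OF y])
  show "bilinear (h y)"
    unfolding bilinear_def induced_metric_def
    using linear_compose[OF d_linear[OF y] linear_left] linear_compose[OF d_linear[OF y] linear_right]
    by (simp add: o_def)
  show "h y u v = h y v u" for u v by (simp add: induced_metric_def sym)
  show "0 < h y u u" if "u \<noteq> 0" for u
    unfolding induced_metric_def using that F_inj[OF y] linear_injective_0[OF d_linear[OF y]]
    by (auto intro!: pos)
qed

sublocale sub: riemannian_domain S h
proof
  fix u v
  show "smooth_on S (\<lambda>y. h y u v)"
    unfolding induced_metric_def by (rule amb.smooth_form[OF d_smooth d_smooth])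
qed (use open_S induced_form in \<open>auto simp: inner_form_def\<close>)

lemma amb_cov: "amb.cov W y u = nabla_along g F W y u"
  by (simp add: amb.cov_def nabla_along_def)

lemma amb_sym:
  assumes y: "y \<in> S" shows "amb.cov (\<lambda>y. d y v) y u = amb.cov (\<lambda>y. d y u) y v"
  using second_fderiv_sym[OF open_S y F_smooth, of u v] ambient.christoffel_sym[OF F_in[OF y]]
  by (simp add: amb.cov_def)

text \<open>The pulled-back coefficients depend on the differential of \<open>F\<close>, so
  differentiating them produces second derivatives of \<open>F\<close>; these are symmetric and
  cancel in the commutator.\<close>

lemma amb_curv:
  assumes y: "y \<in> S" shows "amb.curv y u v w = ambient.curv (F y) (d y u) (d y v) w"
proof -
  have lin: "linear (\<lambda>a. christoffel g (F z) a w)" if "z \<in> S" for z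
    by (rule ambient.C_linear[OF F_in[OF that]])
  have sm: "smooth_on S (\<lambda>y. christoffel g (F y) a w)" for a
    by (rule smooth_on_compose[OF open_S F_image F_smooth ambient.C_smooth])
  have "amb.cov (\<lambda>y. christoffel g (F y) (d y v) w) y u =
      fderiv (\<lambda>z. christoffel g z (d y v) w) (F y) (d y u)
      + christoffel g (F y) (fderiv (\<lambda>y. d y v) y u) w
      + christoffel g (F y) (d y u) (christoffel g (F y) (d y v) w)" for u v
    using fderiv_eqI[OF fderiv_apply[of S y "\<lambda>z a. christoffel g (F z) a w" "\<lambda>y. d y v",
          OF open_S y lin smooth_on_differentiable[OF sm y] smooth_on_differentiable[OF d_smooth y]]]
    by (simp add: amb.cov_def fderiv_F[OF ambient.C_smooth y])
  then show ?thesis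
    using second_fderiv_sym[OF open_S y F_smooth, of u v]
    by (simp add: amb.curv_def ambient.curv_def ambient.cov_def)
qed

lemma J_F: "y \<in> S \<Longrightarrow> linear (J (F y))" "smooth_on S (\<lambda>y. J (F y) w)"
  by (auto intro: J_linear F_in smooth_on_compose[OF open_S F_image F_smooth J_smooth])

lemma J_smooth_field: "smooth_on S W \<Longrightarrow> smooth_on S (\<lambda>y. J (F y) (W y))"
  by (rule smooth_on_apply[OF open_S J_F])

lemma amb_cov_J:
  assumes y: "y \<in> S" and W: "W differentiable (at y)"
  shows "amb.cov (\<lambda>y. J (F y) (W y)) y u = J (F y) (amb.cov W y u)"
proof -
  have "amb.covend (\<lambda>y. J (F y)) y u w = 0" for w
    using J_parallel[OF F_in[OF y], of w "d y u"] fderiv_F[OF J_smooth y, of w u]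
    by (simp add: amb.covend_def amb.cov_def ambient.cov_def)
  then show ?thesis using amb.cov_apply[OF J_F y W] by simp
qed

lemma J_skew:
  assumes y: "y \<in> S" shows "g (F y) (J (F y) u) v = - g (F y) u (J (F y) v)"
proof -
  interpret inner_form "g (F y)" by (rule form_F[OF y])
  have "g (F y) (J (F y) u) v = - g (F y) (J (F y) u) (J (F y) (J (F y) v))"
    by (simp add: J_J[OF F_in[OF y]] form_simps)
  then show ?thesis by (simp add: J_isometry[OF F_in[OF y]])
qed

section \<open>Tangential parts and the formulas of Gauss and Weingarten\<close>

text \<open>The linear form on the right is represented by a tangent vector because the induced
  metric is definite, and that vector is the only candidate for the definite description.\<close>

lemma tan_h:
  assumes y: "y \<in> S" shows "h y (tanp y w) v = g (F y) w (d y v)"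
proof -
  interpret g: inner_form "g (F y)" by (rule form_F[OF y])
  interpret h: inner_form "h y" by (rule induced_form[OF y])
  have "linear (\<lambda>v. g (F y) w (d y v))"
    using linear_compose[OF d_linear[OF y] g.linear_right] by (simp add: o_def)
  then obtain u where u: "\<And>v. h y u v = g (F y) w (d y v)" using h.dual_exists by blast
  have "tanp y w = u"
    unfolding tangential_def
  proof (rule the_equality)
    show "\<forall>v. g (F y) (w - d y u) (d y v) = 0"
      using u by (simp add: g.form_simps induced_metric_def)
    fix u' assume "\<forall>v. g (F y) (w - d y u') (d y v) = 0"
    then show "u' = u"
      by (intro h.eqI) (simp add: u[unfolded induced_metric_def] g.form_simps induced_metric_def)
  qed
  then show ?thesis using u by simp
qed

lemma tan_eqI:
  assumes y: "y \<in> S" and u: "\<And>v. h y u v = g (F y) w (d y v)" shows "tanp y w = u"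
  by (rule inner_form.eqI[OF induced_form[OF y]]) (simp only: tan_h[OF y] u)

lemma tan_linear:
  assumes y: "y \<in> S" shows "linear (tanp y)"
proof -
  interpret g: inner_form "g (F y)" by (rule form_F[OF y])
  interpret h: inner_form "h y" by (rule induced_form[OF y])
  show ?thesis
    by (intro linearI tan_eqI[OF y]) (simp_all add: g.form_simps h.form_simps tan_h[OF y])
qed

lemma tan_d: "y \<in> S \<Longrightarrow> tanp y (d y u) = u"
  by (rule tan_eqI) (simp_all add: induced_metric_def)

lemma tan_smooth: "smooth_on S W \<Longrightarrow> smooth_on S (\<lambda>y. tanp y (W y))"
proof (rule smooth_on_dual[OF open_S induced_form sub.smooth])
  assume W: "smooth_on S W"
  show "linear (\<lambda>v. g (F y) (W y) (d y v))" if y: "y \<in> S" for y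
    using linear_compose[OF d_linear[OF y] inner_form.linear_right[OF form_F[OF y]]] by (simp add: o_def)
  show "smooth_on S (\<lambda>y. g (F y) (W y) (d y v))" for v
    by (rule amb.smooth_form[OF W d_smooth])
  show "h y (tanp y (W y)) v = g (F y) (W y) (d y v)" if "y \<in> S" for y v
    by (rule tan_h[OF that])
qed

lemma sff_eq: "sff y u v = amb.cov (\<lambda>y. d y v) y u - d y (christoffel h y u v)"
  by (simp add: second_fundamental_form_def amb_cov nabla_def frechet_derivative_const)

text \<open>The tangential part of the ambient derivative is symmetric, by symmetry of second
  derivatives of \<open>F\<close>, and metric, by ambient compatibility; uniqueness does the rest.
  Normality of \<open>sff\<close> is a consequence.\<close>

lemma christoffel_induced:
  assumes y: "y \<in> S" shows "christoffel h y u v = tanp y (amb.cov (\<lambda>y. d y v) y u)"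
proof (rule sub.christoffel_unique[OF y])
  interpret g: inner_form "g (F y)" by (rule form_F[OF y])
  interpret h: inner_form "h y" by (rule induced_form[OF y])
  have t: "h y v (tanp y w) = g (F y) (d y v) w" for v w
    using tan_h[OF y, of w v] h.sym[of v "tanp y w"] g.sym[of w "d y v"] by simp
  show "tanp y (amb.cov (\<lambda>y. d y v) y u) = tanp y (amb.cov (\<lambda>y. d y u) y v)" for u v
    by (simp only: amb_sym[OF y, of v u])
  show "fderiv (\<lambda>y. h y v w) y u = h y (tanp y (amb.cov (\<lambda>y. d y v) y u)) w
      + h y v (tanp y (amb.cov (\<lambda>y. d y w) y u))" for u v w
    unfolding tan_h[OF y] t
    using fderiv_eqI[OF amb.cov_metric[OF y smooth_on_differentiable[OF d_smooth y]
          smooth_on_differentiable[OF d_smooth y]], of v w]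
    by (simp add: induced_metric_def)
qed

lemma sff_normal:
  assumes y: "y \<in> S" shows "g (F y) (sff y u v) (d y z) = 0"
proof -
  interpret g: inner_form "g (F y)" by (rule form_F[OF y])
  show ?thesis
    using tan_h[OF y, of "amb.cov (\<lambda>y. d y v) y u" z]
    by (simp add: sff_eq g.form_simps christoffel_induced[OF y] induced_metric_def)
qed

lemma tan_sff:
  assumes y: "y \<in> S" shows "tanp y (sff y u v) = 0"
proof (rule tan_eqI[OF y])
  interpret h: inner_form "h y" by (rule induced_form[OF y])
  show "h y 0 z = g (F y) (sff y u v) (d y z)" for z
    using sff_normal[OF y, of u v z] h.form_simps by simp
qed

lemma sff_sym:
  assumes y: "y \<in> S" shows "sff y u v = sff y v u"
  unfolding sff_eq using amb_sym[OF y, of v u] sub.christoffel_sym[OF y, of u v] by simp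

lemma sff_bilinear:
  assumes y: "y \<in> S" shows "bilinear (sff y)"
proof -
  have l: "linear (\<lambda>u. sff y u v)" for v
  proof -
    have 1: "linear (\<lambda>u. amb.cov (\<lambda>y. d y v) y u)"
      by (rule amb.linear_cov[OF y smooth_on_differentiable[OF d_smooth y]])
    have 2: "linear (\<lambda>u. d y (christoffel h y u v))"
      using linear_compose[OF sub.C_linear(2)[OF y] d_linear[OF y]] by (simp add: o_def)
    show ?thesis unfolding sff_eq by (rule linear_compose_sub[OF 1 2])
  qed
  have r: "linear (sff y u)" for u
  proof -
    have "sff y u = (\<lambda>v. sff y v u)" by (rule ext) (rule sff_sym[OF y])
    then show ?thesis by (rule ssubst) (rule l)
  qed
  show ?thesis unfolding bilinear_def using l r by simp
qed

lemma d_smooth_field: "smooth_on S Y \<Longrightarrow> smooth_on S (\<lambda>y. d y (Y y))"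
  by (rule smooth_on_apply[OF open_S d_linear d_smooth])

lemma sff_smooth: "smooth_on S (\<lambda>y. sff y u v)"
  unfolding sff_eq
  by (rule smooth_on_diff[OF open_S amb.smooth_cov[OF d_smooth] d_smooth_field[OF sub.C_smooth]])

text \<open>\<open>sff\<close> is defined through constant fields; the product rule for the
  differential of \<open>F\<close> carries the decomposition over to variable tangent
  fields.\<close>

lemma gauss_formula:
  assumes y: "y \<in> S" and Y: "Y differentiable (at y)"
  shows "amb.cov (\<lambda>y. d y (Y y)) y u = d y (sub.cov Y y u) + sff y u (Y y)"
  using fderiv_eqI[OF fderiv_apply[OF open_S y d_linear smooth_on_differentiable[OF d_smooth y] Y]]
  by (simp add: sff_eq amb.cov_def sub.cov_def linear_add[OF d_linear[OF y]])

lemma shape_operator_eq: "shape_operator g F X y u = - tanp y (amb.cov X y u)"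
  by (simp add: shape_operator_def amb_cov)

lemma shape_h:
  assumes y: "y \<in> S" and X: "X differentiable (at y)"
    and n: "normal_field_on g F S X"
  shows "h y (shape_operator g F X y u) v = g (F y) (X y) (sff y u v)"
proof -
  interpret g: inner_form "g (F y)" by (rule form_F[OF y])
  interpret h: inner_form "h y" by (rule induced_form[OF y])
  \<comment> \<open>The pairing of a normal field with a tangent field vanishes identically, so the
    compatibility formula for its derivative must give zero.\<close>
  have 0: "((\<lambda>_. 0) has_derivative (\<lambda>u. g (F y) (amb.cov X y u) (d y v)
      + g (F y) (X y) (amb.cov (\<lambda>y. d y v) y u))) (at y)"
    by (rule has_derivative_transform_within_open[OF
          amb.cov_metric[OF y X smooth_on_differentiable[OF d_smooth y]] open_S y])
      (use n in \<open>simp add: normal_field_on_def\<close>)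
  have "g (F y) (amb.cov X y u) (d y v) + g (F y) (X y) (amb.cov (\<lambda>y. d y v) y u) = 0"
    using fun_cong[OF has_derivative_unique[OF 0 has_derivative_const]] by blast
  moreover have "g (F y) (X y) (d y z) = 0" for z using n y by (simp add: normal_field_on_def)
  ultimately show ?thesis
    by (simp add: shape_operator_eq h.form_simps tan_h[OF y] sff_eq g.form_simps)
qed

end

context immersed_domain
begin

section \<open>The tangential and normal parts of the complex structure\<close>

text \<open>The operators \<open>tJ\<close> and \<open>nJ\<close> act on arbitrary ambient vectors,
  so one pair covers tangent and normal arguments. \<open>t_tan\<close> is t as an endomorphism of
  the tangent space, and \<open>t_sff\<close> is the composite of t with the second fundamental
  form.\<close>

definition tJ :: "'e \<Rightarrow> 'f \<Rightarrow> 'e" where "tJ y w = tanp y (J (F y) w)"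
definition nJ :: "'e \<Rightarrow> 'f \<Rightarrow> 'f" where "nJ y w = normal_part g F y (J (F y) w)"
definition t_tan :: "'e \<Rightarrow> 'e \<Rightarrow> 'e" where "t_tan y u = tJ y (d y u)"
definition t_sff :: "'e \<Rightarrow> 'e \<Rightarrow> 'e \<Rightarrow> 'e" where "t_sff y u v = tJ y (sff y u v)"

lemma normal_part_normal: "y \<in> S \<Longrightarrow> g (F y) (normal_part g F y w) (d y v) = 0"
  using tan_h[of y w v] inner_form.form_simps[OF form_F]
  by (simp add: normal_part_def induced_metric_def)

lemma J_split: "J (F y) w = d y (tJ y w) + nJ y w"
  by (simp add: tJ_def nJ_def normal_part_def)

lemma tJ_linear: "y \<in> S \<Longrightarrow> linear (tJ y)"
  unfolding tJ_def using linear_compose[OF J_F(1) tan_linear] by (simp add: o_def)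

lemma tJ_smooth: "smooth_on S W \<Longrightarrow> smooth_on S (\<lambda>y. tJ y (W y))"
  unfolding tJ_def by (rule tan_smooth[OF J_smooth_field])

lemma nJ_smooth: "smooth_on S W \<Longrightarrow> smooth_on S (\<lambda>y. nJ y (W y))"
  using smooth_on_diff[OF open_S J_smooth_field d_smooth_field[OF tJ_smooth]]
  by (simp add: nJ_def tJ_def normal_part_def)

lemma nJ_normal: "normal_field_on g F S (\<lambda>y. nJ y (W y))"
  unfolding normal_field_on_def nJ_def using normal_part_normal by blast

lemma t_tan_linear: "y \<in> S \<Longrightarrow> linear (t_tan y)"
  unfolding t_tan_def using linear_compose[OF d_linear tJ_linear] by (simp add: o_def)

lemma t_tan_smooth: "smooth_on S (\<lambda>y. t_tan y u)"
  unfolding t_tan_def by (rule tJ_smooth[OF d_smooth])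

lemma h_tJ: "y \<in> S \<Longrightarrow> h y (tJ y w) v = - g (F y) w (J (F y) (d y v))"
  by (simp add: tJ_def tan_h J_skew)

lemma t_tan_skew:
  assumes y: "y \<in> S" shows "h y (t_tan y u) v = - h y u (t_tan y v)"
proof -
  interpret h: inner_form "h y" by (rule induced_form[OF y])
  interpret g: inner_form "g (F y)" by (rule form_F[OF y])
  show ?thesis
    unfolding h.sym[of u] t_tan_def h_tJ[OF y] using J_skew[OF y, of "d y u" "d y v"]
      g.sym[of "d y u" "J (F y) (d y v)"] g.sym[of "d y v" "J (F y) (d y u)"] by simp
qed

lemma t_sff_bilinear: "y \<in> S \<Longrightarrow> bilinear (t_sff y)"
  unfolding t_sff_def bilinear_def
  using linear_compose[OF _ tJ_linear, of _ y] sff_bilinear[of y]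
  by (auto simp: bilinear_def o_def)

lemma t_sff_sym: "y \<in> S \<Longrightarrow> t_sff y u v = t_sff y v u"
  unfolding t_sff_def using sff_sym by simp

text \<open>Values of \<open>sff\<close> are normal, so adding the tangential part of JW to its
  normal part does not change the pairing.\<close>

lemma shape_nJ:
  assumes y: "y \<in> S" and W: "smooth_on S W"
  shows "h y (shape_operator g F (\<lambda>y. nJ y (W y)) y u) v = g (F y) (J (F y) (W y)) (sff y u v)"
proof -
  interpret g: inner_form "g (F y)" by (rule form_F[OF y])
  show ?thesis
    using shape_h[OF y smooth_on_differentiable[OF nJ_smooth[OF W] y] nJ_normal[of W]]
      sff_normal[OF y, of u v "tJ y (W y)"] g.sym[of "d y (tJ y (W y))"]
    by (simp add: J_split[of y "W y"] g.form_simps)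
qed

text \<open>Skewness of \<open>J\<close> moves it onto the second fundamental form. This eliminates
  shape operators in directions nY in favour of \<open>t_sff\<close>, both in the derivative of t
  and in the term with n(tV).\<close>

lemma shape_nJ_tangent:
  assumes y: "y \<in> S" and Y: "smooth_on S Y"
  shows "h y (shape_operator g F (\<lambda>y. nJ y (d y (Y y))) y u) v = - h y (Y y) (t_sff y u v)"
proof -
  interpret h: inner_form "h y" by (rule induced_form[OF y])
  interpret g: inner_form "g (F y)" by (rule form_F[OF y])
  show ?thesis
    unfolding shape_nJ[OF y d_smooth_field[OF Y]] h.sym[of "Y y"] t_sff_def h_tJ[OF y]
    using g.sym by simp
qed

lemma shape_linear:
  assumes y: "y \<in> S" and W: "smooth_on S W"
  shows "linear (shape_operator g F W y)"
  using linear_compose[OF amb.linear_cov[OF y smooth_on_differentiable[OF W y]] tan_linear[OF y]]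
  unfolding shape_operator_eq[abs_def] by (intro linear_compose_neg) (simp add: o_def)

lemma shape_selfadjoint:
  assumes y: "y \<in> S" and W: "smooth_on S W" "normal_field_on g F S W"
  shows "h y (shape_operator g F W y u) v = h y u (shape_operator g F W y v)"
  unfolding inner_form.sym[OF induced_form[OF y], of u]
    shape_h[OF y smooth_on_differentiable[OF W(1) y] W(2)] sff_sym[OF y, of u v] ..

lemma covend_t_tan:
  assumes y: "y \<in> S"
  shows "h y (sub.covend t_tan y u v) z = h y (t_sff y u v) z - h y v (t_sff y u z)"
proof -
  interpret h: inner_form "h y" by (rule induced_form[OF y])
  define n where "n = (\<lambda>y. nJ y (d y v))"
  have sm: "smooth_on S n" unfolding n_def by (rule nJ_smooth[OF d_smooth])
  have sm': "smooth_on S (\<lambda>y. d y (t_tan y v))" by (rule d_smooth_field[OF t_tan_smooth])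
  \<comment> \<open>The field J applied to a constant tangent field is differentiated in two ways:
    by parallelism of J, and after splitting it into tangential and normal parts. Only the
    tangential components are then compared.\<close>
  have "J (F y) (d y (christoffel h y u v)) + J (F y) (sff y u v) = amb.cov (\<lambda>y. J (F y) (d y v)) y u"
    unfolding amb_cov_J[OF y smooth_on_differentiable[OF d_smooth y]]
    by (simp add: sff_eq linear_diff[OF J_F(1)[OF y]])
  also have "\<dots> = amb.cov (\<lambda>y. d y (t_tan y v) + n y) y u"
    by (simp add: n_def t_tan_def flip: J_split)
  also have "\<dots> = d y (sub.cov (\<lambda>y. t_tan y v) y u) + sff y u (t_tan y v) + amb.cov n y u"
    using amb.cov_add[OF y smooth_on_differentiable[OF sm' y] smooth_on_differentiable[OF sm y]]
      gauss_formula[OF y smooth_on_differentiable[OF t_tan_smooth y]] by simp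
  finally have "t_tan y (christoffel h y u v) + t_sff y u v = sub.cov (\<lambda>y. t_tan y v) y u + tanp y (amb.cov n y u)"
    using linear_add[OF tan_linear[OF y]] tan_d[OF y] tan_sff[OF y]
    by (metis (no_types, lifting) add.right_neutral t_sff_def tJ_def t_tan_def)
  then have "sub.covend t_tan y u v = t_sff y u v + shape_operator g F n y u"
    by (simp add: sub.covend_def shape_operator_eq algebra_simps)
  then show ?thesis
    using shape_nJ_tangent[OF y smooth_on_const, of v u z] by (simp add: h.form_simps n_def)
qed

text \<open>The pulled-back curvature is evaluated on the section \<open>\<lambda>y. d y w\<close>.
  Its first derivative splits into a tangential and a normal field; differentiating the normal one
  contributes tangentially only through its shape operator.\<close>

lemma gauss_equation:
  assumes y: "y \<in> S"
  shows "h y (sub.curv y u v w) z = g (F y) (ambient.curv (F y) (d y u) (d y v) (d y w)) (d y z)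
    + g (F y) (sff y v w) (sff y u z) - g (F y) (sff y u w) (sff y v z)"
proof -
  interpret h: inner_form "h y" by (rule induced_form[OF y])
  interpret g: inner_form "g (F y)" by (rule form_F[OF y])
  have nrm: "normal_field_on g F S (\<lambda>y. sff y v w)" for v w
    by (simp add: normal_field_on_def sff_normal)
  have "g (F y) (amb.cov (\<lambda>y. amb.cov (\<lambda>y. d y w) y v) y u) (d y z) =
    h y (sub.cov (\<lambda>y. christoffel h y v w) y u) z - g (F y) (sff y v w) (sff y u z)" for u v
  proof -
    note dC = smooth_on_differentiable[OF sub.C_smooth y, of v w]
    have "amb.cov (\<lambda>y. amb.cov (\<lambda>y. d y w) y v) y u
        = amb.cov (\<lambda>y. d y (christoffel h y v w) + sff y v w) y u"
      by (simp add: sff_eq)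
    also have "\<dots> = d y (sub.cov (\<lambda>y. christoffel h y v w) y u) + sff y u (christoffel h y v w)
        + amb.cov (\<lambda>y. sff y v w) y u"
      using amb.cov_add[OF y smooth_on_differentiable[OF d_smooth_field[OF sub.C_smooth] y]
          smooth_on_differentiable[OF sff_smooth y]] gauss_formula[OF y dC] by simp
    finally show ?thesis
      using shape_h[OF y smooth_on_differentiable[OF sff_smooth y] nrm, of v w u z]
        tan_h[OF y, of "amb.cov (\<lambda>y. sff y v w) y u" z]
      by (simp add: g.form_simps h.form_simps sff_normal[OF y] shape_operator_eq)
        (simp add: induced_metric_def)
  qed
  then show ?thesis
    using arg_cong[OF amb.commutator[OF y d_smooth, of w v u], of "\<lambda>a. g (F y) a (d y z)"]
    by (simp add: amb_curv[OF y] g.form_simps h.form_simps sub.curv_def)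
qed

end

section \<open>A parallel normal field and the Codazzi equation\<close>

locale parallel_normal_field = immersed_domain \<Omega> g J c S F
  for \<Omega> :: "'f::euclidean_space set" and g J c and S :: "'e::euclidean_space set" and F +
  fixes W :: "'e \<Rightarrow> 'f" and K :: real
  assumes W_smooth: "smooth_on S W" and W_normal: "normal_field_on g F S W"
    and W_parallel: "y \<in> S \<Longrightarrow> normal_connection g F W y u = 0"
    and W_trace: "y \<in> S \<Longrightarrow> lin_trace (shape_operator g F W y) = K"
begin

abbreviation A :: "'e \<Rightarrow> 'e \<Rightarrow> 'e" where "A \<equiv> shape_operator g F W"
abbreviation T :: "'e \<Rightarrow> 'e" where "T y \<equiv> tJ y (W y)"
abbreviation AnV :: "'e \<Rightarrow> 'e \<Rightarrow> 'e" where "AnV \<equiv> shape_operator g F (\<lambda>y. nJ y (W y))"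

lemma A_linear: "y \<in> S \<Longrightarrow> linear (A y)"
  by (rule shape_linear[OF _ W_smooth])

lemma A_smooth: "smooth_on S (\<lambda>y. A y v)"
  unfolding shape_operator_eq
  by (rule smooth_on_minus[OF open_S tan_smooth[OF amb.smooth_cov[OF W_smooth]]])

lemma A_selfadjoint: "y \<in> S \<Longrightarrow> h y (A y u) v = h y u (A y v)"
  by (rule shape_selfadjoint[OF _ W_smooth W_normal])

lemma weingarten: "y \<in> S \<Longrightarrow> amb.cov W y u = d y (- A y u)"
  using W_parallel[of y u] by (simp add: normal_connection_def normal_part_def shape_operator_eq amb_cov)

lemma T_smooth: "smooth_on S T"
  by (rule tJ_smooth[OF W_smooth])

text \<open>Since V is parallel, the derivative of JV is -J(AX). Taking tangential parts in JV = tV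
  + nV isolates the derivative of tV, the normal summand giving the shape operator in direction
  nV.\<close>

lemma cov_T:
  assumes y: "y \<in> S" shows "sub.cov T y u = AnV y u - t_tan y (A y u)"
proof -
  have sm: "smooth_on S (\<lambda>y. nJ y (W y))" by (rule nJ_smooth[OF W_smooth])
  have "J (F y) (d y (- A y u)) = amb.cov (\<lambda>y. J (F y) (W y)) y u"
    by (simp add: amb_cov_J[OF y smooth_on_differentiable[OF W_smooth y]] weingarten[OF y])
  also have "\<dots> = amb.cov (\<lambda>y. d y (T y) + nJ y (W y)) y u"
    by (simp flip: J_split)
  also have "\<dots> = d y (sub.cov T y u) + sff y u (T y) + amb.cov (\<lambda>y. nJ y (W y)) y u"
    using amb.cov_add[OF y smooth_on_differentiable[OF d_smooth_field[OF T_smooth] y]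
        smooth_on_differentiable[OF sm y]]
      gauss_formula[OF y smooth_on_differentiable[OF T_smooth y]] by simp
  finally have "tanp y (J (F y) (d y (- A y u))) = tanp y (d y (sub.cov T y u) + sff y u (T y)
      + amb.cov (\<lambda>y. nJ y (W y)) y u)" by (rule arg_cong)
  then have "t_tan y (- A y u) = sub.cov T y u - AnV y u"
    by (simp add: linear_add[OF tan_linear[OF y]] tan_d[OF y] tan_sff[OF y] shape_operator_eq
        t_tan_def tJ_def)
  then show ?thesis by (simp add: linear_neg[OF t_tan_linear[OF y]] algebra_simps)
qed

text \<open>This is minus the tangential part of the ambient curvature applied to V, written with t
  and tV.\<close>

definition P :: "'e \<Rightarrow> 'e \<Rightarrow> 'e \<Rightarrow> 'e"
  where "P y u v = (c / 4) *\<^sub>R (h y (T y) v *\<^sub>R t_tan y u - h y (T y) u *\<^sub>R t_tan y v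
    - (2 * h y u (t_tan y v)) *\<^sub>R T y)"

text \<open>For parallel V the ambient derivative is minus the shape operator, so the commutator of
  ambient derivatives on V, projected to the tangent space, antisymmetrises the derivative of
  \<open>A\<close>.\<close>

lemma codazzi:
  assumes y: "y \<in> S" shows "sub.covend A y u v - sub.covend A y v u = P y u v"
proof -
  interpret h: inner_form "h y" by (rule induced_form[OF y])
  interpret g: inner_form "g (F y)" by (rule form_F[OF y])
  have dA: "(\<lambda>y. - A y v) differentiable (at y)" for v
    by (rule smooth_on_differentiable[OF smooth_on_minus[OF open_S A_smooth] y])
  have "amb.cov (\<lambda>y. amb.cov W y v) y u = d y (- sub.cov (\<lambda>y. A y v) y u) + sff y u (- A y v)" for u v
  proof -
    have sm: "smooth_on S (\<lambda>y. d y (- A y v))"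
      by (rule d_smooth_field[OF smooth_on_minus[OF open_S A_smooth]])
    have "amb.cov (\<lambda>y. amb.cov W y v) y = amb.cov (\<lambda>y. d y (- A y v)) y"
      by (rule amb.cov_cong[OF y _ smooth_on_differentiable[OF sm y]]) (simp add: weingarten)
    then show ?thesis
      using gauss_formula[OF y dA] sub.cov_minus[OF y smooth_on_differentiable[OF A_smooth y]] by simp
  qed
  then have "tanp y (amb.cov (\<lambda>y. amb.cov W y v) y u) = - sub.cov (\<lambda>y. A y v) y u" for u v
    by (simp only: linear_add[OF tan_linear[OF y]] tan_d[OF y] tan_sff[OF y]) simp
  then have "sub.cov (\<lambda>y. A y v) y u - sub.cov (\<lambda>y. A y u) y v = - tanp y (amb.curv y u v (W y))"
    by (simp add: linear_diff[OF tan_linear[OF y]] flip: amb.commutator[OF y W_smooth])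
  also have "\<dots> = P y u v"
  proof -
    \<comment> \<open>Normality removes the two curvature terms without J; the remaining three
      become the summands of \<open>P\<close>.\<close>
    have 0: "g (F y) (d y a) (W y) = 0" for a
      using W_normal y g.sym by (simp add: normal_field_on_def)
    have 1: "g (F y) (J (F y) (d y a)) (W y) = - h y (T y) a" for a
      using h_tJ[OF y, of "W y" a] g.sym by simp
    have 2: "g (F y) (d y a) (J (F y) (d y b)) = h y a (t_tan y b)" for a b
      unfolding h.sym[of a] t_tan_def h_tJ[OF y] using J_skew[OF y, of "d y b" "d y a"] g.sym by simp
    show ?thesis
      unfolding amb_curv[OF y] space_form[OF F_in[OF y]]
      by (simp add: 0 1 2 P_def linear_add[OF tan_linear[OF y]] linear_diff[OF tan_linear[OF y]]
          linear_scale[OF tan_linear[OF y]] linear_neg[OF tan_linear[OF y]] tan_d[OF y] algebra_simps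
          flip: tJ_def t_tan_def)
  qed
  finally show ?thesis
    using sub.christoffel_sym[OF y, of u v] by (simp add: sub.covend_def)
qed

text \<open>The covariant derivative \<open>(\<nabla>\<^sub>w P)(u, v)\<close>; see \<open>cov_P\<close>.\<close>

definition DP :: "'e \<Rightarrow> 'e \<Rightarrow> 'e \<Rightarrow> 'e \<Rightarrow> 'e"
  where "DP y w u v = (c / 4) *\<^sub>R
    (h y (sub.cov T y w) v *\<^sub>R t_tan y u + h y (T y) v *\<^sub>R sub.covend t_tan y w u
     - h y (sub.cov T y w) u *\<^sub>R t_tan y v - h y (T y) u *\<^sub>R sub.covend t_tan y w v
     - (2 * h y u (sub.covend t_tan y w v)) *\<^sub>R T y - (2 * h y u (t_tan y v)) *\<^sub>R sub.cov T y w)"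

lemma cov_P:
  assumes y: "y \<in> S"
  shows "sub.cov (\<lambda>y. P y u v) y w = DP y w u v + P y (christoffel h y w u) v + P y u (christoffel h y w v)"
proof -
  interpret h: inner_form "h y" by (rule induced_form[OF y])
  have c: "sub.cov (\<lambda>_. a) y w = christoffel h y w a" for a
    by (simp add: sub.cov_def frechet_derivative_const)
  have cov_t: "sub.cov (\<lambda>y. t_tan y a) y w = sub.covend t_tan y w a + t_tan y (christoffel h y w a)" for a
    by (simp add: sub.covend_def)
  note sT = T_smooth and st = t_tan_smooth and sc = smooth_on_const
  note dT = smooth_on_differentiable[OF T_smooth y] and dt = smooth_on_differentiable[OF t_tan_smooth y]
  have f1: "fderiv (\<lambda>y. h y (T y) a) y w = h y (sub.cov T y w) a + h y (T y) (christoffel h y w a)" for a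
    using fderiv_eqI[OF sub.cov_metric[OF y dT smooth_on_differentiable[OF sc y]]] by (simp add: c)
  have f2: "fderiv (\<lambda>y. h y u (t_tan y v)) y w = h y (christoffel h y w u) (t_tan y v)
      + h y u (sub.covend t_tan y w v + t_tan y (christoffel h y w v))"
    using fderiv_eqI[OF sub.cov_metric[OF y smooth_on_differentiable[OF sc y] dt]] by (simp add: c cov_t)
  have s1: "smooth_on S (\<lambda>y. h y (T y) a)" for a by (rule sub.smooth_form[OF sT sc])
  have s2: "smooth_on S (\<lambda>y. h y u (t_tan y v))" by (rule sub.smooth_form[OF sc st])
  have s3: "smooth_on S (\<lambda>y. h y (T y) a *\<^sub>R t_tan y b)" for a b
    by (rule smooth_on_scaleR[OF open_S s1 st])
  have s4: "smooth_on S (\<lambda>y. h y u (t_tan y v) *\<^sub>R T y)"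
    by (rule smooth_on_scaleR[OF open_S s2 sT])
  have s5: "smooth_on S (\<lambda>y. 2 *\<^sub>R (h y u (t_tan y v) *\<^sub>R T y))"
    by (rule smooth_on_linear[OF bounded_linear_scaleR_right open_S s4])
  have s6: "smooth_on S (\<lambda>y. h y (T y) v *\<^sub>R t_tan y u - h y (T y) u *\<^sub>R t_tan y v)"
    by (rule smooth_on_diff[OF open_S s3 s3])
  have s7: "smooth_on S (\<lambda>y. h y (T y) v *\<^sub>R t_tan y u - h y (T y) u *\<^sub>R t_tan y v
      - 2 *\<^sub>R (h y u (t_tan y v) *\<^sub>R T y))"
    by (rule smooth_on_diff[OF open_S s6 s5])
  have sc: "sub.cov (\<lambda>y. r *\<^sub>R X y) y w = r *\<^sub>R sub.cov X y w" if "smooth_on S X" for r X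
    using sub.cov_scaleR[OF y _ smooth_on_differentiable[OF that y], of "\<lambda>_. r" w]
    by (simp add: frechet_derivative_const)
  \<comment> \<open>The factor 2 is written as an outer scalar multiple, so that each summand is a
    smooth function times a field, up to constants.\<close>
  have P_eq: "P = (\<lambda>y u v. (c / 4) *\<^sub>R (h y (T y) v *\<^sub>R t_tan y u - h y (T y) u *\<^sub>R t_tan y v
      - 2 *\<^sub>R (h y u (t_tan y v) *\<^sub>R T y)))"
    by (simp add: P_def fun_eq_iff)
  note D = smooth_on_differentiable[OF _ y]
  have "sub.cov (\<lambda>y. P y u v) y w = (c / 4) *\<^sub>R
    ((fderiv (\<lambda>y. h y (T y) v) y w *\<^sub>R t_tan y u + h y (T y) v *\<^sub>R sub.cov (\<lambda>y. t_tan y u) y w)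
     - (fderiv (\<lambda>y. h y (T y) u) y w *\<^sub>R t_tan y v + h y (T y) u *\<^sub>R sub.cov (\<lambda>y. t_tan y v) y w)
     - 2 *\<^sub>R (fderiv (\<lambda>y. h y u (t_tan y v)) y w *\<^sub>R T y + h y u (t_tan y v) *\<^sub>R sub.cov T y w))"
    unfolding P_eq sc[OF s7] sub.cov_diff[OF y D[OF s6] D[OF s5]] sub.cov_diff[OF y D[OF s3] D[OF s3]]
      sc[OF s4] sub.cov_scaleR[OF y D[OF s1] dt] sub.cov_scaleR[OF y D[OF s2] dT] ..
  then show ?thesis
    unfolding f1 f2 cov_t DP_def P_def
    by (simp add: h.form_simps linear_add[OF t_tan_linear[OF y]] algebra_simps)
qed

text \<open>The second covariant derivative of \<open>A\<close> as a tensor, \<open>(\<nabla>\<^sup>2\<^sub>w\<^sub>u A) v\<close>.\<close>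

definition M :: "'e \<Rightarrow> 'e \<Rightarrow> 'e \<Rightarrow> 'e \<Rightarrow> 'e"
  where "M y w u v = sub.covend (\<lambda>y. sub.covend A y u) y w v - sub.covend A y (christoffel h y w u) v"

section \<open>First and second covariant derivatives of the shape operator\<close>

lemma N_linear: "y \<in> S \<Longrightarrow> linear (sub.covend A y u)"
  by (rule sub.linear_covend(1)[OF A_linear A_smooth])

lemma N_smooth: "smooth_on S (\<lambda>y. sub.covend A y u w)"
  by (rule sub.smooth_covend[OF A_linear A_smooth])

lemma N_selfadjoint: "y \<in> S \<Longrightarrow> h y (sub.covend A y u v) w = h y v (sub.covend A y u w)"
  by (rule sub.covend_selfadjoint[OF A_linear A_smooth A_selfadjoint])

lemma N_trace:
  assumes y: "y \<in> S" shows "lin_trace (sub.covend A y u) = 0"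
proof -
  have "((\<lambda>y. K) has_derivative (\<lambda>u. lin_trace (sub.covend A y u))) (at y)"
    by (rule has_derivative_transform_within_open[OF sub.covend_trace[OF A_linear A_smooth y] open_S y])
      (simp_all add: W_trace)
  from has_derivative_unique[OF this has_derivative_const] show ?thesis by meson
qed

lemma M_linear: "y \<in> S \<Longrightarrow> linear (M y w u)"
  unfolding M_def[abs_def]
  by (intro linear_compose_sub sub.linear_covend(1)[OF N_linear N_smooth] N_linear)

lemma M_selfadjoint:
  assumes y: "y \<in> S" shows "h y (M y w u v) z = h y v (M y w u z)"
proof -
  interpret h: inner_form "h y" by (rule induced_form[OF y])
  show ?thesis
    using sub.covend_selfadjoint[OF N_linear N_smooth N_selfadjoint y, of u w v z]
      N_selfadjoint[OF y] by (simp add: M_def h.form_simps)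
qed

lemma M_trace:
  assumes y: "y \<in> S" shows "lin_trace (M y w u) = 0"
proof -
  have "((\<lambda>y. 0) has_derivative (\<lambda>w. lin_trace (sub.covend (\<lambda>y. sub.covend A y u) y w))) (at y)"
    by (rule has_derivative_transform_within_open[OF sub.covend_trace[OF N_linear N_smooth y] open_S y])
      (simp_all add: N_trace)
  from has_derivative_unique[OF this has_derivative_const]
  have "lin_trace (sub.covend (\<lambda>y. sub.covend A y u) y w) = 0" by meson
  then show ?thesis by (simp add: M_def[abs_def] lin_trace_diff N_trace[OF y])
qed

text \<open>The Codazzi equation is differentiated as an identity of fields with constant
  \<open>u\<close> and \<open>v\<close>. Applying Codazzi again to the Christoffel vectors removes
  exactly the non-tensorial terms of \<open>cov_P\<close>.\<close>

lemma M_codazzi: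
  assumes y: "y \<in> S" shows "M y w u v - M y w v u = DP y w u v"
proof -
  have "sub.cov (\<lambda>y. P y u v) y = sub.cov (\<lambda>y. sub.covend A y u v - sub.covend A y v u) y"
    by (rule sub.cov_cong[OF y codazzi smooth_on_differentiable[OF smooth_on_diff[OF open_S N_smooth N_smooth] y]])
  then have "sub.cov (\<lambda>y. P y u v) y w = sub.cov (\<lambda>y. sub.covend A y u v) y w
      - sub.cov (\<lambda>y. sub.covend A y v u) y w"
    using sub.cov_diff[OF y smooth_on_differentiable[OF N_smooth y] smooth_on_differentiable[OF N_smooth y]]
    by simp
  then show ?thesis
    using cov_P[OF y, of u v w] codazzi[OF y, of "christoffel h y w u" v]
      codazzi[OF y, of u "christoffel h y w v"]
    by (simp add: M_def sub.covend_def[of "\<lambda>y. sub.covend A y _"] algebra_simps)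
qed

lemma M_ricci:
  assumes y: "y \<in> S"
  shows "M y u v w - M y v u w = sub.curv y u v (A y w) - A y (sub.curv y u v w)"
  using sub.ricci_identity[OF A_linear A_smooth y, of v u w] sub.christoffel_sym[OF y, of u v]
  by (simp add: M_def)

text \<open>Cyclicity makes the first derivative twice the trace of \<open>A\<close> composed with
  its derivative; differentiating again, the Christoffel term of the Hessian completes the iterated
  derivative to \<open>M\<close>. The function \<open>r\<close> only has to agree with the trace on
  \<open>S\<close>, since the norm itself is defined with a frame chosen pointwise.\<close>

lemma hessian:
  assumes y: "y \<in> S"
    and r: "\<And>y. y \<in> S \<Longrightarrow> r y = lin_trace (\<lambda>w. A y (A y w))"
  shows "fderiv (\<lambda>y. fderiv r y v) y u - fderiv r y (christoffel h y u v) =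
    2 * lin_trace (\<lambda>w. sub.covend A y u (sub.covend A y v w)) + 2 * lin_trace (\<lambda>w. A y (M y u v w))"
proof -
  have r': "fderiv r y v = 2 * lin_trace (\<lambda>w. A y (sub.covend A y v w))" if y: "y \<in> S" for y v
  proof -
    have "(r has_derivative (\<lambda>v. lin_trace (\<lambda>w. sub.covend A y v (A y w))
        + lin_trace (\<lambda>w. A y (sub.covend A y v w)))) (at y)"
      by (rule has_derivative_transform_within_open[OF
            sub.covend_trace_comp[OF A_linear A_smooth A_linear A_smooth y] open_S y]) (simp_all add: r)
    then show ?thesis
      using lin_trace_commute[OF N_linear[OF y] A_linear[OF y], of v] by (simp add: fderiv_eqI)
  qed
  have d: "((\<lambda>y. 2 * lin_trace (\<lambda>w. A y (sub.covend A y v w))) has_derivative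
    (\<lambda>u. 2 * (lin_trace (\<lambda>w. sub.covend A y u (sub.covend A y v w))
      + lin_trace (\<lambda>w. A y (sub.covend (\<lambda>y. sub.covend A y v) y u w))))) (at y)"
    by (intro has_derivative_mult_right sub.covend_trace_comp[OF A_linear A_smooth N_linear N_smooth y])
  have "((\<lambda>y. fderiv r y v) has_derivative
    (\<lambda>u. 2 * (lin_trace (\<lambda>w. sub.covend A y u (sub.covend A y v w))
      + lin_trace (\<lambda>w. A y (sub.covend (\<lambda>y. sub.covend A y v) y u w))))) (at y)"
    by (rule has_derivative_transform_within_open[OF d open_S y]) (simp_all add: r')
  then have "fderiv (\<lambda>y. fderiv r y v) y u = 2 * (lin_trace (\<lambda>w. sub.covend A y u (sub.covend A y v w))
      + lin_trace (\<lambda>w. A y (sub.covend (\<lambda>y. sub.covend A y v) y u w)))"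
    by (simp add: fderiv_eqI)
  then show ?thesis
    by (simp add: r'[OF y] M_def linear_diff[OF A_linear[OF y]] lin_trace_diff)
qed

end

section \<open>The algebra of the Simons formula\<close>

lemma linear_comp: "linear f \<Longrightarrow> linear k \<Longrightarrow> linear (\<lambda>x. f (k x))"
  using linear_compose[of k f] by (simp add: o_def)

text \<open>
  The tensors at one point: \<open>B\<close> and \<open>C\<close> stand for \<open>A\<^sub>n\<^sub>V\<close> and \<open>A\<^sub>n\<^sub>(\<^sub>t\<^sub>V\<^sub>)\<close>, \<open>\<kappa>\<close> for \<open>t \<sigma>\<close>, \<open>Q\<close> for \<open>\<nabla>t\<close>,
  \<open>D\<close> for \<open>\<nabla>T\<close>, \<open>\<Delta>\<close> for \<open>\<nabla>P\<close>, \<open>M\<close> for \<open>\<nabla>\<^sup>2 A\<close>, \<open>R\<close> for the curvature of the submanifold and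
  \<open>a \<alpha>\<close> for \<open>A\<^sub>\<alpha>\<close>.
\<close>

locale simons_algebra = inner_frame h I E
  for h :: "'a::euclidean_space \<Rightarrow> 'a \<Rightarrow> real" and I :: "'i set" and E +
  fixes A t B C :: "'a \<Rightarrow> 'a" and \<kappa> Q :: "'a \<Rightarrow> 'a \<Rightarrow> 'a" and T :: 'a and D :: "'a \<Rightarrow> 'a"
    and c :: real and \<Delta> M R :: "'a \<Rightarrow> 'a \<Rightarrow> 'a \<Rightarrow> 'a" and \<Lambda> :: "'k set" and a :: "'k \<Rightarrow> 'a \<Rightarrow> 'a"
  assumes A_lin: "linear A" and A_sa: "h (A u) v = h u (A v)"
    and t_lin: "linear t" and t_skew: "h (t u) v = - h u (t v)"
    and B_lin: "linear B" and B_sa: "h (B u) v = h u (B v)"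
    and C_lin: "linear C" and C_h: "h (C u) v = - h T (\<kappa> u v)"
    and \<kappa>_bil: "bilinear \<kappa>" and \<kappa>_sym: "\<kappa> u v = \<kappa> v u"
    and Q_h: "h (Q u v) w = h (\<kappa> u v) w - h v (\<kappa> u w)"
    and D_eq: "D u = B u - t (A u)"
    and \<Delta>_eq: "\<Delta> w u v = (c / 4) *\<^sub>R (h (D w) v *\<^sub>R t u + h T v *\<^sub>R Q w u - h (D w) u *\<^sub>R t v
      - h T u *\<^sub>R Q w v - (2 * h u (Q w v)) *\<^sub>R T - (2 * h u (t v)) *\<^sub>R D w)"
    and M_lin: "linear (M w u)" and M_sa: "h (M w u v) x = h v (M w u x)"
    and M_trace: "lin_trace (M w u) = 0"
    and M_codazzi: "M w u v - M w v u = \<Delta> w u v"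
    and M_ricci: "M u v w - M v u w = R u v (A w) - A (R u v w)"
    and R_h: "h (R u v w) x = c / 4 * (h v w * h u x - h u w * h v x + h (t v) w * h (t u) x
      - h (t u) w * h (t v) x + 2 * h u (t v) * h (t w) x)
      + (\<Sum>\<alpha>\<in>\<Lambda>. h (a \<alpha> v) w * h (a \<alpha> u) x - h (a \<alpha> u) w * h (a \<alpha> v) x)"
    and a_lin: "\<alpha> \<in> \<Lambda> \<Longrightarrow> linear (a \<alpha>)" and a_sa: "\<alpha> \<in> \<Lambda> \<Longrightarrow> h (a \<alpha> u) v = h u (a \<alpha> v)"
begin

lemmas lin = A_lin t_lin B_lin C_lin linear_comp[OF A_lin] linear_comp[OF t_lin]
  linear_comp[OF B_lin] linear_comp[OF C_lin]

lemma linear_words: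
  "linear (\<lambda>u. A (A u))" "linear (\<lambda>u. A (t u))" "linear (\<lambda>u. t (A u))" "linear (\<lambda>u. t (B u))"
  "linear (\<lambda>u. t (t u))" "linear (\<lambda>u. A (t (B u)))" "linear (\<lambda>u. B (A (t u)))" "linear (\<lambda>u. t (B (A u)))"
  "linear (\<lambda>u. t (A (t u)))" "linear (\<lambda>u. A (t (A (t u))))" "linear (\<lambda>u. A (t (t u)))" "linear (\<lambda>u. t (t (A u)))"
  by (intro lin)+

section \<open>Traces of words in the endomorphisms\<close>

lemma tr: "linear L \<Longrightarrow> (\<Sum>i\<in>I. h (L (E i)) (E i)) = lin_trace L"
  by (rule trace_frame)

lemma A_tr: "linear L \<Longrightarrow> (\<Sum>i\<in>I. h (L (E i)) (A (E i))) = lin_trace (\<lambda>u. A (L u))"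
  using tr[OF linear_comp[OF A_lin]] by (simp add: A_sa)

text \<open>A skew and a self-adjoint endomorphism are trace-orthogonal: adjointness and cyclicity
  give the sum with opposite signs.\<close>

lemma t_A_zero: "(\<Sum>i\<in>I. h (t (E i)) (A (E i))) = 0"
proof -
  have "(\<Sum>i\<in>I. h (t (E i)) (A (E i))) = - (\<Sum>i\<in>I. h (t (A (E i))) (E i))"
  proof -
    have "h (t x) (A x) = - h (t (A x)) x" for x
      using t_skew[of "A x" x] sym[of "t x" "A x"] by simp
    then show ?thesis by (simp add: sum_negf)
  qed
  then show ?thesis
    using A_tr[OF t_lin] tr[of "\<lambda>u. t (A u)"] lin_trace_commute[OF A_lin t_lin] linear_words A_lin t_lin B_lin C_lin by simp
qed

text \<open>Adjointness moves the factors to one side, each passage of \<open>t\<close> costing a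
  sign; cyclicity then brings the word to the normal form used in the final formula. The next two
  lemmas follow the same pattern.\<close>

lemma A_t_B: "(\<Sum>i\<in>I. h (t (E i)) (A (B (E i)))) = lin_trace (\<lambda>u. A (t (B u)))"
proof -
  have "(\<Sum>i\<in>I. h (t (E i)) (A (B (E i)))) = (\<Sum>i\<in>I. h (B (A (t (E i)))) (E i))"
    by (simp add: A_sa B_sa)
  then show ?thesis
    using tr[of "\<lambda>u. B (A (t u))"] lin_trace_commute[of B "\<lambda>u. A (t u)"] linear_words A_lin t_lin B_lin C_lin by simp
qed

lemma t_A_t_A: "(\<Sum>i\<in>I. h (t (E i)) (A (t (A (E i))))) = - lin_trace (\<lambda>u. A (t (A (t u))))"
proof -
  have "(\<Sum>i\<in>I. h (t (E i)) (A (t (A (E i))))) = - (\<Sum>i\<in>I. h (A (t (A (t (E i))))) (E i))"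
    by (simp add: A_sa t_skew sum_negf)
  then show ?thesis using tr[of "\<lambda>u. A (t (A (t u)))"] linear_words A_lin t_lin B_lin C_lin by simp
qed

lemma D_t_A: "(\<Sum>i\<in>I. h (D (t (E i))) (A (E i))) =
  - lin_trace (\<lambda>u. A (t (B u))) - lin_trace (\<lambda>u. A (t (A (t u))))"
proof -
  have "(\<Sum>i\<in>I. h (B (t (E i))) (A (E i))) = - (\<Sum>i\<in>I. h (t (B (A (E i)))) (E i))"
  proof -
    have "h (B (t x)) (A x) = - h (t (B (A x))) x" for x
      using B_sa[of "t x" "A x"] t_skew[of x "B (A x)"] sym[of x "t (B (A x))"] by simp
    then show ?thesis by (simp add: sum_negf)
  qed
  also have "\<dots> = - lin_trace (\<lambda>u. A (t (B u)))"
    using tr[of "\<lambda>u. t (B (A u))"] lin_trace_commute[of A "\<lambda>u. t (B u)"] linear_words A_lin t_lin B_lin C_lin by simp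
  finally show ?thesis
    using A_tr[of "\<lambda>u. t (A (t u))"] linear_words A_lin t_lin B_lin C_lin by (simp add: D_eq form_simps sum_subtractf)
qed

lemma D_tA: "(\<Sum>i\<in>I. h (D (E i)) (t (A (E i)))) =
  - lin_trace (\<lambda>u. A (t (B u))) - (\<Sum>i\<in>I. h (t (A (E i))) (t (A (E i))))"
proof -
  have "(\<Sum>i\<in>I. h (B (E i)) (t (A (E i)))) = - (\<Sum>i\<in>I. h (A (t (B (E i)))) (E i))"
    by (simp add: t_skew A_sa sum_negf)
  then show ?thesis
    using tr[of "\<lambda>u. A (t (B u))"] linear_words A_lin t_lin B_lin C_lin by (simp add: D_eq form_simps sum_subtractf)
qed

section \<open>Traces involving the derivative of t\<close>

lemma \<kappa>_lin: "linear (\<kappa> u)" "linear (\<lambda>u. \<kappa> u v)"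
  using \<kappa>_bil by (simp_all add: bilinear_def)

text \<open>The endomorphism \<open>\<kappa> u\<close> is not assumed self-adjoint, so
  \<open>A\<close> changes its slot by cyclicity of the trace and not by adjointness.\<close>

lemma \<kappa>_A: "(\<Sum>i\<in>I. h (A (E i)) (\<kappa> u (E i))) = (\<Sum>i\<in>I. h (\<kappa> (A (E i)) u) (E i))"
proof -
  have "(\<Sum>i\<in>I. h (A (E i)) (\<kappa> u (E i))) = (\<Sum>i\<in>I. h (\<kappa> u (E i)) (A (E i)))"
    by (simp add: sym)
  also have "\<dots> = (\<Sum>i\<in>I. h (\<kappa> u (A (E i))) (E i))"
    using A_tr[OF \<kappa>_lin(1)[of u]] tr[OF linear_comp[OF \<kappa>_lin(1)[of u] A_lin]]
      lin_trace_commute[OF A_lin \<kappa>_lin(1)[of u]] by simp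
  finally show ?thesis by (simp add: \<kappa>_sym[of u])
qed

lemma Q_A_T: "(\<Sum>i\<in>I. h (Q (E i) (A (E i))) T) =
  - lin_trace (\<lambda>u. A (C u)) - (\<Sum>i\<in>I. h (\<kappa> (A (E i)) T) (E i))"
proof -
  have "(\<Sum>i\<in>I. h (\<kappa> (E i) (A (E i))) T) = - (\<Sum>i\<in>I. h (C (E i)) (A (E i)))"
    by (simp add: C_h sum_negf sym[of T])
  moreover have "(\<Sum>i\<in>I. h (A (E i)) (\<kappa> (E i) T)) = (\<Sum>i\<in>I. h (\<kappa> (A (E i)) T) (E i))"
    using \<kappa>_A[of T] by (simp add: \<kappa>_sym[of T])
  ultimately show ?thesis using A_tr[OF C_lin] by (simp add: Q_h sum_subtractf)
qed

lemma Q_skew: "h (Q u v) w = - h v (Q u w)"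
  unfolding sym[of v "Q u w"] Q_h using sym[of w] sym[of v] by simp

text \<open>In the geometric setting \<open>\<kappa>_A_T\<close> is the trace of t \<sigma>(A(tV),
  .), and \<open>A_\<kappa>_T\<close> is m times the pairing of A(tH) with tV, because the frame sum
  of \<sigma> is mH.\<close>

definition "\<kappa>_A_T = (\<Sum>i\<in>I. h (\<kappa> (A T) (E i)) (E i))"
definition "A_\<kappa>_T = h (A (\<Sum>i\<in>I. \<kappa> (E i) (E i))) T"

lemma Q_trace: "(\<Sum>i\<in>I. h (Q (E i) (E i)) (A T)) = A_\<kappa>_T - \<kappa>_A_T"
  by (simp add: Q_h sum_subtractf \<kappa>_A_T_def A_\<kappa>_T_def A_sa sum_left sym[of "E _" "\<kappa> _ _"] \<kappa>_sym[of "A T"])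

lemma Q_div: "(\<Sum>i\<in>I. h (E i) (Q (E i) (A T))) = \<kappa>_A_T - A_\<kappa>_T"
  using Q_trace by (simp add: Q_skew sum_negf)

section \<open>Contractions of the differentiated Codazzi tensor\<close>

lemma \<Delta>_h: "h (\<Delta> w u v) x = c / 4 * (h (D w) v * h (t u) x + h T v * h (Q w u) x - h (D w) u * h (t v) x
      - h T u * h (Q w v) x - 2 * (h u (Q w v) * h T x) - 2 * (h u (t v) * h (D w) x))"
  by (simp add: \<Delta>_eq form_simps)

lemma linear_h_A: "linear (\<lambda>u. h x (A u))" and linear_h_A': "linear (\<lambda>u. h (A u) x)"
  by (rule linear_comp[OF linear_right A_lin], rule linear_comp[OF linear_left A_lin])

text \<open>This is the contribution of the first Codazzi exchange. Of the six summands of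
  \<open>\<Delta>\<close>, the third and fourth vanish because a skew endomorphism is traced against
  \<open>A\<close>; each of the last two repeats an earlier value with weight 2, whence the factors
  3.\<close>

lemma divergence_sum: "(\<Sum>i\<in>I. \<Sum>j\<in>I. h (\<Delta> (E i) (E i) (E j)) (A (E j))) =
  c / 4 * (3 * lin_trace (\<lambda>u. A (t (B u))) + 3 * lin_trace (\<lambda>u. A (t (A (t u)))) + 3 * A_\<kappa>_T - 3 * \<kappa>_A_T)"
proof -
  have 1: "(\<Sum>i\<in>I. \<Sum>j\<in>I. h (D (E i)) (E j) * h (t (E i)) (A (E j))) =
      lin_trace (\<lambda>u. A (t (B u))) + lin_trace (\<lambda>u. A (t (A (t u))))"
    unfolding contract_real[OF linear_h_A]
    using A_t_B t_A_t_A by (simp add: D_eq linear_diff[OF A_lin] form_simps sum_subtractf)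
  have 2: "(\<Sum>i\<in>I. \<Sum>j\<in>I. h T (E j) * h (Q (E i) (E i)) (A (E j))) = A_\<kappa>_T - \<kappa>_A_T"
    unfolding contract_real[OF linear_h_A] by (rule Q_trace)
  have 3: "(\<Sum>i\<in>I. \<Sum>j\<in>I. h (D (E i)) (E i) * h (t (E j)) (A (E j))) = 0"
    by (simp add: t_A_zero flip: sum_distrib_left)
  have 4: "(\<Sum>i\<in>I. \<Sum>j\<in>I. h T (E i) * h (Q (E i) (E j)) (A (E j))) = 0"
  proof -
    have "(\<Sum>i\<in>I. \<Sum>j\<in>I. h T (E i) * h (Q (E i) (E j)) (A (E j))) = (\<Sum>i\<in>I. h T (E i) *
        ((\<Sum>j\<in>I. h (\<kappa> (E i) (E j)) (A (E j))) - (\<Sum>j\<in>I. h (\<kappa> (E i) (A (E j))) (E j))))"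
      by (simp add: Q_h sum_subtractf sum_distrib_left right_diff_distrib sym[of "E _" "\<kappa> _ _"])
    moreover have "(\<Sum>j\<in>I. h (\<kappa> u (E j)) (A (E j))) = (\<Sum>j\<in>I. h (\<kappa> u (A (E j))) (E j))" for u
      using \<kappa>_A[of u] by (simp add: sym[of "A _"] \<kappa>_sym[of u])
    ultimately show ?thesis by simp
  qed
  have 5: "(\<Sum>i\<in>I. \<Sum>j\<in>I. h (E i) (Q (E i) (E j)) * h T (A (E j))) = \<kappa>_A_T - A_\<kappa>_T"
  proof -
    \<comment> \<open>Skewness shifts \<open>Q\<close> off \<open>E j\<close>, Parseval removes the
      index \<open>j\<close>, and skewness shifts \<open>Q\<close> back onto
      \<open>A T\<close>.\<close>
    have "(\<Sum>j\<in>I. h (E i) (Q (E i) (E j)) * h T (A (E j))) = h (E i) (Q (E i) (A T))" for i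
      using parseval[of "Q (E i) (E i)" "A T"] by (simp add: Q_skew[of _ _ "E _"] Q_skew sum_negf A_sa)
    then show ?thesis using Q_div by simp
  qed
  have 6: "(\<Sum>i\<in>I. \<Sum>j\<in>I. h (E i) (t (E j)) * h (D (E i)) (A (E j))) =
      - lin_trace (\<lambda>u. A (t (B u))) - lin_trace (\<lambda>u. A (t (A (t u))))"
  proof -
    have "linear (\<lambda>u. h (D u) x)" for x
      unfolding D_eq by (rule linear_comp[OF linear_left linear_compose_sub]) (intro lin)+
    then have "(\<Sum>i\<in>I. h (t (E j)) (E i) * h (D (E i)) (A (E j))) = h (D (t (E j))) (A (E j))" for j
      by (rule contract_real)
    then show ?thesis
      using D_t_A by (subst sum.swap) (simp add: sym[of "E _" "t _"])
  qed
  have "(\<Sum>i\<in>I. \<Sum>j\<in>I. h (\<Delta> (E i) (E i) (E j)) (A (E j))) = c / 4 * (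
    (\<Sum>i\<in>I. \<Sum>j\<in>I. h (D (E i)) (E j) * h (t (E i)) (A (E j)))
    + (\<Sum>i\<in>I. \<Sum>j\<in>I. h T (E j) * h (Q (E i) (E i)) (A (E j)))
    - (\<Sum>i\<in>I. \<Sum>j\<in>I. h (D (E i)) (E i) * h (t (E j)) (A (E j)))
    - (\<Sum>i\<in>I. \<Sum>j\<in>I. h T (E i) * h (Q (E i) (E j)) (A (E j)))
    - 2 * (\<Sum>i\<in>I. \<Sum>j\<in>I. h (E i) (Q (E i) (E j)) * h T (A (E j)))
    - 2 * (\<Sum>i\<in>I. \<Sum>j\<in>I. h (E i) (t (E j)) * h (D (E i)) (A (E j))))"
    unfolding \<Delta>_h by (simp only: sum_distrib_left[symmetric] sum.distrib sum_subtractf)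
  then show ?thesis unfolding 1 2 3 4 5 6 by (simp add: algebra_simps)
qed

text \<open>This is the contribution of the second Codazzi exchange, where two frame slots of the
  differentiated tensor coincide.\<close>

lemma trace_sum: "(\<Sum>j\<in>I. \<Sum>i\<in>I. h (\<Delta> (E j) (E i) (A (E j))) (E i)) =
  c / 4 * (3 * lin_trace (\<lambda>u. A (t (B u))) + 3 * (\<Sum>i\<in>I. h (t (A (E i))) (t (A (E i))))
    + 3 * lin_trace (\<lambda>u. A (C u)) + 3 * (\<Sum>i\<in>I. h (\<kappa> (A (E i)) T) (E i)))"
proof -
  \<comment> \<open>Skewness kills the first two summands of \<open>\<Delta>\<close>; the remaining
    four pair off with weights 1 and 2.\<close>
  have z: "h (t u) u = 0" "h (Q w u) u = 0" for u w
    using t_skew[of u u] Q_skew[of w u u] sym[of u] by simp_all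
  have "(\<Sum>i\<in>I. h (\<Delta> (E j) (E i) (A (E j))) (E i)) =
      c / 4 * (- 3 * h (D (E j)) (t (A (E j))) - 3 * h (Q (E j) (A (E j))) T)" for j
  proof -
    let ?q = "Q (E j) (A (E j))" and ?s = "t (A (E j))" and ?d = "D (E j)"
    have "(\<Sum>i\<in>I. h (\<Delta> (E j) (E i) (A (E j))) (E i)) = (\<Sum>i\<in>I. c / 4 * (
        - 3 * (h ?d (E i) * h ?s (E i)) - 3 * (h ?q (E i) * h T (E i))))"
      by (rule sum.cong) (simp_all add: \<Delta>_h z sym[of "E _" "Q _ _"] sym[of "E _" "t _"])
    also have "\<dots> = c / 4 * (- 3 * (\<Sum>i\<in>I. h ?d (E i) * h ?s (E i)) - 3 * (\<Sum>i\<in>I. h ?q (E i) * h T (E i)))"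
      by (simp only: sum_distrib_left[symmetric] sum_subtractf)
    finally show ?thesis by (simp only: parseval)
  qed
  then have "(\<Sum>j\<in>I. \<Sum>i\<in>I. h (\<Delta> (E j) (E i) (A (E j))) (E i)) = c / 4 *
    (- 3 * (\<Sum>j\<in>I. h (D (E j)) (t (A (E j)))) - 3 * (\<Sum>j\<in>I. h (Q (E j) (A (E j))) T))"
    by (simp only: sum_distrib_left[symmetric] sum_subtractf)
  then show ?thesis unfolding D_tA Q_A_T by (simp add: algebra_simps)
qed

lemma A_A_t_t: "(\<Sum>j\<in>I. h (t (t (E j))) (A (A (E j)))) = - (\<Sum>i\<in>I. h (t (A (E i))) (t (A (E i))))"
proof -
  have "(\<Sum>j\<in>I. h (t (t (E j))) (A (A (E j)))) = lin_trace (\<lambda>u. A (A (t (t u))))"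
    using A_tr[of "\<lambda>u. A (t (t u))"] linear_words A_lin t_lin B_lin C_lin by (simp add: A_sa)
  moreover have "(\<Sum>i\<in>I. h (t (A (E i))) (t (A (E i)))) = - (\<Sum>i\<in>I. h (t (t (A (E i)))) (A (E i)))"
    by (simp add: t_skew sum_negf)
  moreover have "(\<Sum>i\<in>I. h (t (t (A (E i)))) (A (E i))) = lin_trace (\<lambda>u. A (t (t (A u))))"
    using A_tr[of "\<lambda>u. t (t (A u))"] linear_words A_lin t_lin B_lin C_lin by simp
  moreover have "lin_trace (\<lambda>u. A (A (t (t u)))) = lin_trace (\<lambda>u. A (t (t (A u))))"
    using lin_trace_commute[of A "\<lambda>u. A (t (t u))"] linear_words A_lin t_lin B_lin C_lin by simp
  ultimately show ?thesis by simp
qed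

section \<open>Contractions of the curvature terms\<close>

lemma h_EE: "i \<in> I \<Longrightarrow> h (E i) (E i) = 1"
  by (simp add: orth)

lemma sum_swap_last: "(\<Sum>i\<in>I. \<Sum>j\<in>I. \<Sum>\<alpha>\<in>\<Lambda>. f i j \<alpha>) = (\<Sum>\<alpha>\<in>\<Lambda>. \<Sum>i\<in>I. \<Sum>j\<in>I. f i j \<alpha>)"
proof -
  have "(\<Sum>j\<in>I. \<Sum>\<alpha>\<in>\<Lambda>. f i j \<alpha>) = (\<Sum>\<alpha>\<in>\<Lambda>. \<Sum>j\<in>I. f i j \<alpha>)" for i
    by (rule sum.swap)
  then show ?thesis by (simp only:) (rule sum.swap)
qed

text \<open>The third and fifth curvature terms yield the same trace with weights 1 and 2, the
  fourth vanishes by \<open>t_A_zero\<close>, and the products that separate in the two indices give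
  squared traces.\<close>

lemma curvature_sum_1: "(\<Sum>i\<in>I. \<Sum>j\<in>I. h (R (E i) (E j) (A (E i))) (A (E j))) =
  c / 4 * (lin_trace (\<lambda>u. A (A u)) - (lin_trace A)\<^sup>2 + 3 * lin_trace (\<lambda>u. A (t (A (t u)))))
  + (\<Sum>\<alpha>\<in>\<Lambda>. lin_trace (\<lambda>u. A (a \<alpha> (A (a \<alpha> u)))) - (lin_trace (\<lambda>u. A (a \<alpha> u)))\<^sup>2)"
proof -
  have 1: "(\<Sum>i\<in>I. \<Sum>j\<in>I. h (E j) (A (E i)) * h (E i) (A (E j))) = lin_trace (\<lambda>u. A (A u))"
  proof -
    have "(\<Sum>j\<in>I. h (E j) (A (E i)) * h (E i) (A (E j))) = h (A (A (E i))) (E i)" for i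
    proof -
      have "h (E j) (A (E i)) * h (E i) (A (E j)) = h (A (E i)) (E j) * h (A (E i)) (E j)" for j
        using sym[of "E j" "A (E i)"] A_sa[of "E i" "E j"] by simp
      then show ?thesis using A_sa[of "A (E i)" "E i"] by (simp only: parseval)
    qed
    then show ?thesis using tr[of "\<lambda>u. A (A u)"] linear_words A_lin t_lin B_lin C_lin by simp
  qed
  have 2: "(\<Sum>i\<in>I. \<Sum>j\<in>I. h (E i) (A (E i)) * h (E j) (A (E j))) = (lin_trace A)\<^sup>2"
    using tr[OF A_lin] by (simp add: power2_eq_square A_sa flip: sum_product)
  have 3: "(\<Sum>i\<in>I. \<Sum>j\<in>I. h (t (E j)) (A (E i)) * h (t (E i)) (A (E j))) = lin_trace (\<lambda>u. A (t (A (t u))))"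
  proof -
    have "(\<Sum>j\<in>I. h (t (E j)) (A (E i)) * h (t (E i)) (A (E j))) = - h (t (A (E i))) (A (t (E i)))" for i
    proof -
      have "h (t (E j)) (A (E i)) * h (t (E i)) (A (E j)) = - (h (t (A (E i))) (E j) * h (A (t (E i))) (E j))" for j
        using t_skew[of "E j" "A (E i)"] sym[of "E j" "t (A (E i))"] A_sa[of "t (E i)" "E j"] by simp
      then show ?thesis by (simp only: sum_negf parseval)
    qed
    moreover have "h (t (A x)) (A (t x)) = - h (A (t (A (t x)))) x" for x
      using t_skew[of "A x" "A (t x)"] A_sa[of x "t (A (t x))"] sym[of x] by simp
    ultimately show ?thesis using tr[of "\<lambda>u. A (t (A (t u)))"] linear_words A_lin t_lin B_lin C_lin by simp
  qed
  have 4: "(\<Sum>i\<in>I. \<Sum>j\<in>I. h (t (E i)) (A (E i)) * h (t (E j)) (A (E j))) = 0"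
    by (simp add: t_A_zero flip: sum_distrib_left)
  have 5: "(\<Sum>i\<in>I. \<Sum>j\<in>I. h (E i) (t (E j)) * h (t (A (E i))) (A (E j))) = lin_trace (\<lambda>u. A (t (A (t u))))"
  proof -
    have "linear (\<lambda>u. h (t (A u)) x)" for x
      by (rule linear_comp[OF linear_left]) (intro lin)
    then have "(\<Sum>i\<in>I. h (t (E j)) (E i) * h (t (A (E i))) (A (E j))) = h (t (A (t (E j)))) (A (E j))" for j
      by (rule contract_real)
    then show ?thesis
      using A_tr[of "\<lambda>u. t (A (t u))"] linear_words by (subst sum.swap) (simp add: sym[of "E _" "t _"])
  qed
  have 6: "(\<Sum>i\<in>I. \<Sum>j\<in>I. h (a \<alpha> (E j)) (A (E i)) * h (a \<alpha> (E i)) (A (E j))) =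
      lin_trace (\<lambda>u. A (a \<alpha> (A (a \<alpha> u))))" if \<alpha>: "\<alpha> \<in> \<Lambda>" for \<alpha>
  proof -
    note l = a_lin[OF \<alpha>] linear_comp[OF a_lin[OF \<alpha>]]
    have "(\<Sum>j\<in>I. h (a \<alpha> (E j)) (A (E i)) * h (a \<alpha> (E i)) (A (E j))) = h (a \<alpha> (A (a \<alpha> (A (E i))))) (E i)" for i
    proof -
      have "h (a \<alpha> (E j)) (A (E i)) * h (a \<alpha> (E i)) (A (E j)) =
          h (a \<alpha> (A (E i))) (E j) * h (A (a \<alpha> (E i))) (E j)" for j
        using a_sa[OF \<alpha>, of "E j" "A (E i)"] sym[of "E j" "a \<alpha> (A (E i))"] A_sa[of "a \<alpha> (E i)" "E j"] by simp
      then show ?thesis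
        using A_sa[of "a \<alpha> (A (E i))" "a \<alpha> (E i)"] a_sa[OF \<alpha>, of "A (a \<alpha> (A (E i)))" "E i"]
        by (simp only: parseval)
    qed
    moreover have "linear (\<lambda>u. a \<alpha> (A (a \<alpha> (A u))))" "linear (\<lambda>u. a \<alpha> (A (a \<alpha> u)))"
      by (intro l lin)+
    ultimately show ?thesis
      using tr[of "\<lambda>u. a \<alpha> (A (a \<alpha> (A u)))"] lin_trace_commute[of A "\<lambda>u. a \<alpha> (A (a \<alpha> u))"] lin l by simp
  qed
  have 7: "(\<Sum>i\<in>I. \<Sum>j\<in>I. h (a \<alpha> (E i)) (A (E i)) * h (a \<alpha> (E j)) (A (E j))) =
      (lin_trace (\<lambda>u. A (a \<alpha> u)))\<^sup>2" if \<alpha>: "\<alpha> \<in> \<Lambda>" for \<alpha>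
    using A_tr[OF a_lin[OF \<alpha>]] by (simp add: power2_eq_square flip: sum_product)
  have "(\<Sum>i\<in>I. \<Sum>j\<in>I. h (R (E i) (E j) (A (E i))) (A (E j))) = c / 4 * (
    (\<Sum>i\<in>I. \<Sum>j\<in>I. h (E j) (A (E i)) * h (E i) (A (E j)))
    - (\<Sum>i\<in>I. \<Sum>j\<in>I. h (E i) (A (E i)) * h (E j) (A (E j)))
    + (\<Sum>i\<in>I. \<Sum>j\<in>I. h (t (E j)) (A (E i)) * h (t (E i)) (A (E j)))
    - (\<Sum>i\<in>I. \<Sum>j\<in>I. h (t (E i)) (A (E i)) * h (t (E j)) (A (E j)))
    + 2 * (\<Sum>i\<in>I. \<Sum>j\<in>I. h (E i) (t (E j)) * h (t (A (E i))) (A (E j))))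
    + (\<Sum>i\<in>I. \<Sum>j\<in>I. \<Sum>\<alpha>\<in>\<Lambda>. h (a \<alpha> (E j)) (A (E i)) * h (a \<alpha> (E i)) (A (E j))
        - h (a \<alpha> (E i)) (A (E i)) * h (a \<alpha> (E j)) (A (E j)))"
    unfolding R_h by (simp only: sum_distrib_left[symmetric] sum.distrib sum_subtractf mult.assoc)
  moreover have "(\<Sum>i\<in>I. \<Sum>j\<in>I. \<Sum>\<alpha>\<in>\<Lambda>. h (a \<alpha> (E j)) (A (E i)) * h (a \<alpha> (E i)) (A (E j))
        - h (a \<alpha> (E i)) (A (E i)) * h (a \<alpha> (E j)) (A (E j))) =
    (\<Sum>\<alpha>\<in>\<Lambda>. lin_trace (\<lambda>u. A (a \<alpha> (A (a \<alpha> u)))) - (lin_trace (\<lambda>u. A (a \<alpha> u)))\<^sup>2)"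
    unfolding sum_swap_last
    by (rule sum.cong) (simp_all only: sum_subtractf 6 7)
  ultimately show ?thesis unfolding 1 2 3 4 5 by (simp add: algebra_simps)
qed

text \<open>Here two frame indices meet inside the curvature: the factor
  \<open>h (E i) (E i) = 1\<close> counts the frame and produces the coefficient m, and the trace of
  \<open>a \<alpha>\<close> appears by itself.\<close>

lemma curvature_sum_2: "(\<Sum>i\<in>I. \<Sum>j\<in>I. h (R (E i) (E j) (E i)) (A (A (E j)))) =
  c / 4 * (lin_trace (\<lambda>u. A (A u)) - real (card I) * lin_trace (\<lambda>u. A (A u))
    - 3 * (\<Sum>i\<in>I. h (t (A (E i))) (t (A (E i)))))
  + (\<Sum>\<alpha>\<in>\<Lambda>. lin_trace (\<lambda>u. A (A (a \<alpha> (a \<alpha> u)))) - lin_trace (a \<alpha>) * lin_trace (\<lambda>u. A (A (a \<alpha> u))))"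
proof -
  have AA: "(\<Sum>j\<in>I. h (L (E j)) (A (A (E j)))) = lin_trace (\<lambda>u. A (A (L u)))" if "linear L" for L
    using A_tr[OF linear_comp[OF A_lin that]] by (simp add: A_sa)
  have AA1: "(\<Sum>j\<in>I. h (E j) (A (A (E j)))) = lin_trace (\<lambda>u. A (A u))"
    using AA[OF linear_id] by simp
  have 1: "(\<Sum>i\<in>I. \<Sum>j\<in>I. h (E j) (E i) * h (E i) (A (A (E j)))) = lin_trace (\<lambda>u. A (A u))"
    by (subst sum.swap) (simp add: contract_real[OF linear_left] AA1)
  have 2: "(\<Sum>i\<in>I. \<Sum>j\<in>I. h (E i) (E i) * h (E j) (A (A (E j)))) = real (card I) * lin_trace (\<lambda>u. A (A u))"
    by (simp add: h_EE AA1)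
  have 3: "(\<Sum>i\<in>I. \<Sum>j\<in>I. h (t (E j)) (E i) * h (t (E i)) (A (A (E j)))) =
      - (\<Sum>i\<in>I. h (t (A (E i))) (t (A (E i))))"
    by (subst sum.swap) (simp add: contract_real[OF linear_comp[OF linear_left t_lin]] A_A_t_t)
  have 4: "(\<Sum>i\<in>I. \<Sum>j\<in>I. h (t (E i)) (E i) * h (t (E j)) (A (A (E j)))) = 0"
  proof -
    have "h (t u) u = 0" for u using t_skew[of u u] sym[of u] by simp
    then show ?thesis by simp
  qed
  have 5: "(\<Sum>i\<in>I. \<Sum>j\<in>I. h (E i) (t (E j)) * h (t (E i)) (A (A (E j)))) =
      - (\<Sum>i\<in>I. h (t (A (E i))) (t (A (E i))))"
    using 3 by (simp add: sym[of "E _" "t _"])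
  have 6: "(\<Sum>i\<in>I. \<Sum>j\<in>I. h (a \<alpha> (E j)) (E i) * h (a \<alpha> (E i)) (A (A (E j)))) =
      lin_trace (\<lambda>u. A (A (a \<alpha> (a \<alpha> u))))" if \<alpha>: "\<alpha> \<in> \<Lambda>" for \<alpha>
    using AA[OF linear_comp[OF a_lin[OF \<alpha>] a_lin[OF \<alpha>]]]
    by (subst sum.swap) (simp add: contract_real[OF linear_comp[OF linear_left a_lin[OF \<alpha>]]])
  have 7: "(\<Sum>i\<in>I. \<Sum>j\<in>I. h (a \<alpha> (E i)) (E i) * h (a \<alpha> (E j)) (A (A (E j)))) =
      lin_trace (a \<alpha>) * lin_trace (\<lambda>u. A (A (a \<alpha> u)))" if \<alpha>: "\<alpha> \<in> \<Lambda>" for \<alpha>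
    using AA[OF a_lin[OF \<alpha>]] tr[OF a_lin[OF \<alpha>]] by (simp add: sum_product[symmetric])
  have "(\<Sum>i\<in>I. \<Sum>j\<in>I. h (R (E i) (E j) (E i)) (A (A (E j)))) = c / 4 * (
    (\<Sum>i\<in>I. \<Sum>j\<in>I. h (E j) (E i) * h (E i) (A (A (E j))))
    - (\<Sum>i\<in>I. \<Sum>j\<in>I. h (E i) (E i) * h (E j) (A (A (E j))))
    + (\<Sum>i\<in>I. \<Sum>j\<in>I. h (t (E j)) (E i) * h (t (E i)) (A (A (E j))))
    - (\<Sum>i\<in>I. \<Sum>j\<in>I. h (t (E i)) (E i) * h (t (E j)) (A (A (E j))))
    + 2 * (\<Sum>i\<in>I. \<Sum>j\<in>I. h (E i) (t (E j)) * h (t (E i)) (A (A (E j)))))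
    + (\<Sum>i\<in>I. \<Sum>j\<in>I. \<Sum>\<alpha>\<in>\<Lambda>. h (a \<alpha> (E j)) (E i) * h (a \<alpha> (E i)) (A (A (E j)))
        - h (a \<alpha> (E i)) (E i) * h (a \<alpha> (E j)) (A (A (E j))))"
    unfolding R_h by (simp only: sum_distrib_left[symmetric] sum.distrib sum_subtractf mult.assoc)
  moreover have "(\<Sum>i\<in>I. \<Sum>j\<in>I. \<Sum>\<alpha>\<in>\<Lambda>. h (a \<alpha> (E j)) (E i) * h (a \<alpha> (E i)) (A (A (E j)))
        - h (a \<alpha> (E i)) (E i) * h (a \<alpha> (E j)) (A (A (E j)))) =
    (\<Sum>\<alpha>\<in>\<Lambda>. lin_trace (\<lambda>u. A (A (a \<alpha> (a \<alpha> u)))) - lin_trace (a \<alpha>) * lin_trace (\<lambda>u. A (A (a \<alpha> u))))"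
    unfolding sum_swap_last
    by (rule sum.cong) (simp_all only: sum_subtractf 6 7)
  ultimately show ?thesis unfolding 1 2 3 4 5 by (simp add: algebra_simps)
qed

text \<open>The two curvature sums contain the same multiple of the trace of A^2, which cancels in
  their difference. The trace with nV collects 3 + 3 from the two Codazzi exchanges, the trace of
  AtAt from the first exchange and a curvature sum, and the norm of tA from the second exchange and
  the other curvature sum.\<close>

lemma simons_identity: "(\<Sum>i\<in>I. lin_trace (\<lambda>w. A (M (E i) (E i) w))) =
  c / 4 * (real (card I) * lin_trace (\<lambda>u. A (A u)) + 6 * (\<Sum>i\<in>I. h (t (A (E i))) (t (A (E i))))
    + 6 * lin_trace (\<lambda>u. A (t (B u))) + 3 * lin_trace (\<lambda>u. A (C u)) - (lin_trace A)\<^sup>2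
    + 6 * lin_trace (\<lambda>u. A (t (A (t u)))) + 3 * (\<Sum>i\<in>I. h (\<kappa> (A (E i)) T) (E i))
    - 3 * (\<Sum>i\<in>I. h (\<kappa> (A T) (E i)) (E i)) + 3 * h (A (\<Sum>i\<in>I. \<kappa> (E i) (E i))) T)
  + (\<Sum>\<alpha>\<in>\<Lambda>. lin_trace (\<lambda>u. A (a \<alpha> (A (a \<alpha> u)))) - lin_trace (\<lambda>u. A (A (a \<alpha> (a \<alpha> u))))
      + lin_trace (a \<alpha>) * lin_trace (\<lambda>u. A (A (a \<alpha> u))) - (lin_trace (\<lambda>u. A (a \<alpha> u)))\<^sup>2)"
proof -
  \<comment> \<open>Self-adjointness puts a frame vector outside, and Codazzi then puts the other
    one into the endomorphism slot; the resulting trace of \<open>M w x\<close> is zero, leaving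
    only \<open>\<Delta>\<close>.\<close>
  have M0: "(\<Sum>i\<in>I. h (M w (E i) (E i)) x) = (\<Sum>i\<in>I. h (\<Delta> w (E i) x) (E i))" for w x
  proof -
    have "h (M w (E i) (E i)) x = h (M w x (E i)) (E i) + h (\<Delta> w (E i) x) (E i)" for i
      using sym[of "E i" "M w (E i) x"] by (simp add: M_sa form_simps flip: M_codazzi)
    then show ?thesis using tr[OF M_lin[of w x]] by (simp add: sum.distrib M_trace)
  qed
  have "(\<Sum>i\<in>I. lin_trace (\<lambda>w. A (M (E i) (E i) w))) = (\<Sum>i\<in>I. \<Sum>j\<in>I. h (M (E i) (E i) (E j)) (A (E j)))"
    by (simp add: A_tr[OF M_lin])
  also have "\<dots> = (\<Sum>i\<in>I. \<Sum>j\<in>I. h (\<Delta> (E i) (E i) (E j)) (A (E j)) + h (M (E j) (E i) (E i)) (A (E j))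
      + h (R (E i) (E j) (A (E i))) (A (E j)) - h (R (E i) (E j) (E i)) (A (A (E j))))"
  proof (intro sum.cong refl)
    fix i j
    \<comment> \<open>Codazzi exchanges the last two slots, the Ricci identity the first
      two.\<close>
    have "M (E i) (E i) (E j) = \<Delta> (E i) (E i) (E j) + M (E j) (E i) (E i)
        + R (E i) (E j) (A (E i)) - A (R (E i) (E j) (E i))"
      using M_ricci[of "E i" "E j" "E i"] by (simp add: algebra_simps flip: M_codazzi)
    then show "h (M (E i) (E i) (E j)) (A (E j)) = h (\<Delta> (E i) (E i) (E j)) (A (E j))
      + h (M (E j) (E i) (E i)) (A (E j)) + h (R (E i) (E j) (A (E i))) (A (E j))
      - h (R (E i) (E j) (E i)) (A (A (E j)))"
      by (simp add: form_simps A_sa)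
  qed
  also have "\<dots> = (\<Sum>i\<in>I. \<Sum>j\<in>I. h (\<Delta> (E i) (E i) (E j)) (A (E j)))
      + (\<Sum>j\<in>I. \<Sum>i\<in>I. h (M (E j) (E i) (E i)) (A (E j)))
      + (\<Sum>i\<in>I. \<Sum>j\<in>I. h (R (E i) (E j) (A (E i))) (A (E j)))
      - (\<Sum>i\<in>I. \<Sum>j\<in>I. h (R (E i) (E j) (E i)) (A (A (E j))))"
    by (subst (3) sum.swap) (simp only: sum.distrib sum_subtractf)
  finally show ?thesis
    unfolding M0 divergence_sum trace_sum curvature_sum_1 curvature_sum_2 \<kappa>_A_T_def A_\<kappa>_T_def
    by (simp add: sum.distrib sum_subtractf algebra_simps)
qed

end

section \<open>The Simons formula\<close>

context immersed_domain
begin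

section \<open>The Gauss equation in an adapted frame\<close>

text \<open>Parseval is applied in the ambient space to a frame that extends a tangent one by the
  normal fields; the tangent coefficients vanish, and the normal ones are entries of shape
  operators.\<close>

lemma sff_frame:
  assumes x: "x \<in> S" and E: "normal_frame_on g F S E" and dim: "DIM('e) \<le> DIM('f)"
  shows "g (F x) (sff x u v) (sff x w z) = (\<Sum>\<alpha> = DIM('e)+1..DIM('f).
    h x (shape_operator g F (E \<alpha>) x u) v * h x (shape_operator g F (E \<alpha>) x w) z)"
proof -
  interpret h: inner_form "h x" by (rule induced_form[OF x])
  interpret fr: inner_frame "h x" "{..<DIM('e)}" h.fr by (rule h.fr)
  interpret g: inner_form "g (F x)" by (rule form_F[OF x])
  let ?\<Lambda> = "{DIM('e)+1..DIM('f)}"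
  have nrm: "g (F x) (E \<alpha> x) (d x b) = 0" "g (F x) (d x b) (E \<alpha> x) = 0" if "\<alpha> \<in> ?\<Lambda>" for \<alpha> b
    using E x that g.sym by (auto simp: normal_frame_on_def normal_field_on_def)
  \<comment> \<open>Tangent indices run from 0 to m - 1 and normal ones from m + 1 to 2n. The index
    m is skipped, and the index set still has m + (2n - m) = 2n elements.\<close>
  define e where "e k = (if k < DIM('e) then d x (h.fr k) else E k x)" for k
  interpret e: inner_frame "g (F x)" "{..<DIM('e)} \<union> ?\<Lambda>" e
  proof
    have "card ({..<DIM('e)} \<union> ?\<Lambda>) = card {..<DIM('e)} + card ?\<Lambda>"
      by (rule card_Un_disjoint) auto
    then show "card ({..<DIM('e)} \<union> ?\<Lambda>) = DIM('f)" using dim by simp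
    fix i j assume "i \<in> {..<DIM('e)} \<union> ?\<Lambda>" "j \<in> {..<DIM('e)} \<union> ?\<Lambda>"
    then show "g (F x) (e i) (e j) = (if i = j then 1 else 0)"
      using E x nrm fr.orth[of i j]
      by (auto simp: e_def normal_frame_on_def induced_metric_def)
  qed simp
  have "g (F x) (sff x u v) (sff x w z) =
      (\<Sum>k\<in>{..<DIM('e)} \<union> ?\<Lambda>. g (F x) (sff x u v) (e k) * g (F x) (sff x w z) (e k))"
    by (rule e.parseval[symmetric])
  also have "\<dots> = (\<Sum>k\<in>{..<DIM('e)}. g (F x) (sff x u v) (e k) * g (F x) (sff x w z) (e k))
      + (\<Sum>k\<in>?\<Lambda>. g (F x) (sff x u v) (e k) * g (F x) (sff x w z) (e k))"
    by (rule sum.union_disjoint) auto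
  also have "\<dots> = (\<Sum>\<alpha>\<in>?\<Lambda>. g (F x) (sff x u v) (E \<alpha> x) * g (F x) (sff x w z) (E \<alpha> x))"
    by (simp add: e_def sff_normal[OF x])
  also have "\<dots> = (\<Sum>\<alpha>\<in>?\<Lambda>.
    h x (shape_operator g F (E \<alpha>) x u) v * h x (shape_operator g F (E \<alpha>) x w) z)"
  proof (rule sum.cong)
    fix \<alpha> assume "\<alpha> \<in> ?\<Lambda>"
    then have "smooth_on S (E \<alpha>)" "normal_field_on g F S (E \<alpha>)"
      using E by (simp_all add: normal_frame_on_def)
    note sh = shape_h[OF x smooth_on_differentiable[OF this(1) x] this(2)]
    show "g (F x) (sff x u v) (E \<alpha> x) * g (F x) (sff x w z) (E \<alpha> x) =
      h x (shape_operator g F (E \<alpha>) x u) v * h x (shape_operator g F (E \<alpha>) x w) z"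
      unfolding sh by (simp add: g.sym)
  qed simp
  finally show ?thesis .
qed

lemma gauss_equation_frame:
  assumes x: "x \<in> S" and E: "normal_frame_on g F S E" and dim: "DIM('e) \<le> DIM('f)"
  shows "h x (sub.curv x u v w) z = c / 4 * (h x v w * h x u z - h x u w * h x v z
      + h x (t_tan x v) w * h x (t_tan x u) z - h x (t_tan x u) w * h x (t_tan x v) z
      + 2 * h x u (t_tan x v) * h x (t_tan x w) z)
    + (\<Sum>\<alpha> = DIM('e)+1..DIM('f).
        h x (shape_operator g F (E \<alpha>) x v) w * h x (shape_operator g F (E \<alpha>) x u) z
        - h x (shape_operator g F (E \<alpha>) x u) w * h x (shape_operator g F (E \<alpha>) x v) z)"
proof -
  interpret h: inner_form "h x" by (rule induced_form[OF x])
  interpret g: inner_form "g (F x)" by (rule form_F[OF x])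
  have 1: "g (F x) (J (F x) (d x a)) (d x b) = h x (t_tan x a) b" for a b
    by (simp add: t_tan_def tJ_def tan_h[OF x])
  have 2: "g (F x) (d x a) (J (F x) (d x b)) = h x a (t_tan x b)" for a b
    using 1[of b a] by (simp add: g.sym[of "d x a"] h.sym[of a])
  have 3: "g (F x) (d x a) (d x b) = h x a b" for a b
    by (simp add: induced_metric_def)
  show ?thesis
    unfolding gauss_equation[OF x] space_form[OF F_in[OF x]] sff_frame[OF x E dim]
    by (simp add: g.form_simps 1 2 3 sum_subtractf)
qed

end

context parallel_normal_field
begin

text \<open>The geometric tensors at \<open>x\<close> satisfy the axioms of
  \<open>simons_algebra\<close>; beyond that, only the metric traces and norms of the statement have
  to be turned into coordinate traces or sums over \<open>h.fr\<close>.\<close>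

theorem simons_formula_in_chart:
  assumes x: "x \<in> S" and E: "normal_frame_on g F S E" and dim: "DIM('e) \<le> DIM('f)"
  shows "
      let \<tau> = (\<lambda>y w. tangential g F y (J (F y) w));
          \<eta> = (\<lambda>y w. normal_part g F y (J (F y) w));
          i = fderiv F x;
          \<sigma> = second_fundamental_form g F x;
          H = mean_curvature g F x;
          A = shape_operator g F W x;
          tV = \<tau> x (W x);
          A\<^sub>n\<^sub>V = shape_operator g F (\<lambda>y. \<eta> y (W y)) x;
          A\<^sub>n\<^sub>t\<^sub>V = shape_operator g F (\<lambda>y. \<eta> y (fderiv F y (\<tau> y (W y)))) x;
          A\<^sub>E = (\<lambda>\<alpha>. shape_operator g F (E \<alpha>) x);
          tr = end_trace (h x)
      in 1 / 2 * laplacian h (\<lambda>y. end_norm_sq (h y) (shape_operator g F W y)) x =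
           nabla_end_norm_sq h (shape_operator g F W) x
           + c / 4 * (real DIM('e) * end_norm_sq (h x) A
               + 6 * end_norm_sq (h x) (\<lambda>u. \<tau> x (i (A u)))
               + 6 * tr (\<lambda>u. A (\<tau> x (i (A\<^sub>n\<^sub>V u))))
               + 3 * tr (\<lambda>u. A (A\<^sub>n\<^sub>t\<^sub>V u))
               - (tr A)\<^sup>2
               + 6 * tr (\<lambda>u. A (\<tau> x (i (A (\<tau> x (i u))))))
               + 3 * form_trace (h x) (\<lambda>u v. h x (\<tau> x (\<sigma> (A u) tV)) v)
               - 3 * form_trace (h x) (\<lambda>u v. h x (\<tau> x (\<sigma> (A tV) u)) v)
               + 3 * real DIM('e) * h x (A (\<tau> x H)) tV)
           + (\<Sum>\<alpha> = DIM('e)+1..DIM('f).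
               tr (\<lambda>u. A (A\<^sub>E \<alpha> (A (A\<^sub>E \<alpha> u))) - A (A (A\<^sub>E \<alpha> (A\<^sub>E \<alpha> u))))
               + tr (A\<^sub>E \<alpha>) * tr (\<lambda>u. A (A (A\<^sub>E \<alpha> u)))
               - (tr (\<lambda>u. A (A\<^sub>E \<alpha> u)))\<^sup>2)"
proof -
  interpret h: inner_form "h x" by (rule induced_form[OF x])
  let ?I = "{..<DIM('e)}" and ?\<Lambda> = "{DIM('e)+1..DIM('f)}"
  let ?a = "\<lambda>\<alpha>. shape_operator g F (E \<alpha>) x"
  let ?C = "shape_operator g F (\<lambda>y. nJ y (d y (T y))) x"
  have E': "smooth_on S (E \<alpha>)" "normal_field_on g F S (E \<alpha>)" if "\<alpha> \<in> ?\<Lambda>" for \<alpha>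
    using E that by (simp_all add: normal_frame_on_def)
  interpret alg: simons_algebra "h x" ?I h.fr "A x" "t_tan x" "AnV x" ?C "t_sff x" "sub.covend t_tan x" "T x"
    "sub.cov T x" c "DP x" "M x" "sub.curv x" ?\<Lambda> ?a
  proof (intro simons_algebra.intro simons_algebra_axioms.intro)
    show "inner_frame (h x) ?I h.fr" by (rule h.fr)
    show "linear (A x)" "linear (t_tan x)" by (rule A_linear[OF x], rule t_tan_linear[OF x])
    show "h x (A x u) v = h x u (A x v)" for u v by (rule A_selfadjoint[OF x])
    show "h x (t_tan x u) v = - h x u (t_tan x v)" for u v by (rule t_tan_skew[OF x])
    show "linear (AnV x)" by (rule shape_linear[OF x nJ_smooth[OF W_smooth]])
    show "h x (AnV x u) v = h x u (AnV x v)" for u v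
      by (rule shape_selfadjoint[OF x nJ_smooth[OF W_smooth] nJ_normal])
    show "linear ?C" by (rule shape_linear[OF x nJ_smooth[OF d_smooth_field[OF T_smooth]]])
    show "h x (?C u) v = - h x (T x) (t_sff x u v)" for u v
      by (rule shape_nJ_tangent[OF x T_smooth])
    show "bilinear (t_sff x)" by (rule t_sff_bilinear[OF x])
    show "t_sff x u v = t_sff x v u" for u v by (rule t_sff_sym[OF x])
    show "h x (sub.covend t_tan x u v) w = h x (t_sff x u v) w - h x v (t_sff x u w)" for u v w
      by (rule covend_t_tan[OF x])
    show "sub.cov T x u = AnV x u - t_tan x (A x u)" for u by (rule cov_T[OF x])
    show "DP x w u v = (c / 4) *\<^sub>R (h x (sub.cov T x w) v *\<^sub>R t_tan x u + h x (T x) v *\<^sub>R sub.covend t_tan x w u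
      - h x (sub.cov T x w) u *\<^sub>R t_tan x v - h x (T x) u *\<^sub>R sub.covend t_tan x w v
      - (2 * h x u (sub.covend t_tan x w v)) *\<^sub>R T x - (2 * h x u (t_tan x v)) *\<^sub>R sub.cov T x w)" for w u v
      by (rule DP_def)
    show "linear (M x w u)" "lin_trace (M x w u) = 0" for w u
      by (rule M_linear[OF x], rule M_trace[OF x])
    show "h x (M x w u v) z = h x v (M x w u z)" for w u v z by (rule M_selfadjoint[OF x])
    show "M x w u v - M x w v u = DP x w u v" for w u v by (rule M_codazzi[OF x])
    show "M x u v w - M x v u w = sub.curv x u v (A x w) - A x (sub.curv x u v w)" for u v w
      by (rule M_ricci[OF x])
    show "h x (sub.curv x u v w) z = c / 4 * (h x v w * h x u z - h x u w * h x v z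
        + h x (t_tan x v) w * h x (t_tan x u) z - h x (t_tan x u) w * h x (t_tan x v) z
        + 2 * h x u (t_tan x v) * h x (t_tan x w) z)
      + (\<Sum>\<alpha>\<in>?\<Lambda>. h x (?a \<alpha> v) w * h x (?a \<alpha> u) z - h x (?a \<alpha> u) w * h x (?a \<alpha> v) z)" for u v w z
      by (rule gauss_equation_frame[OF x E dim])
    show "linear (?a \<alpha>)" if "\<alpha> \<in> ?\<Lambda>" for \<alpha>
      by (rule shape_linear[OF x E'(1)[OF that]])
    show "h x (?a \<alpha> u) v = h x u (?a \<alpha> v)" if "\<alpha> \<in> ?\<Lambda>" for \<alpha> u v
      by (rule shape_selfadjoint[OF x E'[OF that]])
  qed
  have lap: "1 / 2 * laplacian h (\<lambda>y. end_norm_sq (h y) (A y)) x =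
    (\<Sum>i\<in>?I. lin_trace (\<lambda>w. sub.covend A x (h.fr i) (sub.covend A x (h.fr i) w)))
    + (\<Sum>i\<in>?I. lin_trace (\<lambda>w. A x (M x (h.fr i) (h.fr i) w)))"
  proof -
    have r: "end_norm_sq (h y) (A y) = lin_trace (\<lambda>w. A y (A y w))" if "y \<in> S" for y
      by (rule inner_form.end_norm_sq_eq[of "h y" "A y", OF induced_form[OF that] A_linear[OF that]])
        (rule A_selfadjoint[OF that])
    have "fderiv (\<lambda>y. fderiv (\<lambda>y. end_norm_sq (h y) (A y)) y v) x u
        - fderiv (\<lambda>y. end_norm_sq (h y) (A y)) x (nabla h (\<lambda>_. u) (\<lambda>_. v) x) =
      2 * lin_trace (\<lambda>w. sub.covend A x u (sub.covend A x v w)) + 2 * lin_trace (\<lambda>w. A x (M x u v w))" for u v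
    proof -
      have n: "nabla h (\<lambda>_. u) (\<lambda>_. v) x = christoffel h x u v"
        by (simp add: nabla_def frechet_derivative_const)
      show ?thesis unfolding n by (rule hessian[of x "\<lambda>y. end_norm_sq (h y) (A y)", OF x r])
    qed
    then show ?thesis
      unfolding laplacian_def h.form_trace_fr by (simp add: sum.distrib flip: sum_distrib_left)
  qed
  have nab: "nabla_end_norm_sq h A x =
    (\<Sum>i\<in>?I. lin_trace (\<lambda>w. sub.covend A x (h.fr i) (sub.covend A x (h.fr i) w)))"
  proof -
    have "nabla_end h A x u v = sub.covend A x u v" for u v
      by (simp add: nabla_end_def nabla_def frechet_derivative_const sub.covend_def sub.cov_def)
    moreover have "(\<Sum>j\<in>?I. h x (sub.covend A x u (h.fr j)) (sub.covend A x u (h.fr j))) =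
        lin_trace (\<lambda>w. sub.covend A x u (sub.covend A x u w))" for u
      unfolding N_selfadjoint[OF x, of u "sub.covend A x u _", symmetric]
      by (rule alg.tr[OF linear_comp[OF N_linear[OF x] N_linear[OF x]]])
    ultimately show ?thesis
      by (simp only: nabla_end_norm_sq_def h.form_trace_fr)
  qed
  \<comment> \<open>The factor 1/m in the mean curvature cancels against m.\<close>
  have H: "real DIM('e) * h x (A x (tJ x (mean_curvature g F x))) (T x) =
      h x (A x (\<Sum>i\<in>?I. t_sff x (h.fr i) (h.fr i))) (T x)"
    unfolding mean_curvature_def h.form_trace_fr t_sff_def
    by (simp add: linear_scale[OF tJ_linear[OF x]] linear_sum[OF tJ_linear[OF x]]
        linear_scale[OF A_linear[OF x]] h.form_simps)
  have tr: "end_trace (h x) L = lin_trace L" if "linear L" for L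
    by (rule h.end_trace_eq[OF that])
  have a_lin: "linear (\<lambda>u. A x (?a \<alpha> u))" "linear (\<lambda>u. A x (A x (?a \<alpha> u)))"
    "linear (\<lambda>u. A x (?a \<alpha> (A x (?a \<alpha> u))) - A x (A x (?a \<alpha> (?a \<alpha> u))))" if "\<alpha> \<in> ?\<Lambda>" for \<alpha>
    by (intro linear_compose_sub linear_comp[OF A_linear[OF x]] linear_comp[OF alg.a_lin[OF that]]
        alg.a_lin[OF that])+
  have sum: "(\<Sum>\<alpha>\<in>?\<Lambda>. end_trace (h x) (\<lambda>u. A x (?a \<alpha> (A x (?a \<alpha> u))) - A x (A x (?a \<alpha> (?a \<alpha> u))))
      + end_trace (h x) (?a \<alpha>) * end_trace (h x) (\<lambda>u. A x (A x (?a \<alpha> u)))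
      - (end_trace (h x) (\<lambda>u. A x (?a \<alpha> u)))\<^sup>2) =
    (\<Sum>\<alpha>\<in>?\<Lambda>. lin_trace (\<lambda>u. A x (?a \<alpha> (A x (?a \<alpha> u)))) - lin_trace (\<lambda>u. A x (A x (?a \<alpha> (?a \<alpha> u))))
      + lin_trace (?a \<alpha>) * lin_trace (\<lambda>u. A x (A x (?a \<alpha> u))) - (lin_trace (\<lambda>u. A x (?a \<alpha> u)))\<^sup>2)"
    by (rule sum.cong[OF refl]) (simp only: tr[OF a_lin(1)] tr[OF a_lin(2)] tr[OF a_lin(3)]
        tr[OF alg.a_lin] lin_trace_diff)
  have fold_t_tan: "tJ y (d y u) = t_tan y u" for y u by (simp add: t_tan_def)
  have AA: "end_norm_sq (h x) (A x) = lin_trace (\<lambda>u. A x (A x u))"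
    by (rule h.end_norm_sq_eq[of "A x", OF A_linear[OF x]]) (rule A_selfadjoint[OF x])
  have tA: "end_norm_sq (h x) (\<lambda>u. t_tan x (A x u)) = (\<Sum>i\<in>?I. h x (t_tan x (A x (h.fr i))) (t_tan x (A x (h.fr i))))"
    by (simp add: end_norm_sq_def h.form_trace_fr)
  note trs = tr[OF alg.A_lin] tr[OF linear_comp[OF alg.A_lin alg.C_lin]]
    tr[OF linear_comp[OF alg.A_lin linear_comp[OF alg.t_lin alg.B_lin]]] tr[OF alg.linear_words(10)]
  show ?thesis
    unfolding Let_def tJ_def[symmetric] nJ_def[symmetric] fold_t_tan t_sff_def[symmetric]
    unfolding lap nab alg.simons_identity sum trs AA tA H[symmetric] h.form_trace_fr
    by simp
qed

end

section \<open>From manifolds and charts to a coordinate domain\<close>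

text \<open>Both sides are evaluated in a pair of charts, so the chart data only have to be
  restricted to the open set \<open>S\<close> on which the normal frame is given. Constant
  coordinate fields serve as test fields in the Kaehler and curvature conditions.\<close>

theorem theorem4p1:
  fixes \<Sigma> :: "'p topology" and \<A> :: "('p, 'e::euclidean_space) chart set"
    and N :: "'q topology" and \<B> :: "('q, 'f::euclidean_space) chart set"
    and g\<^sub>N :: "('q, 'f) chart \<Rightarrow> 'f \<Rightarrow> 'f \<Rightarrow> 'f \<Rightarrow> real"
    and J\<^sub>N :: "('q, 'f) chart \<Rightarrow> 'f \<Rightarrow> 'f \<Rightarrow> 'f"
    and f :: "'p \<Rightarrow> 'q" and V :: "('q, 'f) chart \<Rightarrow> 'p \<Rightarrow> 'f"
    and n m :: nat and c :: real
  assumes "complex_space_form n c N \<B> g\<^sub>N J\<^sub>N"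
    and "immersed_submanifold \<Sigma> \<A> N \<B> f"
    and "m = DIM('e)" and "m \<le> 2 * n - 1"
    and "vector_field_along \<Sigma> \<A> \<B> f V"
    and normal: "\<And>\<phi> \<psi>. \<phi> \<in> \<A> \<Longrightarrow> \<psi> \<in> \<B> \<Longrightarrow>
      normal_field_on (g\<^sub>N \<psi>) (rep f \<phi> \<psi>) (rep_dom f \<phi> \<psi>) (V \<psi> \<circ> chart_inv \<phi>)"
    and parallel: "\<And>\<phi> \<psi> x u. \<phi> \<in> \<A> \<Longrightarrow> \<psi> \<in> \<B> \<Longrightarrow> x \<in> rep_dom f \<phi> \<psi> \<Longrightarrow>
      normal_connection (g\<^sub>N \<psi>) (rep f \<phi> \<psi>) (V \<psi> \<circ> chart_inv \<phi>) x u = 0"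
    and trace_constant: "\<exists>k. \<forall>\<phi>\<in>\<A>. \<forall>\<psi>\<in>\<B>. \<forall>x\<in>rep_dom f \<phi> \<psi>.
      end_trace (induced_metric (g\<^sub>N \<psi>) (rep f \<phi> \<psi>) x)
        (shape_operator (g\<^sub>N \<psi>) (rep f \<phi> \<psi>) (V \<psi> \<circ> chart_inv \<phi>) x) = k"
  shows "\<forall>\<phi>\<in>\<A>. \<forall>\<psi>\<in>\<B>.
    let g = g\<^sub>N \<psi>; J = J\<^sub>N \<psi>; F = rep f \<phi> \<psi>; h = induced_metric g F; W = V \<psi> \<circ> chart_inv \<phi>
    in \<forall>S E. open S \<longrightarrow> S \<subseteq> rep_dom f \<phi> \<psi> \<longrightarrow> normal_frame_on g F S E \<longrightarrow> (\<forall>x\<in>S.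
      let \<tau> = (\<lambda>y w. tangential g F y (J (F y) w));
          \<eta> = (\<lambda>y w. normal_part g F y (J (F y) w));
          i = fderiv F x;
          \<sigma> = second_fundamental_form g F x;
          H = mean_curvature g F x;
          A = shape_operator g F W x;
          tV = \<tau> x (W x);
          A\<^sub>n\<^sub>V = shape_operator g F (\<lambda>y. \<eta> y (W y)) x;
          A\<^sub>n\<^sub>t\<^sub>V = shape_operator g F (\<lambda>y. \<eta> y (fderiv F y (\<tau> y (W y)))) x;
          A\<^sub>E = (\<lambda>\<alpha>. shape_operator g F (E \<alpha>) x);
          tr = end_trace (h x)
      in 1 / 2 * laplacian h (\<lambda>y. end_norm_sq (h y) (shape_operator g F W y)) x =
           nabla_end_norm_sq h (shape_operator g F W) x
           + c / 4 * (real m * end_norm_sq (h x) A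
               + 6 * end_norm_sq (h x) (\<lambda>u. \<tau> x (i (A u)))
               + 6 * tr (\<lambda>u. A (\<tau> x (i (A\<^sub>n\<^sub>V u))))
               + 3 * tr (\<lambda>u. A (A\<^sub>n\<^sub>t\<^sub>V u))
               - (tr A)\<^sup>2
               + 6 * tr (\<lambda>u. A (\<tau> x (i (A (\<tau> x (i u))))))
               + 3 * form_trace (h x) (\<lambda>u v. h x (\<tau> x (\<sigma> (A u) tV)) v)
               - 3 * form_trace (h x) (\<lambda>u v. h x (\<tau> x (\<sigma> (A tV) u)) v)
               + 3 * real m * h x (A (\<tau> x H)) tV)
           + (\<Sum>\<alpha> = m+1..2*n.
               tr (\<lambda>u. A (A\<^sub>E \<alpha> (A (A\<^sub>E \<alpha> u))) - A (A (A\<^sub>E \<alpha> (A\<^sub>E \<alpha> u))))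
               + tr (A\<^sub>E \<alpha>) * tr (\<lambda>u. A (A (A\<^sub>E \<alpha> u)))
               - (tr (\<lambda>u. A (A\<^sub>E \<alpha> u)))\<^sup>2))"
proof (intro ballI)
  fix \<phi> \<psi> assume \<phi>: "\<phi> \<in> \<A>" and \<psi>: "\<psi> \<in> \<B>"
  note form = assms(1) and imm = assms(2)
  have K: "kaehler_manifold N \<B> g\<^sub>N J\<^sub>N" and dimf: "DIM('f) = 2 * n"
    using form by (auto simp: complex_space_form_def)
  let ?\<Omega> = "chart_image \<psi>" and ?g = "g\<^sub>N \<psi>" and ?J = "J\<^sub>N \<psi>" and ?F = "rep f \<phi> \<psi>"
    and ?W = "V \<psi> \<circ> chart_inv \<phi>"
  have nab: "nabla ?g (\<lambda>_. u) Y y = fderiv Y y u + christoffel ?g y u (Y y)" for u Y y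
    by (simp add: nabla_def)
  have nab_const: "nabla ?g (\<lambda>_. u) (\<lambda>_. v) = (\<lambda>y. christoffel ?g y u v)" for u v
    by (simp add: nabla_def fun_eq_iff frechet_derivative_const)
  interpret R: riemannian_domain ?\<Omega> ?g
  proof (intro riemannian_domain.intro inner_form.intro)
    show "open ?\<Omega>"
      using K \<psi> by (simp add: kaehler_manifold_def smooth_manifold_def)
    show "smooth_on ?\<Omega> (\<lambda>y. ?g y u v)" for u v
      using K \<psi> by (simp add: kaehler_manifold_def riemannian_metric_def)
    fix y assume "y \<in> ?\<Omega>"
    then have "bilinear (?g y) \<and> (\<forall>u v. ?g y u v = ?g y v u) \<and> (\<forall>u. u \<noteq> 0 \<longrightarrow> ?g y u u > 0)"
      using K \<psi> by (simp add: kaehler_manifold_def riemannian_metric_def)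
    then show "bilinear (?g y)" "?g y u v = ?g y v u" "u \<noteq> 0 \<Longrightarrow> ?g y u u > 0" for u v
      by blast+
  qed
  have acs: "almost_complex_structure \<B> J\<^sub>N" using K by (simp add: kaehler_manifold_def)
  interpret SF: space_form_domain ?\<Omega> ?g ?J c
  proof (intro space_form_domain.intro space_form_domain_axioms.intro R.riemannian_domain_axioms)
    show "smooth_on ?\<Omega> (\<lambda>y. ?J y u)" for u
      using acs \<psi> by (simp add: almost_complex_structure_def)
    fix y assume y: "y \<in> ?\<Omega>"
    show "linear (?J y)" "?J y (?J y u) = - u" for u
      using acs \<psi> y by (simp_all add: almost_complex_structure_def)
    show "?g y (?J y u) (?J y v) = ?g y u v" for u v
      using K \<psi> y by (simp add: kaehler_manifold_def)
    show "R.cov (\<lambda>y. ?J y v) y u = ?J y (christoffel ?g y u v)" for u v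
    proof -
      have "nabla ?g (\<lambda>_. u) (\<lambda>y. ?J y v) y = ?J y (nabla ?g (\<lambda>_. u) (\<lambda>_. v) y)"
        using K \<psi> y smooth_on_const unfolding kaehler_manifold_def by fast
      then show ?thesis by (simp add: nab_const) (simp add: nab R.cov_def)
    qed
    show "R.curv y u v w = (c / 4) *\<^sub>R (?g y v w *\<^sub>R u - ?g y u w *\<^sub>R v + ?g y (?J y v) w *\<^sub>R ?J y u
       - ?g y (?J y u) w *\<^sub>R ?J y v + (2 * ?g y u (?J y v)) *\<^sub>R ?J y w)" for u v w
    proof -
      \<comment> \<open>Constant fields commute, and the derivative in the zero direction vanishes,
        so the bracket term of \<open>curvature\<close> disappears and the commutator
        \<open>R.curv\<close> remains.\<close>
      have "lie_bracket (\<lambda>_. u) (\<lambda>_. v) = (\<lambda>_. 0)"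
        by (simp add: lie_bracket_def fun_eq_iff frechet_derivative_const)
      moreover have "christoffel ?g y 0 w = 0" using linear_0[OF R.C_linear(2)[OF y]] .
      ultimately have "curvature ?g (\<lambda>_. u) (\<lambda>_. v) (\<lambda>_. w) y = R.curv y u v w"
        by (simp add: curvature_def nab_const) (simp add: nab R.curv_def R.cov_def)
      then show ?thesis
        using form \<psi> y smooth_on_const unfolding complex_space_form_def by metis
    qed
  qed
  have F_sm: "smooth_on (rep_dom f \<phi> \<psi>) ?F" and F_inj: "x \<in> rep_dom f \<phi> \<psi> \<Longrightarrow> inj (fderiv ?F x)" for x
    using imm \<phi> \<psi> by (simp_all add: immersed_submanifold_def)
  have F_in: "?F x \<in> ?\<Omega>" if x: "x \<in> rep_dom f \<phi> \<psi>" for x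
  proof -
    obtain p where p: "p \<in> fst \<phi>" "f p \<in> fst \<psi>" "x = snd \<phi> p"
      using x by (auto simp: rep_dom_def)
    have "homeomorphic_map (subtopology \<Sigma> (fst \<phi>)) (top_of_set (chart_image \<phi>)) (snd \<phi>)"
      and "openin \<Sigma> (fst \<phi>)"
      using imm \<phi> by (simp_all add: immersed_submanifold_def smooth_manifold_def)
    \<comment> \<open>Injectivity of the chart makes \<open>chart_inv\<close> recover the point
      \<open>p\<close> itself, and \<open>f p\<close> lies in the ambient chart domain by the choice
      of \<open>p\<close>.\<close>
    then have "inj_on (snd \<phi>) (fst \<phi>)"
      using homeomorphic_imp_injective_map openin_subset by (fastforce simp: Int_absorb1)
    then have "chart_inv \<phi> x = p" using p by (simp add: chart_inv_def)
    then show ?thesis using p by (simp add: rep_def chart_image_def)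
  qed
  have W_sm: "smooth_on (rep_dom f \<phi> \<psi>) ?W"
    using assms(5) \<phi> \<psi> by (simp add: vector_field_along_def)
  obtain k where k: "\<And>x. x \<in> rep_dom f \<phi> \<psi> \<Longrightarrow>
      end_trace (induced_metric ?g ?F x) (shape_operator ?g ?F ?W x) = k"
    using trace_constant \<phi> \<psi> by blast
  have main: "parallel_normal_field ?\<Omega> ?g ?J c S ?F ?W k"
    if S: "open S" "S \<subseteq> rep_dom f \<phi> \<psi>" for S
  proof -
    interpret I: immersed_domain ?\<Omega> ?g ?J c S ?F
      using S F_in F_inj smooth_on_subset[OF F_sm S(2)]
      by (intro immersed_domain.intro immersed_domain_axioms.intro SF.space_form_domain_axioms) auto
    have W: "smooth_on S ?W" by (rule smooth_on_subset[OF W_sm S(2)])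
    show ?thesis
    proof (intro parallel_normal_field.intro parallel_normal_field_axioms.intro
        I.immersed_domain_axioms W)
      show "normal_field_on ?g ?F S ?W"
        using normal[OF \<phi> \<psi>] S by (auto simp: normal_field_on_def)
      fix y assume y: "y \<in> S"
      show "normal_connection ?g ?F ?W y u = 0" for u
        by (rule parallel[OF \<phi> \<psi>]) (use y S in blast)
      show "lin_trace (shape_operator ?g ?F ?W y) = k"
        using k[of y] y S inner_form.end_trace_eq[OF I.induced_form[OF y] I.shape_linear[OF y W]]
        by auto
    qed
  qed
  have dim: "DIM('e) \<le> DIM('f)" using assms(3,4) dimf by simp
  have loc: "DIM('e) = m" "DIM('f) = 2 * n" using assms(3) dimf by simp_all
  note simons = parallel_normal_field.simons_formula_in_chart[OF main _ _ dim, unfolded loc]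
  show "let g = g\<^sub>N \<psi>; J = J\<^sub>N \<psi>; F = rep f \<phi> \<psi>; h = induced_metric g F; W = V \<psi> \<circ> chart_inv \<phi>
    in \<forall>S E. open S \<longrightarrow> S \<subseteq> rep_dom f \<phi> \<psi> \<longrightarrow> normal_frame_on g F S E \<longrightarrow> (\<forall>x\<in>S.
      let \<tau> = (\<lambda>y w. tangential g F y (J (F y) w));
          \<eta> = (\<lambda>y w. normal_part g F y (J (F y) w));
          i = fderiv F x;
          \<sigma> = second_fundamental_form g F x;
          H = mean_curvature g F x;
          A = shape_operator g F W x;
          tV = \<tau> x (W x);
          A\<^sub>n\<^sub>V = shape_operator g F (\<lambda>y. \<eta> y (W y)) x;
          A\<^sub>n\<^sub>t\<^sub>V = shape_operator g F (\<lambda>y. \<eta> y (fderiv F y (\<tau> y (W y)))) x;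
          A\<^sub>E = (\<lambda>\<alpha>. shape_operator g F (E \<alpha>) x);
          tr = end_trace (h x)
      in 1 / 2 * laplacian h (\<lambda>y. end_norm_sq (h y) (shape_operator g F W y)) x =
           nabla_end_norm_sq h (shape_operator g F W) x
           + c / 4 * (real m * end_norm_sq (h x) A
               + 6 * end_norm_sq (h x) (\<lambda>u. \<tau> x (i (A u)))
               + 6 * tr (\<lambda>u. A (\<tau> x (i (A\<^sub>n\<^sub>V u))))
               + 3 * tr (\<lambda>u. A (A\<^sub>n\<^sub>t\<^sub>V u))
               - (tr A)\<^sup>2
               + 6 * tr (\<lambda>u. A (\<tau> x (i (A (\<tau> x (i u))))))
               + 3 * form_trace (h x) (\<lambda>u v. h x (\<tau> x (\<sigma> (A u) tV)) v)
               - 3 * form_trace (h x) (\<lambda>u v. h x (\<tau> x (\<sigma> (A tV) u)) v)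
               + 3 * real m * h x (A (\<tau> x H)) tV)
           + (\<Sum>\<alpha> = m+1..2*n.
               tr (\<lambda>u. A (A\<^sub>E \<alpha> (A (A\<^sub>E \<alpha> u))) - A (A (A\<^sub>E \<alpha> (A\<^sub>E \<alpha> u))))
               + tr (A\<^sub>E \<alpha>) * tr (\<lambda>u. A (A (A\<^sub>E \<alpha> u)))
               - (tr (\<lambda>u. A (A\<^sub>E \<alpha> u)))\<^sup>2))"
    using simons unfolding Let_def by blast
qed

end
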